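(* Let $(H,A,\gamma)$ be a Dirac system with constant coefficients and let $H_0=\ker A$. Regular self-adjoint boundary conditions exist if and only if $(H_0,\omega)$ is a Hermitian symplectic vector space (where $H_0=0$ is not excluded). In that case, regular self-adjoint boundary conditions are given by the following data: a Lagrangian subspace $L\subset H_0$, an orthogonal decomposition $H_<=F\oplus V$, where $F\subset H^{1/2}_<$ is of finite dimension, and a $1/2$-smooth map $g:V\oplus L\to V\oplus L$ with $g^*=g$. The regular self-adjoint boundary condition $B$ given by such data is $$B=\gamma F\oplus\{w+\gamma gw : w\in(V\oplus L)\cap H^{1/2}\}.$$ (That is, every such choice of data yields a regular self-adjoint boundary condition $B$ by this formula, and every regular self-adjoint boundary condition is of this form.)
   Context: A Dirac system with constant coefficients is a triple $(H,A,\gamma)$: $H$ is a separable complex Hilbert space with inner product $\langle\cdot,\cdot\rangle$; $A$ is a self-adjoint operator in $H$ with domain $H_A$ such that $H_A\to H$ is compact for the graph norm; $\gamma$ is a bounded operator on $H$, restricting to a bounded operator on $H_A$, with $-\gamma=\gamma^*=\gamma^{-1}$ on $H$ and $A\gamma+\gamma A=0$ on $H_A$. For $s\ge0$ let $H^s$ be the domain of $|A|^s$ with norm $\|x\|_s=\|(I+A^2)^{s/2}x\|$; for $s<0$ let $H^s$ be the completion of $\bigcap_{r\ge0}H^r$ in $\|\cdot\|_s$. The spaces $H^s$ and $H^{-s}$ are dually paired by $B_s(x,y)=\langle(I+A^2)^{s/2}x,(I+A^2)^{-s/2}y\rangle$. For $J\subset\mathbb{R}$ let $Q_J$ be the spectral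 projection of $A$, $H^s_J=Q_J(H^s)$; $H_<=Q_{(-\infty,0)}(H)$, $H^{1/2}_<=H^{1/2}_{(-\infty,0)}$, $H_0=Q_{\{0\}}(H)=\ker A$. Put $\check H=H^{1/2}_{(-\infty,0]}\oplus H^{-1/2}_{(0,\infty)}$ with its Hilbert sum norm. On $\check H$ consider the non-degenerate form $\omega(x,y)=B_{1/2}(Q_{(-\infty,0]}x,\gamma Q_{[0,\infty)}y)+B_{-1/2}(Q_{(0,\infty)}x,\gamma Q_{(-\infty,0)}y)$, which extends $\langle x,\gamma y\rangle$. A boundary condition is a closed linear subspace $B\subset\check H$; $B^a=\{y\in\check H:\omega(x,y)=0\ \forall x\in B\}$. $B$ is regular if $B\subset H^{1/2}$, self-adjoint if $B=B^a$. $(H_0,\omega)$ is called a Hermitian symplectic vector space if the $\pm1$-eigenspaces of the involution $i\gamma$ of $H_0$ have equal dimension; then a subspace $L\subset H_0$ is Lagrangian if $L\perp\gamma L$ and $L\oplus\gamma L=H_0$. A bounded linear map $g$ of a closed subspace $U$ of $H$ to itself is $1/2$-smooth if both $g$ and its adjoint $g^*$ map $U\cap H^{1/2}$ to itself. *)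

theory Defs
  imports "HOL-Analysis.Analysis"
begin

section \<open>Complex Hilbert spaces\<close>

text \<open>
  The inner product is linear in the first argument and conjugate linear in the second one.
  Norm and topology are the ones of the underlying real inner product, the real part of the
  complex one.
\<close>

class complex_hilbert = real_inner + complete_space +
  fixes scaleC :: "complex \<Rightarrow> 'a \<Rightarrow> 'a"  (infixr "*\<^sub>C" 75)
    and cinner :: "'a \<Rightarrow> 'a \<Rightarrow> complex"
  assumes scaleC_add_right: "c *\<^sub>C (x + y) = c *\<^sub>C x + c *\<^sub>C y"
    and scaleC_add_left: "(c + d) *\<^sub>C x = c *\<^sub>C x + d *\<^sub>C x"
    and scaleC_scaleC: "c *\<^sub>C (d *\<^sub>C x) = (c * d) *\<^sub>C x"
    and scaleC_of_real: "complex_of_real r *\<^sub>C x = r *\<^sub>R x"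
    and cinner_add_left: "cinner (x + y) z = cinner x z + cinner y z"
    and cinner_scaleC_left: "cinner (c *\<^sub>C x) y = c * cinner x y"
    and cinner_commute: "cinner x y = cnj (cinner y x)"
    and Re_cinner: "Re (cinner x y) = inner x y"

subclass (in complex_hilbert) banach ..

global_interpretation complex_vector: vector_space "scaleC :: complex \<Rightarrow> 'a \<Rightarrow> 'a::complex_hilbert"
proof
  show "1 *\<^sub>C x = x" for x :: 'a
    using scaleC_of_real[of 1 x] by simp
qed (simp_all add: scaleC_add_right scaleC_add_left scaleC_scaleC)

definition finite_dimensional :: "'a::complex_hilbert set \<Rightarrow> bool" where
  "finite_dimensional S \<longleftrightarrow> (\<exists>T. finite T \<and> S = complex_vector.span T)"

definition sum_set :: "'a::plus set \<Rightarrow> 'a set \<Rightarrow> 'a set" where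
  "sum_set S T = {x + y | x y. x \<in> S \<and> y \<in> T}"

definition orthogonal_sets :: "'a::complex_hilbert set \<Rightarrow> 'a set \<Rightarrow> bool" where
  "orthogonal_sets S T \<longleftrightarrow> (\<forall>x\<in>S. \<forall>y\<in>T. cinner x y = 0)"

definition orth_proj :: "'a::complex_hilbert set \<Rightarrow> 'a \<Rightarrow> 'a" where
  "orth_proj S x = (THE y. y \<in> S \<and> (\<forall>z\<in>S. cinner (x - y) z = 0))"

definition clinear_on :: "'a::complex_hilbert set \<Rightarrow> ('a \<Rightarrow> 'b::complex_hilbert) \<Rightarrow> bool" where
  "clinear_on S f \<longleftrightarrow>
     (\<forall>x\<in>S. \<forall>y\<in>S. f (x + y) = f x + f y) \<and> (\<forall>c. \<forall>x\<in>S. f (c *\<^sub>C x) = c *\<^sub>C f x)"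

definition bounded_endo :: "'a::complex_hilbert set \<Rightarrow> ('a \<Rightarrow> 'a) \<Rightarrow> bool" where
  "bounded_endo U f \<longleftrightarrow>
     f ` U \<subseteq> U \<and> clinear_on U f \<and> (\<exists>C. \<forall>x\<in>U. norm (f x) \<le> C * norm x)"

definition is_adjoint_on :: "'a::complex_hilbert set \<Rightarrow> ('a \<Rightarrow> 'a) \<Rightarrow> ('a \<Rightarrow> 'a) \<Rightarrow> bool" where
  "is_adjoint_on U f f' \<longleftrightarrow> f' ` U \<subseteq> U \<and> (\<forall>x\<in>U. \<forall>y\<in>U. cinner (f x) y = cinner x (f' y))"


section \<open>Dirac systems with constant coefficients\<close>

text \<open>
  An unbounded operator is given by its domain \<open>D\<close> and a function \<open>A\<close>, of which only the values
  on \<open>D\<close> matter.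
\<close>

definition op_graph :: "'a set \<Rightarrow> ('a \<Rightarrow> 'a) \<Rightarrow> ('a \<times> 'a) set" where
  "op_graph D A = {(x, A x) | x. x \<in> D}"

definition adjoint_graph :: "'a::complex_hilbert set \<Rightarrow> ('a \<Rightarrow> 'a) \<Rightarrow> ('a \<times> 'a) set" where
  "adjoint_graph D A = {(y, z). \<forall>x\<in>D. cinner (A x) y = cinner x z}"

definition selfadjoint_operator :: "'a::complex_hilbert set \<Rightarrow> ('a \<Rightarrow> 'a) \<Rightarrow> bool" where
  "selfadjoint_operator D A \<longleftrightarrow>
     complex_vector.subspace D \<and> closure D = UNIV \<and> clinear_on D A \<and>
     adjoint_graph D A = op_graph D A"

definition graph_norm :: "('a::complex_hilbert \<Rightarrow> 'a) \<Rightarrow> 'a \<Rightarrow> real" where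
  "graph_norm A x = sqrt ((norm x)\<^sup>2 + (norm (A x))\<^sup>2)"

definition dirac_system ::
    "'h::{complex_hilbert, second_countable_topology} set \<Rightarrow> ('h \<Rightarrow> 'h) \<Rightarrow> ('h \<Rightarrow> 'h) \<Rightarrow> bool" where
  "dirac_system D A \<gamma> \<longleftrightarrow>
     selfadjoint_operator D A \<and>
     compact (closure {x \<in> D. graph_norm A x \<le> 1}) \<and>
     bounded_endo UNIV \<gamma> \<and>
     \<gamma> ` D \<subseteq> D \<and> (\<exists>C. \<forall>x\<in>D. graph_norm A (\<gamma> x) \<le> C * graph_norm A x) \<and>
     is_adjoint_on UNIV \<gamma> (\<lambda>x. - \<gamma> x) \<and>
     (\<forall>x. \<gamma> (- \<gamma> x) = x \<and> - \<gamma> (\<gamma> x) = x) \<and>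
     (\<forall>x\<in>D. A (\<gamma> x) + \<gamma> (A x) = 0)"


section \<open>Functional calculus and Sobolev spaces\<close>

definition eigenspace :: "'h::complex_hilbert set \<Rightarrow> ('h \<Rightarrow> 'h) \<Rightarrow> real \<Rightarrow> 'h set" where
  "eigenspace D A t = {x \<in> D. A x = t *\<^sub>R x}"

text \<open>
  A self-adjoint operator whose domain embeds compactly has discrete real spectrum, and its spectral
  measure is the sum of the orthogonal projections onto the eigenspaces. So \<open>f(A)\<close> is the
  (unordered) sum of the \<open>f(t)\<close> times the projections onto \<open>ker (A - t)\<close>, on the domain of those
  \<open>x\<close> for which the squares of the norms of the summands have finite sum. This makes sense
  for all functions \<open>f\<close> and all sets of reals, measurable or not.
\<close>

definition fun_calc_dom :: "'h::complex_hilbert set \<Rightarrow> ('h \<Rightarrow> 'h) \<Rightarrow> (real \<Rightarrow> real) \<Rightarrow> 'h set" where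
  "fun_calc_dom D A f =
     {x. (\<lambda>t. (norm (f t *\<^sub>R orth_proj (eigenspace D A t) x))\<^sup>2) summable_on UNIV}"

definition fun_calc :: "'h::complex_hilbert set \<Rightarrow> ('h \<Rightarrow> 'h) \<Rightarrow> (real \<Rightarrow> real) \<Rightarrow> 'h \<Rightarrow> 'h" where
  "fun_calc D A f x = (\<Sum>\<^sub>\<infinity>t. f t *\<^sub>R orth_proj (eigenspace D A t) x)"

definition spec_proj :: "'h::complex_hilbert set \<Rightarrow> ('h \<Rightarrow> 'h) \<Rightarrow> real set \<Rightarrow> 'h \<Rightarrow> 'h" where
  "spec_proj D A J = fun_calc D A (indicator J)"

text \<open>\<open>bessel D A s\<close> is \<open>(I + A\<^sup>2)\<^bsup>s/2\<^esup>\<close>.\<close>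

definition bessel :: "'h::complex_hilbert set \<Rightarrow> ('h \<Rightarrow> 'h) \<Rightarrow> real \<Rightarrow> 'h \<Rightarrow> 'h" where
  "bessel D A s = fun_calc D A (\<lambda>t. (1 + t\<^sup>2) powr (s / 2))"

definition sob_norm :: "'h::complex_hilbert set \<Rightarrow> ('h \<Rightarrow> 'h) \<Rightarrow> real \<Rightarrow> 'h \<Rightarrow> real" where
  "sob_norm D A s x = norm (bessel D A s x)"

text \<open>
  The domain of \<open>|A|\<^bsup>s\<^esup>\<close>, for \<open>s \<ge> 0\<close>. The convention \<open>0 powr 0 = 0\<close> is harmless, since the term
  \<open>t = 0\<close> does not influence summability.
\<close>

definition sob :: "'h::complex_hilbert set \<Rightarrow> ('h \<Rightarrow> 'h) \<Rightarrow> real \<Rightarrow> 'h set" where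
  "sob D A s = fun_calc_dom D A (\<lambda>t. \<bar>t\<bar> powr s)"

definition sob_inf :: "'h::complex_hilbert set \<Rightarrow> ('h \<Rightarrow> 'h) \<Rightarrow> 'h set" where
  "sob_inf D A = (\<Inter>r\<in>{0..}. sob D A r)"

definition sob_spec :: "'h::complex_hilbert set \<Rightarrow> ('h \<Rightarrow> 'h) \<Rightarrow> real \<Rightarrow> real set \<Rightarrow> 'h set" where
  "sob_spec D A s J = spec_proj D A J ` sob D A s"

text \<open>
  For \<open>s < 0\<close>, the space \<open>H\<^bsup>s\<^esup>\<close> is the (automatically complete) type \<open>'k\<close> together with
  the canonical map \<open>\<iota>\<close> of \<open>sob_inf D A\<close> to it. The definitions below and the theorem are about
  an arbitrary such completion \<open>\<iota>\<close>, which is determined up to unique isometry.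
\<close>

definition is_sob_completion ::
    "'h::complex_hilbert set \<Rightarrow> ('h \<Rightarrow> 'h) \<Rightarrow> real \<Rightarrow> ('h \<Rightarrow> 'k::complex_hilbert) \<Rightarrow> bool" where
  "is_sob_completion D A s \<iota> \<longleftrightarrow>
     clinear_on (sob_inf D A) \<iota> \<and>
     (\<forall>x\<in>sob_inf D A. norm (\<iota> x) = sob_norm D A s x) \<and>
     closure (\<iota> ` sob_inf D A) = UNIV"

text \<open>
  Extension by continuity: the value at \<open>p\<close> is the limit of \<open>T u\<close> as \<open>j u\<close> tends to \<open>p\<close> with
  \<open>u \<in> S\<close>.
\<close>

definition cont_ext :: "'u set \<Rightarrow> ('u \<Rightarrow> 'x::topological_space) \<Rightarrow> ('u \<Rightarrow> 'y::t2_space) \<Rightarrow> 'x \<Rightarrow> 'y" where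
  "cont_ext S j T p = Lim (inf (filtercomap j (nhds p)) (principal S)) T"

text \<open>
  From here on, \<open>\<iota>\<close> is a completion for \<open>s = -1/2\<close>, that is, \<open>'k\<close> is \<open>H\<^bsup>-1/2\<^esup>\<close>. It contains
  \<open>H\<close>, and hence \<open>H\<^bsup>s\<^esup>\<close> for \<open>s \<ge> 0\<close>, by means of the continuous extension of \<open>\<iota>\<close> to \<open>H\<close>.
\<close>

definition emb :: "'h::complex_hilbert set \<Rightarrow> ('h \<Rightarrow> 'h) \<Rightarrow> ('h \<Rightarrow> 'k::complex_hilbert) \<Rightarrow> 'h \<Rightarrow> 'k" where
  "emb D A \<iota> = cont_ext (sob_inf D A) (\<lambda>u. u) \<iota>"

definition H_half :: "'h::complex_hilbert set \<Rightarrow> ('h \<Rightarrow> 'h) \<Rightarrow> ('h \<Rightarrow> 'k::complex_hilbert) \<Rightarrow> 'k set" where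
  "H_half D A \<iota> = emb D A \<iota> ` sob D A (1/2)"

text \<open>The element of \<open>H\<^bsup>1/2\<^esup>\<close>, as a subset of \<open>H\<close>, corresponding to an element of \<open>H_half\<close>.\<close>

definition from_half :: "'h::complex_hilbert set \<Rightarrow> ('h \<Rightarrow> 'h) \<Rightarrow> ('h \<Rightarrow> 'k::complex_hilbert) \<Rightarrow> 'k \<Rightarrow> 'h" where
  "from_half D A \<iota> = inv_into (sob D A (1/2)) (emb D A \<iota>)"

text \<open>The extensions to \<open>H\<^bsup>-1/2\<^esup>\<close> of the spectral projections, of \<open>\<gamma>\<close>, and of \<open>(I + A\<^sup>2)\<^bsup>-1/4\<^esup>\<close>.\<close>

definition spec_proj_ext ::
    "'h::complex_hilbert set \<Rightarrow> ('h \<Rightarrow> 'h) \<Rightarrow> ('h \<Rightarrow> 'k::complex_hilbert) \<Rightarrow> real set \<Rightarrow> 'k \<Rightarrow> 'k" where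
  "spec_proj_ext D A \<iota> J = cont_ext (sob_inf D A) \<iota> (\<lambda>u. \<iota> (spec_proj D A J u))"

definition gamma_ext ::
    "'h::complex_hilbert set \<Rightarrow> ('h \<Rightarrow> 'h) \<Rightarrow> ('h \<Rightarrow> 'h) \<Rightarrow> ('h \<Rightarrow> 'k::complex_hilbert) \<Rightarrow> 'k \<Rightarrow> 'k" where
  "gamma_ext D A \<gamma> \<iota> = cont_ext (sob_inf D A) \<iota> (\<lambda>u. \<iota> (\<gamma> u))"

definition bessel_ext ::
    "'h::complex_hilbert set \<Rightarrow> ('h \<Rightarrow> 'h) \<Rightarrow> ('h \<Rightarrow> 'k::complex_hilbert) \<Rightarrow> 'k \<Rightarrow> 'h" where
  "bessel_ext D A \<iota> = cont_ext (sob_inf D A) \<iota> (bessel D A (-1/2))"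

text \<open>The pairings \<open>B\<^bsub>1/2\<^esub>\<close> and \<open>B\<^bsub>-1/2\<^esub>\<close>.\<close>

definition pairing_pos ::
    "'h::complex_hilbert set \<Rightarrow> ('h \<Rightarrow> 'h) \<Rightarrow> ('h \<Rightarrow> 'k::complex_hilbert) \<Rightarrow> 'k \<Rightarrow> 'k \<Rightarrow> complex" where
  "pairing_pos D A \<iota> x y = cinner (bessel D A (1/2) (from_half D A \<iota> x)) (bessel_ext D A \<iota> y)"

definition pairing_neg ::
    "'h::complex_hilbert set \<Rightarrow> ('h \<Rightarrow> 'h) \<Rightarrow> ('h \<Rightarrow> 'k::complex_hilbert) \<Rightarrow> 'k \<Rightarrow> 'k \<Rightarrow> complex" where
  "pairing_neg D A \<iota> x y = cinner (bessel_ext D A \<iota> x) (bessel D A (1/2) (from_half D A \<iota> y))"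


section \<open>Boundary conditions\<close>

definition check_H :: "'h::complex_hilbert set \<Rightarrow> ('h \<Rightarrow> 'h) \<Rightarrow> ('h \<Rightarrow> 'k::complex_hilbert) \<Rightarrow> 'k set" where
  "check_H D A \<iota> =
     sum_set (emb D A \<iota> ` sob_spec D A (1/2) {..0}) (range (spec_proj_ext D A \<iota> {0<..}))"

definition check_norm ::
    "'h::complex_hilbert set \<Rightarrow> ('h \<Rightarrow> 'h) \<Rightarrow> ('h \<Rightarrow> 'k::complex_hilbert) \<Rightarrow> 'k \<Rightarrow> real" where
  "check_norm D A \<iota> x =
     sqrt ((sob_norm D A (1/2) (from_half D A \<iota> (spec_proj_ext D A \<iota> {..0} x)))\<^sup>2
           + (norm (spec_proj_ext D A \<iota> {0<..} x))\<^sup>2)"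

definition omega ::
    "'h::complex_hilbert set \<Rightarrow> ('h \<Rightarrow> 'h) \<Rightarrow> ('h \<Rightarrow> 'h) \<Rightarrow> ('h \<Rightarrow> 'k::complex_hilbert) \<Rightarrow> 'k \<Rightarrow> 'k \<Rightarrow> complex" where
  "omega D A \<gamma> \<iota> x y =
     pairing_pos D A \<iota> (spec_proj_ext D A \<iota> {..0} x) (gamma_ext D A \<gamma> \<iota> (spec_proj_ext D A \<iota> {0..} y))
   + pairing_neg D A \<iota> (spec_proj_ext D A \<iota> {0<..} x) (gamma_ext D A \<gamma> \<iota> (spec_proj_ext D A \<iota> {..<0} y))"

definition boundary_condition ::
    "'h::complex_hilbert set \<Rightarrow> ('h \<Rightarrow> 'h) \<Rightarrow> ('h \<Rightarrow> 'k::complex_hilbert) \<Rightarrow> 'k set \<Rightarrow> bool" where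
  "boundary_condition D A \<iota> B \<longleftrightarrow>
     complex_vector.subspace B \<and> B \<subseteq> check_H D A \<iota> \<and>
     (\<forall>u. \<forall>x\<in>check_H D A \<iota>.
        (\<forall>n. u n \<in> B) \<and> (\<lambda>n::nat. check_norm D A \<iota> (u n - x)) \<longlonglongrightarrow> 0 \<longrightarrow> x \<in> B)"

definition adjoint_condition ::
    "'h::complex_hilbert set \<Rightarrow> ('h \<Rightarrow> 'h) \<Rightarrow> ('h \<Rightarrow> 'h) \<Rightarrow> ('h \<Rightarrow> 'k::complex_hilbert) \<Rightarrow> 'k set \<Rightarrow> 'k set" where
  "adjoint_condition D A \<gamma> \<iota> B = {y \<in> check_H D A \<iota>. \<forall>x\<in>B. omega D A \<gamma> \<iota> x y = 0}"

definition regular_condition ::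
    "'h::complex_hilbert set \<Rightarrow> ('h \<Rightarrow> 'h) \<Rightarrow> ('h \<Rightarrow> 'k::complex_hilbert) \<Rightarrow> 'k set \<Rightarrow> bool" where
  "regular_condition D A \<iota> B \<longleftrightarrow> B \<subseteq> H_half D A \<iota>"

definition selfadjoint_condition ::
    "'h::complex_hilbert set \<Rightarrow> ('h \<Rightarrow> 'h) \<Rightarrow> ('h \<Rightarrow> 'h) \<Rightarrow> ('h \<Rightarrow> 'k::complex_hilbert) \<Rightarrow> 'k set \<Rightarrow> bool" where
  "selfadjoint_condition D A \<gamma> \<iota> B \<longleftrightarrow> B = adjoint_condition D A \<gamma> \<iota> B"

definition regular_selfadjoint_bc ::
    "'h::complex_hilbert set \<Rightarrow> ('h \<Rightarrow> 'h) \<Rightarrow> ('h \<Rightarrow> 'h) \<Rightarrow> ('h \<Rightarrow> 'k::complex_hilbert) \<Rightarrow> 'k set \<Rightarrow> bool" where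
  "regular_selfadjoint_bc D A \<gamma> \<iota> B \<longleftrightarrow>
     boundary_condition D A \<iota> B \<and> regular_condition D A \<iota> B \<and> selfadjoint_condition D A \<gamma> \<iota> B"


section \<open>The kernel and the data\<close>

definition ker_op :: "'h::complex_hilbert set \<Rightarrow> ('h \<Rightarrow> 'h) \<Rightarrow> 'h set" where
  "ker_op D A = {x \<in> D. A x = 0}"

definition H_neg :: "'h::complex_hilbert set \<Rightarrow> ('h \<Rightarrow> 'h) \<Rightarrow> 'h set" where
  "H_neg D A = range (spec_proj D A {..<0})"

text \<open>
  The dimension below is the library's natural number valued one, which is the true dimension
  here: the kernel is finite dimensional, since the unit ball of \<open>D\<close> is relatively compact.
\<close>

definition hermitian_symplectic :: "'h::complex_hilbert set \<Rightarrow> ('h \<Rightarrow> 'h) \<Rightarrow> ('h \<Rightarrow> 'h) \<Rightarrow> bool" where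
  "hermitian_symplectic D A \<gamma> \<longleftrightarrow>
     complex_vector.dim {x \<in> ker_op D A. \<i> *\<^sub>C \<gamma> x = x}
     = complex_vector.dim {x \<in> ker_op D A. \<i> *\<^sub>C \<gamma> x = - x}"

definition lagrangian :: "'h::complex_hilbert set \<Rightarrow> ('h \<Rightarrow> 'h) \<Rightarrow> ('h \<Rightarrow> 'h) \<Rightarrow> 'h set \<Rightarrow> bool" where
  "lagrangian D A \<gamma> L \<longleftrightarrow>
     complex_vector.subspace L \<and> L \<subseteq> ker_op D A \<and>
     orthogonal_sets L (\<gamma> ` L) \<and> sum_set L (\<gamma> ` L) = ker_op D A"

definition half_smooth :: "'h::complex_hilbert set \<Rightarrow> ('h \<Rightarrow> 'h) \<Rightarrow> 'h set \<Rightarrow> ('h \<Rightarrow> 'h) \<Rightarrow> bool" where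
  "half_smooth D A U g \<longleftrightarrow>
     complex_vector.subspace U \<and> closed U \<and> bounded_endo U g \<and>
     g ` (U \<inter> sob D A (1/2)) \<subseteq> U \<inter> sob D A (1/2) \<and>
     (\<exists>g'. is_adjoint_on U g g' \<and> g' ` (U \<inter> sob D A (1/2)) \<subseteq> U \<inter> sob D A (1/2))"

definition bc_data ::
    "'h::complex_hilbert set \<Rightarrow> ('h \<Rightarrow> 'h) \<Rightarrow> ('h \<Rightarrow> 'h) \<Rightarrow> 'h set \<Rightarrow> 'h set \<Rightarrow> 'h set \<Rightarrow> ('h \<Rightarrow> 'h) \<Rightarrow> bool" where
  "bc_data D A \<gamma> L F V g \<longleftrightarrow>
     lagrangian D A \<gamma> L \<and>
     complex_vector.subspace F \<and> complex_vector.subspace V \<and>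
     orthogonal_sets F V \<and> sum_set F V = H_neg D A \<and>
     F \<subseteq> sob_spec D A (1/2) {..<0} \<and> finite_dimensional F \<and>
     half_smooth D A (sum_set V L) g \<and> is_adjoint_on (sum_set V L) g g"

definition bc_graph ::
    "'h::complex_hilbert set \<Rightarrow> ('h \<Rightarrow> 'h) \<Rightarrow> ('h \<Rightarrow> 'h) \<Rightarrow> 'h set \<Rightarrow> 'h set \<Rightarrow> ('h \<Rightarrow> 'h) \<Rightarrow> 'h set" where
  "bc_graph D A \<gamma> L V g = {w + \<gamma> (g w) | w. w \<in> sum_set V L \<inter> sob D A (1/2)}"

definition bc_of_data ::
    "'h::complex_hilbert set \<Rightarrow> ('h \<Rightarrow> 'h) \<Rightarrow> ('h \<Rightarrow> 'h) \<Rightarrow> ('h \<Rightarrow> 'k::complex_hilbert) \<Rightarrow>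
       'h set \<Rightarrow> 'h set \<Rightarrow> 'h set \<Rightarrow> ('h \<Rightarrow> 'h) \<Rightarrow> 'k set" where
  "bc_of_data D A \<gamma> \<iota> L F V g = emb D A \<iota> ` sum_set (\<gamma> ` F) (bc_graph D A \<gamma> L V g)"

end

theory Submission
  imports Defs
begin

text \<open>
  The theorem is symplectic linear algebra, once the boundary space is flattened. The spectral
  theorem splits \<open>H\<close> into the eigenspaces of \<open>A\<close>; let \<open>P t\<close> be the projection onto the eigenspace of
  \<open>t\<close>. Multiply the component of \<open>x\<close> at \<open>t\<close> by \<open>lam t = (1 + t\<^sup>2)\<^bsup>1/4\<^esup>\<close> if \<open>t \<le> 0\<close> and by its inverse if
  \<open>t > 0\<close>. This map \<open>M\<close> extends from \<open>H\<^bsup>1/2\<^esup>\<close> to an isometry of the boundary space onto \<open>H\<close>. Since \<open>\<gamma>\<close>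
  exchanges the eigenspaces of \<open>t\<close> and \<open>-t\<close>, whose weights are inverse to each other, the isometry
  carries \<open>\<omega>\<close> to \<open>\<langle>x, \<gamma> y\<rangle>\<close>. So a regular self-adjoint boundary condition is the same as a subspace
  \<open>X\<close> of \<open>H\<^bsup>1/2\<^esup>\<close> such that \<open>S = M X\<close> is the annihilator of itself with respect to \<open>\<langle>x, \<gamma> y\<rangle>\<close>; this is
  the predicate \<open>half_lag X\<close>. The completion \<open>H\<^bsup>-1/2\<^esup>\<close> has disappeared.

  Data give such an \<open>X\<close> (\<open>half_lag_of_data\<close>). Isotropy is the symmetry of \<open>g\<close>. If \<open>b\<close> is in the
  annihilator of \<open>S\<close>, subtract the element of the graph with the same component in \<open>V \<oplus> L\<close>. What
  remains lies in the positive part and comes from \<open>\<gamma> F\<close>, because a vector that annihilates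
  \<open>V \<inter> H\<^bsup>1/2\<^esup>\<close> in the pairing of \<open>H\<^bsup>1/2\<^esup>\<close> and \<open>H\<^bsup>-1/2\<^esup>\<close> belongs to the finite dimensional \<open>F\<close>.

  Conversely let \<open>X\<close> be given. Regularity and the uniform boundedness principle show that \<open>A\<close> is
  bounded on the positive parts of elements of \<open>S\<close> by the norm on \<open>S\<close>. As the domain of \<open>A\<close> embeds
  compactly, \<open>N = X \<inter> H\<^sub>>\<close> has finite dimension and the projection of \<open>S\<close> to the nonpositive part is
  closed, hence equal to the annihilator of the elements of \<open>S\<close> with nonnegative spectral support.
  This solvability statement does all the work. It shows that the kernel parts of these elements
  form a Lagrangian subspace \<open>L\<close> of the kernel (symplectic reduction). With \<open>F = \<gamma> N\<close> and \<open>V\<close> its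
  complement in \<open>H\<^sub><\<close>, it also gives for each \<open>u\<close> in \<open>(V \<oplus> L) \<inter> H\<^bsup>1/2\<^esup>\<close> exactly one
  \<open>w = g0 u\<close> in \<open>V \<oplus> L\<close> with \<open>u + \<gamma> w \<in> X\<close>. The map \<open>g0\<close> is symmetric, so it is bounded in
  the norm of \<open>H\<^bsup>1/2\<^esup>\<close> by uniform boundedness. A symmetric map that is bounded in the finer norm is
  bounded in \<open>H\<close>: the sequence \<open>\<parallel>g0\<^sup>k u\<parallel>\<close> is logarithmically convex and grows at most like \<open>C\<^sup>k\<close>,
  hence its first step has ratio at most \<open>C\<close>. So \<open>g0\<close> extends to \<open>g\<close>.

  Hence a regular self-adjoint condition yields a Lagrangian subspace of the kernel, and a Lagrangian
  subspace yields a condition with \<open>F = 0\<close> and \<open>g = 0\<close>. Lagrangian subspaces of the kernel are graphs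
  of isometries between the two eigenspaces of \<open>\<i>\<gamma>\<close>, so they exist iff these have equal dimension.
\<close>

section \<open>Geometry of complex Hilbert spaces\<close>

abbreviation csubspace :: "'a::complex_hilbert set \<Rightarrow> bool" where
  "csubspace \<equiv> complex_vector.subspace"

abbreviation cspan :: "'a::complex_hilbert set \<Rightarrow> 'a set" where
  "cspan \<equiv> complex_vector.span"

lemmas csubspace_def = complex_vector.subspace_def
lemmas csubspace_0 = complex_vector.subspace_0
lemmas csubspace_add = complex_vector.subspace_add
lemmas csubspace_diff = complex_vector.subspace_diff
lemmas csubspace_neg = complex_vector.subspace_neg
lemmas csubspace_scale = complex_vector.subspace_scale
lemmas csubspace_sum = complex_vector.subspace_sum
lemmas csubspace_sums = complex_vector.subspace_sums
lemmas csubspace_inter = complex_vector.subspace_inter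
lemmas csubspace_Inter = complex_vector.subspace_Inter
lemmas csubspace_single_0 = complex_vector.subspace_single_0

lemma scaleR_eq_scaleC: "r *\<^sub>R x = complex_of_real r *\<^sub>C x"
  by (simp add: scaleC_of_real)

lemma cinner_add_right: "cinner x (y + z) = cinner x y + cinner x z"
  by (metis cinner_add_left cinner_commute complex_cnj_add)

lemma cinner_scaleC_right: "cinner x (c *\<^sub>C y) = cnj c * cinner x y"
  by (metis cinner_commute cinner_scaleC_left complex_cnj_mult)

lemma cinner_scaleR_left: "cinner (r *\<^sub>R x) y = complex_of_real r * cinner x y"
  by (simp add: scaleR_eq_scaleC cinner_scaleC_left)

lemma cinner_scaleR_right: "cinner x (r *\<^sub>R y) = complex_of_real r * cinner x y"
  by (simp add: scaleR_eq_scaleC cinner_scaleC_right)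

lemma cinner_zero_left [simp]: "cinner 0 x = 0"
  using cinner_add_left[of 0 0 x] by simp

lemma cinner_zero_right [simp]: "cinner x 0 = 0"
  using cinner_add_right[of x 0 0] by simp

lemma cinner_minus_left [simp]: "cinner (- x) y = - cinner x y"
  using cinner_add_left[of x "- x" y] by (simp add: eq_neg_iff_add_eq_0 add.commute)

lemma cinner_minus_right [simp]: "cinner x (- y) = - cinner x y"
  using cinner_add_right[of x y "- y"] by (simp add: eq_neg_iff_add_eq_0 add.commute)

lemma cinner_diff_left: "cinner (x - y) z = cinner x z - cinner y z"
  using cinner_add_left[of x "- y" z] by simp

lemma cinner_diff_right: "cinner x (y - z) = cinner x y - cinner x z"
  using cinner_add_right[of x y "- z"] by simp

lemmas cinner_simps = cinner_add_left cinner_add_right cinner_diff_left cinner_diff_right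
  cinner_scaleC_left cinner_scaleC_right cinner_scaleR_left cinner_scaleR_right

lemma cinner_self: "cinner x x = complex_of_real ((norm x)\<^sup>2)"
proof -
  have "Im (cinner x x) = 0"
    using arg_cong[OF cinner_commute[of x x], of Im] by simp
  then show ?thesis
    by (simp add: complex_eq_iff Re_cinner power2_norm_eq_inner)
qed

lemma cinner_self_eq_0 [simp]: "cinner x x = 0 \<longleftrightarrow> x = 0"
  by (simp add: cinner_self)

lemma cinner_eq_0_commute: "cinner x y = 0 \<longleftrightarrow> cinner y x = 0"
  by (metis cinner_commute complex_cnj_zero)

lemma norm_scaleC: "norm (c *\<^sub>C x) = cmod c * norm x"
proof -
  have "complex_of_real ((norm (c *\<^sub>C x))\<^sup>2) = complex_of_real ((cmod c * norm x)\<^sup>2)"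
    unfolding cinner_self[symmetric] cinner_simps mult.assoc[symmetric] complex_norm_square[symmetric]
    using complex_norm_square[of c] by (simp add: cinner_self power_mult_distrib mult.commute)
  then have "(norm (c *\<^sub>C x))\<^sup>2 = (cmod c * norm x)\<^sup>2"
    using of_real_eq_iff by blast
  then show ?thesis
    by (simp add: power2_eq_iff_nonneg)
qed

lemma norm_cinner_le: "cmod (cinner x y) \<le> norm x * norm y"
proof (cases "cinner x y = 0")
  case False
  define c where "c = cnj (cinner x y) / cmod (cinner x y)"
  have c: "cmod c = 1"
    using False by (simp add: c_def norm_divide)
  have "cinner (c *\<^sub>C x) y = complex_of_real (cmod (cinner x y))"
    using False unfolding c_def cinner_scaleC_left
    by (simp add: complex_norm_square[symmetric] power2_eq_square mult.commute divide_simps)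
  then have "cmod (cinner x y) = inner (c *\<^sub>C x) y"
    by (metis Re_cinner Re_complex_of_real)
  also have "\<dots> \<le> norm (c *\<^sub>C x) * norm y"
    by (rule norm_cauchy_schwarz)
  finally show ?thesis
    by (simp add: norm_scaleC c)
qed simp

lemma bounded_bilinear_cinner: "bounded_bilinear cinner"
  by (standard; (simp add: cinner_simps scaleR_conv_of_real)?)
    (metis norm_cinner_le mult.right_neutral)

lemmas tendsto_cinner = bounded_bilinear.tendsto[OF bounded_bilinear_cinner]
lemmas continuous_on_cinner = bounded_bilinear.continuous_on[OF bounded_bilinear_cinner]
lemmas bounded_linear_cinner_left = bounded_bilinear.bounded_linear_left[OF bounded_bilinear_cinner]
lemmas bounded_linear_cinner_right = bounded_bilinear.bounded_linear_right[OF bounded_bilinear_cinner]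

lemma bounded_linear_scaleC: "bounded_linear ((*\<^sub>C) c)"
  by (rule bounded_linear_intro[where K = "cmod c"])
    (simp_all add: scaleC_add_right norm_scaleC mult.commute scaleR_eq_scaleC scaleC_scaleC)

lemmas tendsto_scaleC = bounded_linear.tendsto[OF bounded_linear_scaleC]

lemma cinner_sum_left: "cinner (sum f T) y = (\<Sum>i\<in>T. cinner (f i) y)"
  by (induction T rule: infinite_finite_induct) (simp_all add: cinner_simps)

lemma cinner_sum_right: "cinner y (sum f T) = (\<Sum>i\<in>T. cinner y (f i))"
  by (induction T rule: infinite_finite_induct) (simp_all add: cinner_simps)

lemma norm_add_orthogonal: "cinner x y = 0 \<Longrightarrow> (norm (x + y))\<^sup>2 = (norm x)\<^sup>2 + (norm y)\<^sup>2"
  by (metis Re_cinner norm_add_Pythagorean orthogonal_def zero_complex.sel(1))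

lemma csubspace_scaleR: "csubspace S \<Longrightarrow> x \<in> S \<Longrightarrow> r *\<^sub>R x \<in> S"
  by (simp add: scaleR_eq_scaleC csubspace_scale)

lemma closed_orthogonal: "closed {x. \<forall>y\<in>Y. cinner x y = 0}"
proof -
  have "{x. \<forall>y\<in>Y. cinner x y = 0} = (\<Inter>y\<in>Y. {x. cinner x y = 0})"
    by auto
  also have "closed \<dots>"
    by (intro closed_INT ballI closed_Collect_eq continuous_on_cinner continuous_intros)
  finally show ?thesis .
qed

lemma csubspace_orthogonal: "csubspace {x. \<forall>y\<in>Y. cinner x y = 0}"
  by (auto simp: csubspace_def cinner_simps)

lemma orthogonal_if_closest:
  assumes "csubspace S" "\<And>z. z \<in> S \<Longrightarrow> norm x \<le> norm (x - z)" "z \<in> S"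
  shows "cinner x z = 0"
proof (cases "z = 0")
  case False
  \<comment> \<open>\<open>c z\<close> is the projection of \<open>x\<close> to the line of \<open>z\<close>; subtracting it shortens \<open>x\<close> unless it is zero\<close>
  define c where "c = cinner x z / (norm z)\<^sup>2"
  have nz: "complex_of_real ((norm z)\<^sup>2) \<noteq> 0"
    using False by simp
  have ortho: "cinner (x - c *\<^sub>C z) (c *\<^sub>C z) = 0"
    using nz by (simp add: cinner_simps cinner_self c_def)
  have "(norm x)\<^sup>2 = (norm (x - c *\<^sub>C z))\<^sup>2 + (norm (c *\<^sub>C z))\<^sup>2"
    using norm_add_orthogonal[OF ortho] by simp
  moreover have "norm x \<le> norm (x - c *\<^sub>C z)"
    using assms csubspace_scale by blast
  ultimately have "c *\<^sub>C z = 0"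
    by (smt (verit) norm_ge_zero power_mono zero_eq_power2 norm_eq_zero)
  then have "c = 0"
    using False by simp
  then show ?thesis
    using False by (simp add: c_def)
qed simp

lemma parallelogram: "(norm (x - y))\<^sup>2 = 2 * (norm x)\<^sup>2 + 2 * (norm y)\<^sup>2 - (norm (x + y))\<^sup>2"
  for x y :: "'a::real_inner"
  by (simp add: power2_norm_eq_inner inner_simps inner_commute)

text \<open>
  A minimizing sequence for the distance to \<open>S\<close> converges by completeness, and its limit is the
  closest point.
\<close>
lemma exists_orth_proj:
  fixes S :: "'a::complex_hilbert set"
  assumes S: "csubspace S" "closed S"
  shows "\<exists>y\<in>S. \<forall>z\<in>S. cinner (x - y) z = 0"
proof -
  define d where "d = (INF y\<in>S. (norm (x - y))\<^sup>2)"
  have S0: "S \<noteq> {}"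
    using S(1) csubspace_0 by blast
  have bdd: "bdd_below ((\<lambda>y. (norm (x - y))\<^sup>2) ` S)"
    by (rule bdd_belowI[of _ 0]) auto
  have d_le: "d \<le> (norm (x - y))\<^sup>2" if "y \<in> S" for y
    unfolding d_def using bdd that by (rule cINF_lower)
  have "\<exists>y\<in>S. (norm (x - y))\<^sup>2 < d + 1 / real (Suc n)" for n
    using cInf_lessD[of "(\<lambda>y. (norm (x - y))\<^sup>2) ` S" "d + 1 / real (Suc n)"] S0
    by (auto simp: d_def)
  then obtain y where y: "\<And>n. y n \<in> S" "\<And>n. (norm (x - y n))\<^sup>2 < d + 1 / real (Suc n)"
    by metis
  \<comment> \<open>by the parallelogram law a minimizing sequence is Cauchy: the midpoints cannot be closer to \<open>x\<close>\<close>
  have close: "(norm (y m - y n))\<^sup>2 \<le> 2 / real (Suc m) + 2 / real (Suc n)" for m n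
  proof -
    have mid: "(1/2) *\<^sub>R (y m + y n) \<in> S"
      using S y by (intro csubspace_scaleR csubspace_add) auto
    have "(x - y m) + (x - y n) = 2 *\<^sub>R (x - (1/2) *\<^sub>R (y m + y n))"
      by (simp add: scaleR_right_diff_distrib scaleR_2)
    then have "(norm ((x - y m) + (x - y n)))\<^sup>2 = 4 * (norm (x - (1/2) *\<^sub>R (y m + y n)))\<^sup>2"
      by (simp only: norm_scaleR power_mult_distrib) simp
    then have "4 * d \<le> (norm ((x - y m) + (x - y n)))\<^sup>2"
      using d_le[OF mid] by simp
    moreover have "(norm ((x - y m) - (x - y n)))\<^sup>2 = (norm (y m - y n))\<^sup>2"
      by (simp add: norm_minus_commute)
    ultimately show ?thesis
      using parallelogram[of "x - y m" "x - y n"] y(2)[of m] y(2)[of n] by (simp del: of_nat_Suc)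
  qed
  have "Cauchy y"
  proof (rule metric_CauchyI)
    fix e :: real assume e: "e > 0"
    then obtain N where N: "1 / real (Suc N) < e\<^sup>2 / 4"
      using reals_Archimedean[of "e\<^sup>2 / 4"] by (auto simp: inverse_eq_divide)
    have "dist (y m) (y n) < e" if "m \<ge> N" "n \<ge> N" for m n
    proof -
      have "2 / real (Suc m) \<le> 2 / real (Suc N)" "2 / real (Suc n) \<le> 2 / real (Suc N)"
        using that by (simp_all add: frac_le)
      then have "(norm (y m - y n))\<^sup>2 < e\<^sup>2"
        using close[of m n] N by simp
      then show ?thesis
        using e by (simp add: dist_norm power2_less_imp_less)
    qed
    then show "\<exists>M. \<forall>m\<ge>M. \<forall>n\<ge>M. dist (y m) (y n) < e"
      by blast
  qed
  then obtain l where l: "y \<longlonglongrightarrow> l"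
    using Cauchy_convergent_iff convergent_def by blast
  have lS: "l \<in> S"
    using closed_sequentially[OF S(2)] y(1) l by blast
  have "(\<lambda>n. (norm (x - y n))\<^sup>2) \<longlonglongrightarrow> (norm (x - l))\<^sup>2"
    by (intro tendsto_intros l)
  moreover have "(\<lambda>n. d + 1 / real (Suc n)) \<longlonglongrightarrow> d + 0"
    by (intro tendsto_intros lim_1_over_n[THEN LIMSEQ_Suc])
  ultimately have "(norm (x - l))\<^sup>2 \<le> d + 0"
    by (rule LIMSEQ_le) (use y(2) less_imp_le in blast)
  then have "norm (x - l) \<le> norm (x - w)" if "w \<in> S" for w
    using d_le[OF that] by (simp add: power2_le_imp_le)
  then have "norm (x - l) \<le> norm (x - l - z)" if "z \<in> S" for z
    using csubspace_add[OF S(1) lS that] by (simp add: diff_diff_eq)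
  then show ?thesis
    using orthogonal_if_closest[OF S(1)] lS by blast
qed

lemma orth_proj_eqI:
  assumes "csubspace S" "y \<in> S" "\<And>z. z \<in> S \<Longrightarrow> cinner (x - y) z = 0"
  shows "orth_proj S x = y"
  unfolding orth_proj_def
proof (rule the_equality)
  fix w assume w: "w \<in> S \<and> (\<forall>z\<in>S. cinner (x - w) z = 0)"
  then have wy: "w - y \<in> S"
    using assms csubspace_diff by blast
  have "cinner (w - y) (w - y) = cinner (x - y) (w - y) - cinner (x - w) (w - y)"
    by (simp add: cinner_simps)
  then show "w = y"
    using w assms(3) wy by simp
qed (use assms in auto)

lemma
  assumes "csubspace S" "closed S"
  shows orth_proj_in: "orth_proj S x \<in> S"
    and orth_proj_ortho: "z \<in> S \<Longrightarrow> cinner (x - orth_proj S x) z = 0"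
    and orth_proj_ortho': "z \<in> S \<Longrightarrow> cinner z (x - orth_proj S x) = 0"
    and orth_proj_add: "orth_proj S (x + y) = orth_proj S x + orth_proj S y"
    and orth_proj_scaleC: "orth_proj S (c *\<^sub>C x) = c *\<^sub>C orth_proj S x"
    and norm_orth_proj_le: "norm (orth_proj S x) \<le> norm x"
    and cinner_orth_proj: "cinner (orth_proj S x) y = cinner x (orth_proj S y)"
proof -
  have P: "orth_proj S x \<in> S \<and> (\<forall>z\<in>S. cinner (x - orth_proj S x) z = 0)" for x
    using exists_orth_proj[OF assms, of x] orth_proj_eqI[OF assms(1)] by metis
  show "orth_proj S x \<in> S" and *: "z \<in> S \<Longrightarrow> cinner (x - orth_proj S x) z = 0"
    using P by auto
  then show "z \<in> S \<Longrightarrow> cinner z (x - orth_proj S x) = 0"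
    using cinner_eq_0_commute by blast
  have L: "cinner x z - cinner (orth_proj S x) z = 0" "cinner z x = cinner z (orth_proj S x)"
    if "z \<in> S" for x z
  proof -
    have "cinner (x - orth_proj S x) z = 0" "cinner z (x - orth_proj S x) = 0"
      using P[of x] that cinner_eq_0_commute by blast+
    then show "cinner x z - cinner (orth_proj S x) z = 0" "cinner z x = cinner z (orth_proj S x)"
      by (simp_all add: cinner_diff_left cinner_diff_right)
  qed
  show "orth_proj S (x + y) = orth_proj S x + orth_proj S y"
  proof (rule orth_proj_eqI[OF assms(1)])
    show "orth_proj S x + orth_proj S y \<in> S"
      using P assms(1) csubspace_add by blast
    show "cinner (x + y - (orth_proj S x + orth_proj S y)) z = 0" if "z \<in> S" for z
      using L(1)[OF that, of x] L(1)[OF that, of y] by (simp add: cinner_simps)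
  qed
  show "orth_proj S (c *\<^sub>C x) = c *\<^sub>C orth_proj S x"
  proof (rule orth_proj_eqI[OF assms(1)])
    show "c *\<^sub>C orth_proj S x \<in> S"
      using P assms(1) csubspace_scale by blast
    show "cinner (c *\<^sub>C x - c *\<^sub>C orth_proj S x) z = 0" if "z \<in> S" for z
      using L(1)[OF that, of x] by (simp add: cinner_simps)
  qed
  have "cinner (orth_proj S x) (x - orth_proj S x) = 0"
    using P by (metis cinner_eq_0_commute)
  then have "(norm x)\<^sup>2 = (norm (orth_proj S x))\<^sup>2 + (norm (x - orth_proj S x))\<^sup>2"
    using norm_add_orthogonal[of "orth_proj S x" "x - orth_proj S x"] by simp
  then show "norm (orth_proj S x) \<le> norm x"
    by (smt (verit) norm_ge_zero power2_le_imp_le zero_le_power2)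
  have "cinner (orth_proj S x) y = cinner (orth_proj S x) (orth_proj S y)"
    using L(2) P by blast
  also have "\<dots> = cinner x (orth_proj S y)"
    using L(1)[of "orth_proj S y" x] P[of y] by simp
  finally show "cinner (orth_proj S x) y = cinner x (orth_proj S y)" .
qed

lemma orth_proj_id: "csubspace S \<Longrightarrow> x \<in> S \<Longrightarrow> orth_proj S x = x"
  by (rule orth_proj_eqI) auto

lemma orth_proj_eq_0:
  "csubspace S \<Longrightarrow> (\<And>z. z \<in> S \<Longrightarrow> cinner x z = 0) \<Longrightarrow> orth_proj S x = 0"
  by (rule orth_proj_eqI) (auto simp: csubspace_0)

lemma bounded_linear_orth_proj:
  assumes "csubspace S" "closed S"
  shows "bounded_linear (orth_proj S)"
  by (rule bounded_linear_intro[where K = 1])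
    (simp_all add: orth_proj_add[OF assms] orth_proj_scaleC[OF assms] scaleR_eq_scaleC norm_orth_proj_le[OF assms])

text \<open>
  Gram-Schmidt: a new vector is first made orthogonal to the basis obtained so far.
\<close>
lemma exists_orthonormal_basis_span:
  assumes "finite T"
  shows "\<exists>B. finite B \<and> (\<forall>b\<in>B. \<forall>c\<in>B. cinner b c = (if b = c then 1 else 0)) \<and> cspan B = cspan T"
  using assms
proof (induction T)
  case empty
  show ?case
    by (rule exI[of _ "{}"]) simp
next
  case (insert v T)
  then obtain B where B: "finite B" "\<And>b c. b \<in> B \<Longrightarrow> c \<in> B \<Longrightarrow> cinner b c = (if b = c then 1 else 0)"
    "cspan B = cspan T"
    by blast
  define p where "p = (\<Sum>b\<in>B. cinner v b *\<^sub>C b)"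
  define w where "w = v - p"
  have p: "p \<in> cspan B"
    unfolding p_def by (intro complex_vector.span_sum complex_vector.span_scale complex_vector.span_base)
  have wB: "cinner w b = 0" if "b \<in> B" for b
    using B that by (simp add: w_def p_def cinner_simps cinner_sum_left if_distrib[of "\<lambda>x. _ * x"] cong: if_cong)
  have vT: "cspan (insert v T) = cspan (insert v B)"
    using B(3) by (simp add: complex_vector.span_insert)
  show ?case
  proof (cases "w = 0")
    case True
    then have "v \<in> cspan B"
      using p by (simp add: w_def)
    then have "cspan (insert v B) = cspan B"
      by (rule complex_vector.span_redundant)
    then have "cspan B = cspan (insert v T)"
      using vT by simp
    then show ?thesis
      using B(1,2) by blast
  next
    case False
    define e where "e = complex_of_real (1 / norm w) *\<^sub>C w"
    have ee: "cinner e e = 1"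
      using False by (simp add: e_def cinner_self norm_scaleC norm_divide)
    have eB: "cinner e b = 0" "cinner b e = 0" if "b \<in> B" for b
      using wB[OF that] cinner_eq_0_commute[of b w] by (simp_all add: e_def cinner_simps)
    have v: "v = complex_of_real (norm w) *\<^sub>C e + p"
      using False by (simp add: e_def w_def scaleC_scaleC)
    have "cspan (insert e B) = cspan (insert v B)"
    proof
      have sub: "cspan B \<subseteq> cspan (insert x B)" for x
        by (intro complex_vector.span_mono) auto
      have "w \<in> cspan (insert v B)"
        unfolding w_def using p sub complex_vector.span_base[of v "insert v B"]
        by (intro complex_vector.span_diff) auto
      then show "cspan (insert e B) \<subseteq> cspan (insert v B)"
        unfolding e_def by (intro complex_vector.span_minimal) 
          (auto intro: complex_vector.span_base complex_vector.span_scale)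
      have "v \<in> cspan (insert e B)"
        using p sub complex_vector.span_base[of e "insert e B"]
        by (subst v) (intro complex_vector.span_add complex_vector.span_scale, auto)
      then show "cspan (insert v B) \<subseteq> cspan (insert e B)"
        by (intro complex_vector.span_minimal) (auto intro: complex_vector.span_base)
    qed
    moreover have "e \<notin> B"
      using eB ee by force
    then have "\<forall>b\<in>insert e B. \<forall>c\<in>insert e B. cinner b c = (if b = c then 1 else 0)"
      using B(2) eB ee by auto
    ultimately show ?thesis
      using B(1) vT by (intro exI[of _ "insert e B"] conjI) simp_all
  qed
qed

definition onb :: "'a::complex_hilbert set \<Rightarrow> 'a set \<Rightarrow> bool" where
  "onb B S \<longleftrightarrow> finite B \<and> (\<forall>b\<in>B. \<forall>c\<in>B. cinner b c = (if b = c then 1 else 0)) \<and> cspan B = S"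

lemma exists_onb: "finite_dimensional S \<Longrightarrow> \<exists>B. onb B S"
  unfolding finite_dimensional_def onb_def using exists_orthonormal_basis_span by blast

lemma onb_subset: "onb B S \<Longrightarrow> B \<subseteq> S"
  unfolding onb_def using complex_vector.span_superset by blast

lemma onb_ortho:
  assumes "onb B S"
  shows "z \<in> S \<Longrightarrow> cinner (x - (\<Sum>b\<in>B. cinner x b *\<^sub>C b)) z = 0"
proof -
  let ?r = "x - (\<Sum>b\<in>B. cinner x b *\<^sub>C b)"
  have "cinner z ?r = 0" if "z \<in> cspan B"
    using that
  proof (induction rule: complex_vector.span_induct)
    case base
    show ?case by (auto simp: csubspace_def cinner_simps)
  next
    case (step z)
    have "cinner ?r z = 0"
      using assms step unfolding onb_def
      by (simp add: cinner_simps cinner_sum_left if_distrib[of "\<lambda>x. _ * x"] cong: if_cong)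
    then show ?case
      using cinner_eq_0_commute by blast
  qed
  then show "z \<in> S \<Longrightarrow> cinner ?r z = 0"
    using assms cinner_eq_0_commute unfolding onb_def by blast
qed

lemma onb_sum_in: "onb B S \<Longrightarrow> (\<Sum>b\<in>B. f b *\<^sub>C b) \<in> S"
  unfolding onb_def by (blast intro: complex_vector.span_sum complex_vector.span_scale complex_vector.span_base)

lemma onb_expand:
  assumes "onb B S" "x \<in> S"
  shows "(\<Sum>b\<in>B. cinner x b *\<^sub>C b) = x"
proof -
  have "csubspace S"
    using assms by (auto simp: onb_def)
  then have "x - (\<Sum>b\<in>B. cinner x b *\<^sub>C b) \<in> S"
    using assms onb_sum_in csubspace_diff by blast
  then show ?thesis
    using onb_ortho[OF assms(1), of _ x] by (metis cinner_self_eq_0 eq_iff_diff_eq_0)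
qed

lemma onb_independent:
  assumes "onb B S"
  shows "complex_vector.independent B"
proof -
  have "u b = 0" if "finite T" "T \<subseteq> B" "(\<Sum>v\<in>T. u v *\<^sub>C v) = 0" "b \<in> T" for T u b
  proof -
    have "0 = cinner (\<Sum>v\<in>T. u v *\<^sub>C v) b"
      using that by simp
    also have "\<dots> = (\<Sum>v\<in>T. if v = b then u v else 0)"
      using assms that unfolding onb_def cinner_sum_left
      by (intro sum.cong refl) (simp add: cinner_simps subset_iff)
    also have "\<dots> = u b"
      using that by simp
    finally show ?thesis by simp
  qed
  then show ?thesis
    unfolding complex_vector.dependent_explicit by blast
qed

lemma onb_dim: "onb B S \<Longrightarrow> complex_vector.dim S = card B"
  using onb_independent complex_vector.dim_span_eq_card_independent unfolding onb_def by blast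

text \<open>
  Expand in an orthonormal basis. The functionals to which this is applied are defined by means of
  unbounded operators.
\<close>
lemma riesz_finite_dimensional:
  fixes S :: "'a::complex_hilbert set"
  assumes S: "finite_dimensional S"
    and add: "\<And>x y. x \<in> S \<Longrightarrow> y \<in> S \<Longrightarrow> \<phi> (x + y) = \<phi> x + \<phi> y"
    and scale: "\<And>c x. x \<in> S \<Longrightarrow> \<phi> (c *\<^sub>C x) = c * \<phi> x"
  shows "\<exists>z\<in>S. \<forall>x\<in>S. \<phi> x = cinner x z"
proof -
  obtain B where B: "onb B S"
    using S exists_onb by blast
  have sub: "csubspace S"
    using S unfolding finite_dimensional_def by auto
  have BS: "b \<in> S" if "b \<in> B" for b
    using onb_subset[OF B] that by blast
  have \<phi>0: "\<phi> 0 = 0"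
    using scale[of 0 0] csubspace_0[OF sub] by simp
  define z where "z = (\<Sum>b\<in>B. cnj (\<phi> b) *\<^sub>C b)"
  have "\<phi> x = cinner x z" if x: "x \<in> S" for x
  proof -
    have "\<phi> (\<Sum>b\<in>T. cinner x b *\<^sub>C b) = (\<Sum>b\<in>T. cinner x b * \<phi> b)" if "finite T" "T \<subseteq> B" for T
      using that
    proof (induction T)
      case (insert b T)
      have "(\<Sum>b\<in>T. cinner x b *\<^sub>C b) \<in> S"
        using insert BS sub by (intro csubspace_sum csubspace_scale) auto
      moreover have "cinner x b *\<^sub>C b \<in> S"
        using insert BS sub by (intro csubspace_scale) auto
      ultimately show ?case
        using insert BS by (simp add: add scale)
    qed (simp add: \<phi>0)
    then have "\<phi> (\<Sum>b\<in>B. cinner x b *\<^sub>C b) = (\<Sum>b\<in>B. cinner x b * \<phi> b)"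
      using B by (simp add: onb_def)
    then show ?thesis
      unfolding onb_expand[OF B x] z_def by (simp add: cinner_sum_right cinner_simps mult.commute)
  qed
  moreover have "z \<in> S"
    unfolding z_def by (rule onb_sum_in[OF B])
  ultimately show ?thesis
    by blast
qed

lemma finite_dimensional_closed:
  fixes S :: "'a::complex_hilbert set"
  assumes "finite_dimensional S"
  shows "closed S" "csubspace S"
proof -
  obtain B where B: "onb B S"
    using assms exists_onb by blast
  show sub: "csubspace S"
    using assms unfolding finite_dimensional_def by auto
  have "S = {x. (\<Sum>b\<in>B. cinner x b *\<^sub>C b) = x}"
  proof (intro set_eqI iffI CollectI)
    show "x \<in> S" if "x \<in> {x. (\<Sum>b\<in>B. cinner x b *\<^sub>C b) = x}" for x
      using onb_sum_in[OF B, of "cinner x"] that by simp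
  qed (rule onb_expand[OF B])
  also have "closed \<dots>"
  proof (intro closed_Collect_eq continuous_intros)
    show "continuous_on UNIV (\<lambda>x. cinner x b *\<^sub>C b)" if "b \<in> B" for b :: 'a
    proof -
      have "bounded_linear (\<lambda>c. c *\<^sub>C b)"
        by (rule bounded_linear_intro[where K = "norm b"])
          (simp_all add: scaleC_add_left norm_scaleC scaleR_eq_scaleC scaleC_scaleC scaleR_conv_of_real)
      from bounded_linear.continuous_on[OF this, of UNIV "\<lambda>x. cinner x b"] show ?thesis
        by (simp add: linear_continuous_on bounded_linear_cinner_left)
    qed
  qed
  finally show "closed S" .
qed

lemma finite_dimensional_image:
  assumes "finite_dimensional S" "clinear_on S f"
  shows "finite_dimensional (f ` S)"
proof -
  obtain T where T: "finite T" "S = cspan T"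
    using assms unfolding finite_dimensional_def by blast
  have TS: "x \<in> S" if "x \<in> T" for x
    using that T complex_vector.span_base by auto
  have f0: "f 0 = 0"
    using assms(2) T complex_vector.span_zero unfolding clinear_on_def by (metis complex_vector.scale_zero_left)
  have *: "x \<in> S \<and> f x \<in> cspan (f ` T)" if "x \<in> cspan T" for x
    using that
  proof (induction rule: complex_vector.span_induct_alt)
    case base
    then show ?case
      unfolding T(2) f0 by (blast intro: complex_vector.span_zero)
  next
    case (step c x y)
    have cx: "c *\<^sub>C x \<in> S"
      using TS[OF step(1)] T complex_vector.span_scale by blast
    then have "f (c *\<^sub>C x + y) = c *\<^sub>C f x + f y"
      using assms(2) TS[OF step(1)] step(2) unfolding clinear_on_def by metis
    moreover have "c *\<^sub>C f x + f y \<in> cspan (f ` T)"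
      using step by (intro complex_vector.span_add complex_vector.span_scale)
        (simp_all add: complex_vector.span_base)
    ultimately show ?case
      using cx step(2) T complex_vector.span_add[of "c *\<^sub>C x" T y] by simp
  qed
  have **: "y \<in> f ` S" if "y \<in> cspan (f ` T)" for y
    using that
  proof (induction rule: complex_vector.span_induct_alt)
    case base
    then show ?case
      using f0 T complex_vector.span_zero by (metis image_eqI)
  next
    case (step c x y)
    then obtain x' y' where *: "x' \<in> T" "x = f x'" "y' \<in> S" "y = f y'"
      by blast
    have cx: "c *\<^sub>C x' \<in> S"
      using TS[OF *(1)] T complex_vector.span_scale by blast
    have "c *\<^sub>C x + y = f (c *\<^sub>C x' + y')"
      using * assms(2) cx TS unfolding clinear_on_def by metis
    moreover have "c *\<^sub>C x' + y' \<in> S"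
      using cx * T complex_vector.span_add by blast
    ultimately show ?case
      by blast
  qed
  have "f ` S = cspan (f ` T)"
    using * ** T by blast
  then show ?thesis
    unfolding finite_dimensional_def using T by blast
qed

text \<open>
  The argument of Riesz: finitely many unit balls cover the unit ball of \<open>Y\<close>. The span of
  their centers is closed, and a unit vector of \<open>Y\<close> orthogonal to it has distance at least \<open>1\<close>
  from all centers.
\<close>
lemma finite_dimensional_if_compact_ball:
  fixes Y :: "'a::complex_hilbert set"
  assumes Y: "csubspace Y" and C: "compact C" "\<And>y. y \<in> Y \<Longrightarrow> norm y \<le> 1 \<Longrightarrow> y \<in> C"
  shows "finite_dimensional Y"
proof -
  let ?Y = "{y\<in>Y. norm y \<le> 1}"
  have "closure ?Y \<subseteq> C"
    using C by (intro closure_minimal compact_imp_closed) auto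
  then have "compact (closure ?Y)"
    using C(1) compact_Int_closed[OF C(1) closed_closure[of ?Y]] by (simp add: inf.absorb2)
  moreover have "closure ?Y \<subseteq> (\<Union>k\<in>?Y. ball k 1)"
    using closure_approachable[of _ ?Y] by (force simp: dist_commute)
  ultimately obtain K where K: "K \<subseteq> ?Y" "finite K" "closure ?Y \<subseteq> (\<Union>k\<in>K. ball k 1)"
    by (metis (no_types, lifting) compactE_image open_ball)
  then have K: "finite K" "K \<subseteq> ?Y" "?Y \<subseteq> (\<Union>k\<in>K. ball k 1)"
    using closure_subset[of ?Y] by auto
  define T where "T = cspan K"
  have T: "finite_dimensional T" "csubspace T" "closed T"
    using K(1) finite_dimensional_closed unfolding T_def finite_dimensional_def by auto
  have KT: "K \<subseteq> T"
    unfolding T_def by (rule complex_vector.span_superset)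
  have TY: "T \<subseteq> Y"
    unfolding T_def using K(2) Y by (intro complex_vector.span_minimal) auto
  have "y \<in> T" if y: "y \<in> Y" for y
  proof (rule ccontr)
    assume "y \<notin> T"
    define r where "r = y - orth_proj T y"
    have r0: "r \<noteq> 0"
      using \<open>y \<notin> T\<close> orth_proj_in[OF T(2,3), of y] by (auto simp: r_def)
    have rY: "r \<in> Y"
      unfolding r_def using orth_proj_in[OF T(2,3)] TY y Y by (intro csubspace_diff) auto
    define e where "e = (1 / norm r) *\<^sub>R r"
    have e: "norm e = 1" "e \<in> Y"
      using r0 rY Y by (auto simp: e_def csubspace_scaleR)
    then obtain k where k: "k \<in> K" "norm (k - e) < 1"
      using K(3) by (force simp: dist_norm)
    have "cinner e (- k) = 0"
      using orth_proj_ortho[OF T(2,3)] k KT by (auto simp: e_def r_def cinner_simps)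
    then have "(norm (e - k))\<^sup>2 = (norm e)\<^sup>2 + (norm k)\<^sup>2"
      using norm_add_orthogonal[of e "- k"] by simp
    then have "1 \<le> (norm (e - k))\<^sup>2"
      using e by simp
    moreover have "(norm (e - k))\<^sup>2 < 1"
      using k by (simp add: norm_minus_commute power_less_one_iff abs_square_less_1)
    ultimately show False
      by simp
  qed
  then have "Y = T"
    using TY by blast
  then show ?thesis
    using T by simp
qed

section \<open>Uniform boundedness, orthogonal series, logarithmic convexity\<close>

text \<open>
  By the category theorem of Baire, one of the closed sets on which all \<open>T i\<close> are bounded by
  \<open>m\<close> contains a ball; translating the ball to the origin costs a factor \<open>2\<close>.
\<close>
theorem banach_steinhaus:
  fixes T :: "'i \<Rightarrow> 'a::banach \<Rightarrow> 'b::real_normed_vector"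
  assumes lin: "\<And>i. bounded_linear (T i)" and ptw: "\<And>x. \<exists>K. \<forall>i. norm (T i x) \<le> K"
  shows "\<exists>C. \<forall>i x. norm (T i x) \<le> C * norm x"
proof -
  define F where "F m = {x. \<forall>i. norm (T i x) \<le> real m}" for m :: nat
  have "F m = (\<Inter>i. {x. norm (T i x) \<le> real m})" for m
    by (auto simp: F_def)
  moreover have "continuous_on UNIV (\<lambda>x. norm (T i x))" for i
    by (intro continuous_on_norm linear_continuous_on lin)
  ultimately have closed: "closed (F m)" for m
    by (simp add: closed_INT closed_Collect_le)
  have "\<exists>m. x \<in> F m" for x
  proof -
    obtain K where "\<forall>i. norm (T i x) \<le> K"
      using ptw by blast
    moreover obtain m where "K \<le> real m"
      using real_arch_simple by blast
    ultimately show ?thesis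
      unfolding F_def using order_trans by blast
  qed
  then have "\<Union>(range F) = UNIV"
    by auto
  moreover have "interior (\<Union>(range F)) = {}" if "\<And>m. interior (F m) = {}"
    using Baire_category_alt[of euclidean "range F"] that closed
    by (auto simp: completely_metrizable_space_euclidean)
  ultimately obtain m x0 where "x0 \<in> interior (F m)"
    by (metis UNIV_not_empty equals0I interior_UNIV)
  then obtain r where r: "r > 0" "cball x0 r \<subseteq> F m"
    by (meson mem_interior_cball)
  have "norm (T i x) \<le> (2 * m / r) * norm x" for i x
  proof (cases "x = 0")
    case True
    then show ?thesis
      using lin linear_simps(3) by fastforce
  next
    case False
    interpret T: bounded_linear "T i"
      by (rule lin)
    define y where "y = (r / norm x) *\<^sub>R x"
    have "x0 + y \<in> F m" "x0 \<in> F m"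
      using r False by (auto simp: y_def dist_norm intro!: subsetD[OF r(2)])
    then have "norm (T i (x0 + y)) \<le> m" "norm (T i x0) \<le> m"
      by (auto simp: F_def)
    then have "norm (T i y) \<le> 2 * m"
      using norm_triangle_ineq4[of "T i (x0 + y)" "T i x0"] by (simp add: T.add)
    moreover have "norm (T i y) = r / norm x * norm (T i x)"
      using r by (simp add: y_def T.scaleR)
    ultimately show ?thesis
      using r False by (simp add: field_simps)
  qed
  then show ?thesis
    by blast
qed

lemma norm_sum_orthogonal:
  fixes v :: "'i \<Rightarrow> 'a::complex_hilbert"
  assumes "\<And>s t. s \<noteq> t \<Longrightarrow> cinner (v s) (v t) = 0"
  shows "(norm (sum v T))\<^sup>2 = (\<Sum>t\<in>T. (norm (v t))\<^sup>2)"
proof (induction T rule: infinite_finite_induct)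
  case (insert t T)
  have "cinner (v t) (v s) = 0" if "s \<in> T" for s
    using insert(2) that by (intro assms) blast
  then have "cinner (v t) (sum v T) = 0"
    unfolding cinner_sum_right by (intro sum.neutral) blast
  from norm_add_orthogonal[OF this] show ?case
    using insert by simp
qed simp_all

text \<open>
  By Pythagoras the partial sums of \<open>v\<close> are as close to each other as those of the squared norms,
  so the Cauchy property carries over.
\<close>
lemma orthogonal_summable:
  fixes v :: "'i \<Rightarrow> 'a::complex_hilbert"
  assumes ortho: "\<And>s t. s \<noteq> t \<Longrightarrow> cinner (v s) (v t) = 0"
    and "(\<lambda>t. (norm (v t))\<^sup>2) summable_on UNIV"
  shows "v summable_on UNIV"
proof -
  obtain L where lim: "(sum (\<lambda>t. (norm (v t))\<^sup>2) \<longlongrightarrow> L) (finite_subsets_at_top UNIV)"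
    using assms(2) unfolding has_sum_def summable_on_def by blast
  have "\<exists>P. eventually P (finite_subsets_at_top UNIV) \<and>
              (\<forall>F F'. P F \<and> P F' \<longrightarrow> dist (sum v F) (sum v F') < e)" if "e > 0" for e
  proof -
    have "e\<^sup>2 / 8 > 0"
      using that by simp
    with lim obtain F0 where F0: "finite F0"
      "\<And>F. finite F \<Longrightarrow> F0 \<subseteq> F \<Longrightarrow> dist (\<Sum>t\<in>F. (norm (v t))\<^sup>2) L < e\<^sup>2 / 8"
      unfolding tendsto_iff eventually_finite_subsets_at_top by (metis subset_UNIV)
    have close: "dist (sum v F) (sum v F0) < e / 2" if "finite F" "F0 \<subseteq> F" for F
    proof -
      have "(dist (sum v F) (sum v F0))\<^sup>2 = (norm (sum v (F - F0)))\<^sup>2"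
        using that F0(1) by (simp add: dist_norm sum_diff[of F F0 v])
      also have "\<dots> = (\<Sum>t\<in>F. (norm (v t))\<^sup>2) - (\<Sum>t\<in>F0. (norm (v t))\<^sup>2)"
        using sum_diff[OF that, of "\<lambda>t. (norm (v t))\<^sup>2"] norm_sum_orthogonal[of v "F - F0", OF ortho] by simp
      also have "\<dots> \<le> dist (\<Sum>t\<in>F. (norm (v t))\<^sup>2) (\<Sum>t\<in>F0. (norm (v t))\<^sup>2)"
        by (simp add: dist_real_def)
      also have "\<dots> < e\<^sup>2 / 4"
        by (rule dist_triangle_half_l[where y = L]) (use F0(2)[OF that] F0(2)[OF F0(1) order_refl] in simp_all)
      also have "\<dots> = (e / 2)\<^sup>2"
        by (simp add: power_divide)
      finally show ?thesis
        by (rule power2_less_imp_less) (use \<open>e > 0\<close> in simp)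
    qed
    have "dist (sum v F) (sum v F') < e" if "finite F \<and> F0 \<subseteq> F" "finite F' \<and> F0 \<subseteq> F'" for F F'
      using close[of F] close[of F'] that dist_triangle_half_l[of "sum v F" "sum v F0" e "sum v F'"] by (simp add: dist_commute)
    moreover have "eventually (\<lambda>F. finite F \<and> F0 \<subseteq> F) (finite_subsets_at_top UNIV)"
      using F0(1) unfolding eventually_finite_subsets_at_top by blast
    ultimately show ?thesis
      by blast
  qed
  then have "cauchy_filter (filtermap (sum v) (finite_subsets_at_top UNIV))"
    by (simp add: cauchy_filter_metric_filtermap)
  moreover have "complete (UNIV :: 'a set)"
    by (rule complete_UNIV)
  ultimately obtain l where "(sum v \<longlongrightarrow> l) (finite_subsets_at_top UNIV)"
    using complete_uniform[where S = "UNIV :: 'a set"] by (force simp add: filterlim_def)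
  then show ?thesis
    using summable_on_def has_sum_def by blast
qed

text \<open>
  The ratios of consecutive terms of a logarithmically convex sequence increase, so the first
  one is at most the exponential growth rate.
\<close>
lemma log_convex_growth:
  fixes a :: "nat \<Rightarrow> real"
  assumes nonneg: "\<And>k. a k \<ge> 0" and convex: "\<And>k. (a (Suc k))\<^sup>2 \<le> a k * a (Suc (Suc k))"
    and bound: "\<And>k. a k \<le> K * C ^ k" and C: "C > 0"
  shows "a 1 \<le> C * a 0"
proof (rule ccontr)
  assume "\<not> a 1 \<le> C * a 0"
  then have less: "C * a 0 < a 1"
    by simp
  have a0: "a 0 > 0"
  proof (rule ccontr)
    assume "\<not> a 0 > 0"
    then have "a 0 = 0"
      using nonneg[of 0] by linarith
    then have "(a 1)\<^sup>2 \<le> 0"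
      using convex[of 0] by simp
    then show False
      using less \<open>a 0 = 0\<close> by simp
  qed
  define q where "q = a 1 / a 0"
  have q: "q > C"
    using less a0 by (simp add: q_def pos_less_divide_eq)
  then have q: "q > C" "q > 0"
    using C by simp_all
  have step: "a k > 0 \<and> a (Suc k) \<ge> q * a k" for k
  proof (induction k)
    case 0
    then show ?case
      using a0 by (simp add: q_def)
  next
    case (Suc k)
    have pos: "a (Suc k) > 0"
      using Suc q mult_pos_pos[of q "a k"] by linarith
    have "q * a k * a (Suc k) \<le> a (Suc k) * a (Suc k)"
      using Suc pos by (intro mult_right_mono) auto
    also have "\<dots> \<le> a k * a (Suc (Suc k))"
      using convex[of k] by (simp add: power2_eq_square)
    finally have "a k * (q * a (Suc k)) \<le> a k * a (Suc (Suc k))"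
      by (simp add: algebra_simps)
    then show ?case
      using Suc pos by (simp add: mult_le_cancel_left_pos)
  qed
  have "a k \<ge> q ^ k * a 0" for k
  proof (induction k)
    case (Suc k)
    have "q ^ Suc k * a 0 \<le> q * a k"
      using Suc q by (simp add: mult.assoc)
    then show ?case
      using step[of k] by linarith
  qed simp
  then have "q ^ k * a 0 \<le> K * C ^ k" for k
    using bound order_trans by blast
  then have le: "(q / C) ^ k \<le> K / a 0" for k
    using C a0 by (simp add: power_divide pos_divide_le_eq pos_le_divide_eq mult.commute)
  have "1 < q / C"
    using q C by simp
  then obtain k where "K / a 0 < (q / C) ^ k"
    using real_arch_pow by blast
  then show False
    using le[of k] by linarith
qed

section \<open>The spectral theorem for operators with compact graph ball\<close>

locale discrete_operator =
  fixes D :: "'h::complex_hilbert set" and A :: "'h \<Rightarrow> 'h"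
  assumes selfadjoint: "selfadjoint_operator D A"
    and compact_graph_ball: "compact (closure {x \<in> D. graph_norm A x \<le> 1})"
begin

abbreviation E :: "real \<Rightarrow> 'h set" where "E \<equiv> eigenspace D A"
abbreviation P :: "real \<Rightarrow> 'h \<Rightarrow> 'h" where "P t \<equiv> orth_proj (eigenspace D A t)"

lemma csubspace_D: "csubspace D"
  and closure_D: "closure D = UNIV"
  and A_add: "x \<in> D \<Longrightarrow> y \<in> D \<Longrightarrow> A (x + y) = A x + A y"
  and A_scaleC: "x \<in> D \<Longrightarrow> A (c *\<^sub>C x) = c *\<^sub>C A x"
  using selfadjoint unfolding selfadjoint_operator_def clinear_on_def by blast+

lemma A_scaleR: "x \<in> D \<Longrightarrow> A (r *\<^sub>R x) = r *\<^sub>R A x"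
  by (simp add: scaleR_eq_scaleC A_scaleC)

lemma A_diff:
  assumes "x \<in> D" "y \<in> D"
  shows "A (x - y) = A x - A y"
proof -
  have "x - y \<in> D"
    using assms csubspace_D csubspace_diff by blast
  then have "A x = A (x - y) + A y"
    using A_add[of "x - y" y] assms by simp
  then show ?thesis
    by simp
qed

lemma symmetric: "x \<in> D \<Longrightarrow> y \<in> D \<Longrightarrow> cinner (A x) y = cinner x (A y)"
proof -
  assume "x \<in> D" "y \<in> D"
  then have "(y, A y) \<in> adjoint_graph D A"
    using selfadjoint unfolding selfadjoint_operator_def op_graph_def by blast
  then show ?thesis
    using \<open>x \<in> D\<close> unfolding adjoint_graph_def by blast
qed

lemma adjoint_domain:
  assumes "\<And>x. x \<in> D \<Longrightarrow> cinner (A x) y = cinner x z"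
  shows "y \<in> D" "A y = z"
proof -
  have "(y, z) \<in> adjoint_graph D A"
    using assms unfolding adjoint_graph_def by blast
  then have "(y, z) \<in> op_graph D A"
    using selfadjoint unfolding selfadjoint_operator_def by simp
  then show "y \<in> D" "A y = z"
    unfolding op_graph_def by auto
qed

text \<open>
  An adjoint operator is closed, and \<open>A\<close> is its own adjoint.
\<close>
lemma closed_operator:
  assumes "\<And>n. x n \<in> D" "x \<longlonglongrightarrow> y" "(\<lambda>n. A (x n)) \<longlonglongrightarrow> z"
  shows "y \<in> D" "A y = z"
proof -
  have "cinner (A u) y = cinner u z" if "u \<in> D" for u
  proof (rule LIMSEQ_unique)
    show "(\<lambda>n. cinner (A u) (x n)) \<longlonglongrightarrow> cinner (A u) y"
      by (intro tendsto_cinner tendsto_const assms)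
    have "(\<lambda>n. cinner u (A (x n))) \<longlonglongrightarrow> cinner u z"
      by (intro tendsto_cinner tendsto_const assms)
    then show "(\<lambda>n. cinner (A u) (x n)) \<longlonglongrightarrow> cinner u z"
      using symmetric[OF that assms(1)] by simp
  qed
  then show "y \<in> D" "A y = z"
    using adjoint_domain by blast+
qed

lemma csubspace_E: "csubspace (E t)"
  unfolding csubspace_def eigenspace_def
  using csubspace_D A_scaleC[of 0 0]
  by (auto simp: A_add A_scaleC scaleR_add_right csubspace_0 csubspace_add
      csubspace_scale scaleR_eq_scaleC scaleC_scaleC scaleC_add_right mult.commute)

lemma closed_E: "closed (E t)"
proof (rule closed_sequential_limits[THEN iffD2], intro allI impI)
  fix x l assume x: "(\<forall>n. x n \<in> E t) \<and> x \<longlonglongrightarrow> l"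
  then have "(\<lambda>n. t *\<^sub>R x n) \<longlonglongrightarrow> t *\<^sub>R l"
    by (intro tendsto_intros) auto
  then have "(\<lambda>n. A (x n)) \<longlonglongrightarrow> t *\<^sub>R l"
    using x by (simp add: eigenspace_def)
  then show "l \<in> E t"
    using closed_operator[of x l "t *\<^sub>R l"] x by (auto simp: eigenspace_def)
qed

lemmas P_in = orth_proj_in[OF csubspace_E closed_E]
lemmas P_ortho = orth_proj_ortho[OF csubspace_E closed_E]
lemmas P_add = orth_proj_add[OF csubspace_E closed_E]
lemmas P_scaleC = orth_proj_scaleC[OF csubspace_E closed_E]
lemmas P_id = orth_proj_id[OF csubspace_E]
lemmas cinner_P = cinner_orth_proj[OF csubspace_E closed_E]
lemmas bounded_linear_P = bounded_linear_orth_proj[OF csubspace_E closed_E]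
lemmas P_diff = linear_simps(2)[OF bounded_linear_P]
lemmas P_minus = linear_simps(4)[OF bounded_linear_P]
lemmas P_zero = linear_simps(3)[OF bounded_linear_P]
lemmas P_sum = linear_sum[OF bounded_linear.linear[OF bounded_linear_P]]

lemma E_D: "x \<in> E t \<Longrightarrow> x \<in> D" and E_A: "x \<in> E t \<Longrightarrow> A x = t *\<^sub>R x"
  by (simp_all add: eigenspace_def)

lemmas P_in_D = E_D[OF P_in] and A_P = E_A[OF P_in]

lemma E_orthogonal:
  assumes "s \<noteq> t" "x \<in> E s" "y \<in> E t"
  shows "cinner x y = 0"
proof -
  have "complex_of_real s * cinner x y = complex_of_real t * cinner x y"
    using assms symmetric[of x y] by (simp add: eigenspace_def cinner_simps)
  then show ?thesis
    using assms(1) by simp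
qed

lemma P_orthogonal: "s \<noteq> t \<Longrightarrow> cinner (P s x) (P t y) = 0"
  using E_orthogonal P_in by blast

lemma P_E: "x \<in> E t \<Longrightarrow> P s x = (if s = t then x else 0)"
  using P_id[of x t] orth_proj_eq_0[OF csubspace_E] E_orthogonal[of t s x] by auto

lemma P_P: "P s (P t x) = (if s = t then P t x else 0)"
  using P_E P_in by blast

lemma P_A:
  assumes "x \<in> D"
  shows "P t (A x) = t *\<^sub>R P t x"
proof (rule orth_proj_eqI[OF csubspace_E])
  show "t *\<^sub>R P t x \<in> E t"
    using P_in csubspace_E csubspace_scaleR by blast
  fix z assume z: "z \<in> E t"
  then have "cinner (A x) z = complex_of_real t * cinner x z"
    using symmetric[OF assms, of z] by (simp add: eigenspace_def cinner_simps)
  then show "cinner (A x - t *\<^sub>R P t x) z = 0"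
    using P_ortho[OF z, of x] by (simp add: cinner_simps algebra_simps)
qed

text \<open>
  The Bessel inequality bounds the partial sums: a finite sum of components is an orthogonal projection of
  \<open>x\<close>.
\<close>
lemma P_square_summable: "(\<lambda>t. (norm (P t x))\<^sup>2) summable_on UNIV"
proof (rule nonneg_bdd_above_summable_on)
  have "(\<Sum>t\<in>T. (norm (P t x))\<^sup>2) \<le> (norm x)\<^sup>2" if "finite T" for T
  proof -
    let ?s = "\<Sum>t\<in>T. P t x"
    have "cinner (x - ?s) (P t x) = 0" if "t \<in> T" for t
    proof -
      have "cinner ?s (P t x) = (\<Sum>s\<in>T. if s = t then cinner (P t x) (P t x) else 0)"
        unfolding cinner_sum_left by (intro sum.cong) (auto simp: P_orthogonal)
      then have "cinner ?s (P t x) = cinner (P t x) (P t x)"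
        using \<open>finite T\<close> that by simp
      then show ?thesis
        using P_ortho[OF P_in, of x t x] by (simp add: cinner_simps)
    qed
    then have "cinner ?s (x - ?s) = 0"
      unfolding cinner_eq_0_commute[of ?s] cinner_sum_right by (simp add: sum.neutral)
    then have "(norm x)\<^sup>2 = (norm ?s)\<^sup>2 + (norm (x - ?s))\<^sup>2"
      using norm_add_orthogonal[of ?s "x - ?s"] by simp
    then show ?thesis
      using norm_sum_orthogonal[of "\<lambda>t. P t x" T] P_orthogonal by simp
  qed
  then show "bdd_above (sum (\<lambda>t. (norm (P t x))\<^sup>2) ` {F. F \<subseteq> UNIV \<and> finite F})"
    by (intro bdd_aboveI[of _ "(norm x)\<^sup>2"]) auto
qed simp

lemma exists_vector_with_components:
  assumes "\<And>t. v t \<in> E t" "(\<lambda>t. (norm (v t))\<^sup>2) summable_on UNIV"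
  shows "P s (infsum v UNIV) = v s" and "(v has_sum infsum v UNIV) UNIV"
proof -
  have "v summable_on UNIV"
    using orthogonal_summable[of v] E_orthogonal assms by blast
  then show sum: "(v has_sum infsum v UNIV) UNIV"
    by (simp add: summable_iff_has_sum_infsum)
  have "((\<lambda>t. P s (v t)) has_sum P s (infsum v UNIV)) UNIV"
    by (rule has_sum_bounded_linear[OF bounded_linear_P sum])
  moreover have "((\<lambda>t. P s (v t)) has_sum v s) UNIV"
    using assms(1) by (intro has_sum_finite_neutralI[of "{s}"]) (simp_all add: P_E[OF assms(1)])
  ultimately show "P s (infsum v UNIV) = v s"
    using has_sum_unique by blast
qed

text \<open>
  The form in which the compactness assumption is used: rescale the sequence into the unit ball
  of the graph norm.
\<close>
lemma graph_bounded_subseq: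
  fixes x :: "nat \<Rightarrow> 'h"
  assumes "\<And>n. x n \<in> D" "\<And>n. norm (x n) \<le> K" "\<And>n. norm (A (x n)) \<le> K"
  shows "\<exists>r l. strict_mono r \<and> (x \<circ> r) \<longlonglongrightarrow> l"
proof -
  define c where "c = \<bar>K\<bar> * 2 + 1"
  have c: "c > 0"
    by (simp add: c_def add_nonneg_pos)
  have "(1 / c) *\<^sub>R x n \<in> {x \<in> D. graph_norm A x \<le> 1}" for n
  proof -
    have "(norm (x n))\<^sup>2 \<le> K\<^sup>2" "(norm (A (x n)))\<^sup>2 \<le> K\<^sup>2"
      using assms by (simp_all add: power_mono)
    moreover have "c\<^sup>2 = 4 * K\<^sup>2 + 4 * \<bar>K\<bar> + 1"
      by (simp add: c_def power2_eq_square algebra_simps)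
    then have "K\<^sup>2 + K\<^sup>2 \<le> c\<^sup>2"
      using zero_le_power2[of K] by linarith
    ultimately have "graph_norm A ((1 / c) *\<^sub>R x n) \<le> 1"
      using c assms(1) by (simp add: graph_norm_def A_scaleR power_divide add_divide_distrib[symmetric])
    then show ?thesis
      using assms(1) csubspace_D csubspace_scaleR by blast
  qed
  then have "\<forall>n. (1 / c) *\<^sub>R x n \<in> closure {x \<in> D. graph_norm A x \<le> 1}"
    using closure_subset by blast
  then obtain l r where r: "strict_mono r" "((\<lambda>n. (1 / c) *\<^sub>R x n) \<circ> r) \<longlonglongrightarrow> l"
    using compact_graph_ball[unfolded compact_def, THEN spec, of "\<lambda>n. (1 / c) *\<^sub>R x n"] by blast
  then have "(\<lambda>n. c *\<^sub>R (((\<lambda>n. (1 / c) *\<^sub>R x n) \<circ> r) n)) \<longlonglongrightarrow> c *\<^sub>R l"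
    by (intro tendsto_intros)
  then have "(x \<circ> r) \<longlonglongrightarrow> c *\<^sub>R l"
    using c by (simp add: o_def)
  then show ?thesis
    using r(1) by blast
qed

lemma finite_dimensional_if_A_bounded:
  assumes Y: "csubspace Y" "Y \<subseteq> D" and C: "\<And>y. y \<in> Y \<Longrightarrow> norm (A y) \<le> C * norm y"
  shows "finite_dimensional Y"
proof -
  define k where "k = sqrt (1 + C\<^sup>2)"
  have k: "k > 0"
    by (simp add: k_def add_pos_nonneg)
  show ?thesis
  proof (rule finite_dimensional_if_compact_ball[OF Y(1)])
    show "compact ((*\<^sub>R) k ` closure {x \<in> D. graph_norm A x \<le> 1})"
      by (rule compact_scaling[OF compact_graph_ball])
    fix y assume y: "y \<in> Y" "norm y \<le> 1"
    have "norm (A y) \<le> \<bar>C\<bar>"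
      using C[OF y(1)] y(2) mult_mono[of C "\<bar>C\<bar>" "norm y" 1] by simp linarith
    then have "(norm (A y))\<^sup>2 \<le> C\<^sup>2"
      using abs_le_square_iff[of "norm (A y)" C] by simp
    moreover have "(norm y)\<^sup>2 \<le> 1"
      using y(2) by (simp add: power_le_one)
    ultimately have "(norm y)\<^sup>2 + (norm (A y))\<^sup>2 \<le> k\<^sup>2"
      by (simp add: k_def)
    moreover have "graph_norm A ((1 / k) *\<^sub>R y) = sqrt (((norm y)\<^sup>2 + (norm (A y))\<^sup>2) / k\<^sup>2)"
      using y Y by (auto simp: graph_norm_def A_scaleR power_divide add_divide_distrib)
    ultimately have "graph_norm A ((1 / k) *\<^sub>R y) \<le> 1"
      using k by simp
    moreover have "(1 / k) *\<^sub>R y \<in> D"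
      using y Y csubspace_D csubspace_scaleR by blast
    ultimately have "(1 / k) *\<^sub>R y \<in> {x \<in> D. graph_norm A x \<le> 1}"
      by simp
    then have "(1 / k) *\<^sub>R y \<in> closure {x \<in> D. graph_norm A x \<le> 1}"
      by (rule subsetD[OF closure_subset])
    then have "k *\<^sub>R ((1 / k) *\<^sub>R y) \<in> (*\<^sub>R) k ` closure {x \<in> D. graph_norm A x \<le> 1}"
      by blast
    then show "y \<in> (*\<^sub>R) k ` closure {x \<in> D. graph_norm A x \<le> 1}"
      using k by simp
  qed
qed

text \<open>
  The sum of all components of a vector, and the vectors without components. That the latter are
  zero is the content of the spectral theorem.
\<close>
definition spec_part :: "'h \<Rightarrow> 'h" where
  "spec_part x = (\<Sum>\<^sub>\<infinity>t. P t x)"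

definition spec_null :: "'h set" where
  "spec_null = {z. \<forall>t. \<forall>e\<in>E t. cinner z e = 0}"

lemma P_spec_part: "P t (spec_part x) = P t x"
  and has_sum_spec_part: "((\<lambda>t. P t x) has_sum spec_part x) UNIV"
  unfolding spec_part_def
  using exists_vector_with_components[of "\<lambda>t. P t x"] P_in P_square_summable by auto

lemma spec_null_diff: "x - spec_part x \<in> spec_null"
proof -
  have "cinner (x - spec_part x) e = 0" if e: "e \<in> E t" for t e
  proof -
    have "cinner (x - spec_part x) e = cinner (P t (x - spec_part x)) e"
      using cinner_P[of t "x - spec_part x" e] P_id[OF e] by simp
    then show ?thesis
      by (simp add: P_diff P_spec_part)
  qed
  then show ?thesis
    by (auto simp: spec_null_def)
qed

lemma cinner_spec_part:
  assumes "z \<in> spec_null"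
  shows "cinner z (spec_part y) = 0"
proof -
  have "((\<lambda>t. cinner z (P t y)) has_sum cinner z (spec_part y)) UNIV"
    by (rule has_sum_bounded_linear[OF bounded_linear_cinner_right has_sum_spec_part])
  moreover have "cinner z (P t y) = 0" for t
    using assms P_in[of t y] unfolding spec_null_def by blast
  ultimately have "((\<lambda>t::real. 0 :: complex) has_sum cinner z (spec_part y)) UNIV"
    by simp
  then show ?thesis
    by (rule has_sum_unique[OF _ has_sum_0_simp])
qed

text \<open>
  The domain is invariant because the components of \<open>A y\<close> are \<open>t\<close> times those of \<open>y\<close>, so that
  their sum serves as the image under the adjoint operator. The minimization argument below needs
  this to test its Euler-Lagrange equation, a priori valid on \<open>spec_null\<close> only, against all of \<open>D\<close>.
\<close>
lemma A_spec_part: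
  assumes "y \<in> D"
  shows "spec_part y \<in> D" "A (spec_part y) = spec_part (A y)"
proof -
  have "cinner (A u) (spec_part y) = cinner u (spec_part (A y))" if "u \<in> D" for u
  proof -
    have "((\<lambda>t. cinner (A u) (P t y)) has_sum cinner (A u) (spec_part y)) UNIV"
      by (rule has_sum_bounded_linear[OF bounded_linear_cinner_right has_sum_spec_part])
    moreover have "cinner (A u) (P t y) = cinner u (P t (A y))" for t
      using symmetric[OF that P_in_D, of t y] by (simp only: P_A[OF assms] A_P)
    moreover have "((\<lambda>t. cinner u (P t (A y))) has_sum cinner u (spec_part (A y))) UNIV"
      by (rule has_sum_bounded_linear[OF bounded_linear_cinner_right has_sum_spec_part])
    ultimately show ?thesis
      using has_sum_unique by simp blast
  qed
  then show "spec_part y \<in> D" "A (spec_part y) = spec_part (A y)"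
    using adjoint_domain by blast+
qed

lemma A_spec_null:
  assumes "z \<in> spec_null" "z \<in> D"
  shows "A z \<in> spec_null"
  using assms by (auto simp: spec_null_def symmetric eigenspace_def cinner_simps)

lemma csubspace_spec_null: "csubspace spec_null"
  by (auto simp: csubspace_def spec_null_def cinner_simps)

lemma closed_spec_null: "closed spec_null"
proof -
  have "spec_null = {z. \<forall>e\<in>(\<Union>t. E t). cinner z e = 0}"
    by (auto simp: spec_null_def)
  then show ?thesis
    by (simp only: closed_orthogonal)
qed

text \<open>
  Minimize \<open>\<parallel>A w\<parallel>\<close> on the unit sphere of \<open>W\<close>. Along a minimizing sequence the graph norms are
  bounded, so \<open>w\<close> converges after passing to a subsequence; the parallelogram law for \<open>A w\<close> and the
  minimality of \<open>\<mu>\<close> turn this into convergence of \<open>A w\<close>. The conclusion is the Euler-Lagrange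
  equation of the minimum.
\<close>
lemma exists_minimizer:
  assumes W: "csubspace W" "W = D \<inter> Z" "closed Z" and w0: "w0 \<in> W" "w0 \<noteq> 0"
  obtains w \<mu> where "w \<in> W" "w \<noteq> 0" "\<mu> \<ge> 0" "\<And>y. y \<in> W \<Longrightarrow> cinner (A w) (A y) = complex_of_real \<mu> * cinner w y"
proof -
  define S where "S = {w \<in> W. norm w = 1}"
  define \<mu> where "\<mu> = (INF w\<in>S. (norm (A w))\<^sup>2)"
  have unit: "(1 / norm y) *\<^sub>R y \<in> S" if "y \<in> W" "y \<noteq> 0" for y
    using that W(1) by (simp add: S_def csubspace_scaleR)
  then have S0: "S \<noteq> {}"
    using w0 by blast
  have bdd: "bdd_below ((\<lambda>w. (norm (A w))\<^sup>2) ` S)"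
    by (rule bdd_belowI[of _ 0]) auto
  have \<mu>0: "\<mu> \<ge> 0"
    unfolding \<mu>_def using S0 by (intro cINF_greatest) auto
  have \<mu>_le: "\<mu> * (norm y)\<^sup>2 \<le> (norm (A y))\<^sup>2" if y: "y \<in> W" for y
  proof (cases "y = 0")
    case False
    have "\<mu> \<le> (norm (A ((1 / norm y) *\<^sub>R y)))\<^sup>2"
      unfolding \<mu>_def using bdd unit[OF y False] by (rule cINF_lower)
    also have "\<dots> = (norm (A y))\<^sup>2 / (norm y)\<^sup>2"
      using y W(2) by (simp add: A_scaleR power_divide)
    finally show ?thesis
      using False by (simp add: pos_le_divide_eq)
  qed simp
  have "\<exists>w\<in>S. (norm (A w))\<^sup>2 < \<mu> + 1 / real (Suc n)" for n
    using cInf_lessD[of "(\<lambda>w. (norm (A w))\<^sup>2) ` S" "\<mu> + 1 / real (Suc n)"] S0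
    by (auto simp: \<mu>_def)
  then obtain x where x: "\<And>n. x n \<in> S" "\<And>n. (norm (A (x n)))\<^sup>2 < \<mu> + 1 / real (Suc n)"
    by metis
  have xW: "x n \<in> W" "x n \<in> D" "x n \<in> Z" "norm (x n) = 1" for n
    using x(1) W(2) by (auto simp: S_def)
  have "norm (A (x n)) \<le> \<mu> + 2" for n
  proof -
    have "(norm (A (x n)))\<^sup>2 \<le> \<mu> + 1"
      using x(2)[of n] by (smt (verit) divide_le_eq_1 of_nat_0_le_iff of_nat_Suc)
    also have "\<dots> \<le> (\<mu> + 2)\<^sup>2"
      using \<mu>0 by (simp add: power2_eq_square algebra_simps)
    finally show ?thesis
      by (rule power2_le_imp_le) (use \<mu>0 in simp)
  qed
  moreover have "norm (x n) \<le> \<mu> + 2" for n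
    using \<mu>0 xW by simp
  ultimately obtain r w where r: "strict_mono r" and lim: "(x \<circ> r) \<longlonglongrightarrow> w"
    using graph_bounded_subseq[of x "\<mu> + 2"] xW by blast
  define y where "y = x \<circ> r"
  have y: "y n \<in> W" "y n \<in> D" "y n \<in> Z" "norm (y n) = 1" for n
    using xW by (auto simp: y_def)
  have y2: "(norm (A (y n)))\<^sup>2 < \<mu> + 1 / real (Suc n)" for n
  proof -
    have "1 / real (Suc (r n)) \<le> 1 / real (Suc n)"
      using seq_suble[OF r, of n] by (intro divide_left_mono) auto
    then show ?thesis
      using x(2)[of "r n"] by (simp add: y_def)
  qed
  have ylim: "y \<longlonglongrightarrow> w"
    using lim by (simp add: y_def)
  have close: "(norm (A (y m) - A (y n)))\<^sup>2 \<le> 2 / real (Suc m) + 2 / real (Suc n) + \<mu> * (norm (y m - y n))\<^sup>2" for m n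
  proof -
    have "\<mu> * (norm (y m + y n))\<^sup>2 \<le> (norm (A (y m + y n)))\<^sup>2"
      using y W(1) by (intro \<mu>_le csubspace_add) auto
    moreover have "(norm (y m + y n))\<^sup>2 = 4 - (norm (y m - y n))\<^sup>2"
      using parallelogram[of "y m" "y n"] y by simp
    ultimately show ?thesis
      using parallelogram[of "A (y m)" "A (y n)"] y2[of m] y2[of n] y(2)
      by (simp add: A_add algebra_simps del: of_nat_Suc)
  qed
  have "Cauchy (\<lambda>n. A (y n))"
  proof (rule metric_CauchyI)
    fix e :: real assume e: "e > 0"
    then obtain N1 where N1: "1 / real (Suc N1) < e\<^sup>2 / 8"
      using reals_Archimedean[of "e\<^sup>2 / 8"] by (auto simp: inverse_eq_divide)
    define d where "d = e / (2 * (\<mu> + 1))"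
    have "d > 0"
      using e \<mu>0 by (simp add: d_def)
    then obtain N2 where N2: "\<And>m n. m \<ge> N2 \<Longrightarrow> n \<ge> N2 \<Longrightarrow> dist (y m) (y n) < d"
      using LIMSEQ_imp_Cauchy[OF ylim] unfolding Cauchy_def by blast
    have "dist (A (y m)) (A (y n)) < e" if "m \<ge> max N1 N2" "n \<ge> max N1 N2" for m n
    proof -
      have "2 / real (Suc m) \<le> 2 / real (Suc N1)" "2 / real (Suc n) \<le> 2 / real (Suc N1)"
        using that by (simp_all add: frac_le)
      moreover have "\<mu> * (norm (y m - y n))\<^sup>2 \<le> e\<^sup>2 / 4"
      proof -
        have "(norm (y m - y n))\<^sup>2 \<le> d\<^sup>2"
          using N2[of m n] that by (intro power_mono) (auto simp: dist_norm)
        then have "\<mu> * (norm (y m - y n))\<^sup>2 \<le> \<mu> * d\<^sup>2"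
          using \<mu>0 by (rule mult_left_mono)
        also have "\<mu> * d\<^sup>2 \<le> (\<mu> + 1)\<^sup>2 * d\<^sup>2"
          using \<mu>0 by (intro mult_right_mono) (auto simp: power2_eq_square algebra_simps)
        also have "(\<mu> + 1)\<^sup>2 * d\<^sup>2 = ((\<mu> + 1) * d)\<^sup>2"
          by (simp add: power_mult_distrib)
        also have "(\<mu> + 1) * d = e / 2"
          using \<mu>0 by (simp add: d_def field_simps)
        also have "(e / 2)\<^sup>2 = e\<^sup>2 / 4"
          by (simp add: power_divide)
        finally show ?thesis .
      qed
      ultimately have "(norm (A (y m) - A (y n)))\<^sup>2 < e\<^sup>2"
        using close[of m n] N1 zero_less_power[OF e, of 2] by linarith
      then show ?thesis
        unfolding dist_norm by (rule power2_less_imp_less) (use e in simp)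
    qed
    then show "\<exists>M. \<forall>m\<ge>M. \<forall>n\<ge>M. dist (A (y m)) (A (y n)) < e"
      by blast
  qed
  then obtain v where v: "(\<lambda>n. A (y n)) \<longlonglongrightarrow> v"
    using Cauchy_convergent_iff convergent_def by blast
  have wD: "w \<in> D" "A w = v"
    using closed_operator[OF y(2) ylim v] by auto
  have wW: "w \<in> W"
    using W(2) wD closed_sequentially[OF W(3)] y(3) ylim by blast
  have nw: "norm w = 1"
    using tendsto_norm[OF ylim] y(4) by (simp add: LIMSEQ_const_iff)
  have "(norm (A w))\<^sup>2 \<le> \<mu> + 0"
  proof (rule LIMSEQ_le)
    show "(\<lambda>n. (norm (A (y n)))\<^sup>2) \<longlonglongrightarrow> (norm (A w))\<^sup>2"
      unfolding wD by (intro tendsto_intros v)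
    show "(\<lambda>n. \<mu> + 1 / real (Suc n)) \<longlonglongrightarrow> \<mu> + 0"
      by (intro tendsto_intros lim_1_over_n[THEN LIMSEQ_Suc])
  qed (use y2 less_imp_le in blast)
  then have Aw: "(norm (A w))\<^sup>2 = \<mu>"
    using \<mu>_le[OF wW] nw by simp
  have "cinner (A w) (A u) = complex_of_real \<mu> * cinner w u" if u: "u \<in> W" for u
  proof (rule ccontr)
    define q where "q = cinner (A w) (A u) - complex_of_real \<mu> * cinner w u"
    define p where "p = (norm (A u))\<^sup>2 - \<mu> * (norm u)\<^sup>2"
    assume "cinner (A w) (A u) \<noteq> complex_of_real \<mu> * cinner w u"
    then have q: "q \<noteq> 0"
      by (simp add: q_def)
    have p: "p \<ge> 0"
      using \<mu>_le[OF u] by (simp add: p_def)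
    \<comment> \<open>the second variation is \<open>p\<close>, so replacing \<open>w\<close> by \<open>w - c u\<close> changes the quadratic form by
        \<open>-2 |q|\<^sup>2/(p+1) + |q|\<^sup>2 p/(p+1)\<^sup>2\<close>, which is negative unless \<open>q = 0\<close>\<close>
    define c where "c = complex_of_real (1 / (p + 1)) * q"
    have cu: "c *\<^sub>C u \<in> W"
      using u W(1) csubspace_scale by blast
    then have "w - c *\<^sub>C u \<in> W"
      using wW W(1) csubspace_diff by blast
    then have "\<mu> * (norm (w - c *\<^sub>C u))\<^sup>2 \<le> (norm (A (w - c *\<^sub>C u)))\<^sup>2"
      by (rule \<mu>_le)
    moreover have expand: "(norm (a - b))\<^sup>2 = (norm a)\<^sup>2 - 2 * Re (cinner a b) + (norm b)\<^sup>2" for a b :: 'h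
      by (simp add: power2_norm_eq_inner Re_cinner inner_simps inner_commute)
    moreover have "A (w - c *\<^sub>C u) = A w - c *\<^sub>C A u"
      using wD u cu W(2) by (simp add: A_diff A_scaleC)
    ultimately have "\<mu> * (1 - 2 * Re (cinner w (c *\<^sub>C u)) + (cmod c * norm u)\<^sup>2)
        \<le> \<mu> - 2 * Re (cinner (A w) (c *\<^sub>C A u)) + (cmod c * norm (A u))\<^sup>2"
      by (simp only: expand Aw nw norm_scaleC) simp
    then have "2 * Re (cnj c * q) \<le> (cmod c)\<^sup>2 * p"
      by (simp add: q_def p_def cinner_simps algebra_simps power_mult_distrib)
    moreover have "cnj c * q = complex_of_real ((cmod q)\<^sup>2 / (p + 1))"
      using complex_norm_square[of q] by (simp add: c_def mult.commute)
    moreover have "(cmod c)\<^sup>2 * p = ((cmod q)\<^sup>2 / (p + 1)) * (p / (p + 1))"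
      using p by (simp add: c_def norm_mult norm_divide power_mult_distrib power2_eq_square)
    ultimately have "2 * ((cmod q)\<^sup>2 / (p + 1)) \<le> ((cmod q)\<^sup>2 / (p + 1)) * (p / (p + 1))"
      by (metis Re_complex_of_real)
    moreover have "((cmod q)\<^sup>2 / (p + 1)) * (p / (p + 1)) < ((cmod q)\<^sup>2 / (p + 1)) * 2"
      by (rule mult_strict_left_mono) (use q p in \<open>simp_all add: divide_less_eq\<close>)
    ultimately show False
      by (metis mult.commute not_le)
  qed
  then show ?thesis
    using that[OF wW _ \<mu>0] nw by force
qed

text \<open>
  The minimizer \<open>w\<close> in \<open>spec_null\<close> satisfies \<open>A\<^sup>2 w = m\<^sup>2 w\<close>. As \<open>(A - m)(A + m) w = 0\<close>, either
  \<open>A w + m w\<close> or \<open>w\<close> itself is an eigenvector, but an eigenvector in \<open>spec_null\<close> is orthogonal to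
  itself.
\<close>
lemma spec_null_trivial: "spec_null = {0}"
proof (rule ccontr)
  assume "spec_null \<noteq> {0}"
  then obtain z0 where z0: "z0 \<in> spec_null" "z0 \<noteq> 0"
    using csubspace_spec_null csubspace_0 by blast
  obtain y where y: "y \<in> D" "dist y z0 < norm z0"
    using closure_D z0(2) closure_approachable[of z0 D] by (metis UNIV_I zero_less_norm_iff)
  \<comment> \<open>a vector of \<open>D\<close> close to \<open>z0\<close> is not orthogonal to it, so it has a nonzero part in \<open>spec_null\<close>\<close>
  define w0 where "w0 = y - spec_part y"
  define W where "W = D \<inter> spec_null"
  have W: "csubspace W"
    unfolding W_def using csubspace_D csubspace_spec_null by (simp add: csubspace_inter)
  have w0: "w0 \<in> W"
    unfolding W_def w0_def using spec_null_diff A_spec_part(1)[OF y(1)] y(1) csubspace_D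
    by (simp add: csubspace_diff)
  have "w0 \<noteq> 0"
  proof
    assume "w0 = 0"
    then have "cinner z0 (- y) = 0"
      using cinner_spec_part[OF z0(1), of y] by (simp add: w0_def)
    then have "(norm (z0 - y))\<^sup>2 = (norm z0)\<^sup>2 + (norm y)\<^sup>2"
      using norm_add_orthogonal[of z0 "- y"] by simp
    moreover have "(norm (z0 - y))\<^sup>2 < (norm z0)\<^sup>2"
      using y(2) by (intro power_strict_mono) (auto simp: dist_norm norm_minus_commute)
    ultimately show False
      by (smt (verit) zero_le_power2)
  qed
  then obtain w \<mu> where w: "w \<in> W" "w \<noteq> 0" "\<mu> \<ge> 0"
    and crit: "\<And>y. y \<in> W \<Longrightarrow> cinner (A w) (A y) = complex_of_real \<mu> * cinner w y"
    using exists_minimizer[OF W W_def closed_spec_null w0] by blast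
  have wD: "w \<in> D" "w \<in> spec_null"
    using w(1) by (auto simp: W_def)
  have Aw: "A w \<in> spec_null"
    using A_spec_null wD by blast
  have "cinner (A u) (A w) = cinner u (\<mu> *\<^sub>R w)" if u: "u \<in> D" for u
  proof -
    have sD: "spec_part u \<in> D"
      using A_spec_part(1)[OF u] .
    have "u - spec_part u \<in> W"
      unfolding W_def using u sD csubspace_D spec_null_diff by (simp add: csubspace_diff)
    then have "cinner (A w) (A (u - spec_part u)) = complex_of_real \<mu> * cinner w (u - spec_part u)"
      by (rule crit)
    then have "cinner (A w) (A u) = complex_of_real \<mu> * cinner w u"
      using cinner_spec_part Aw wD(2) by (simp add: A_diff[OF u sD] A_spec_part(2)[OF u] cinner_simps)
    then have "cnj (cinner (A w) (A u)) = cnj (complex_of_real \<mu> * cinner w u)"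
      by simp
    then show ?thesis
      by (simp add: cinner_simps cinner_commute[symmetric])
  qed
  then have AAw: "A w \<in> D" "A (A w) = \<mu> *\<^sub>R w"
    using adjoint_domain by blast+
  define m where "m = sqrt \<mu>"
  have m: "m * m = \<mu>"
    using w(3) by (simp add: m_def)
  define v where "v = A w + m *\<^sub>R w"
  have weight: "m *\<^sub>R w \<in> D"
    using wD csubspace_D csubspace_scaleR by blast
  have "v \<in> E m"
    unfolding v_def eigenspace_def using AAw wD weight csubspace_D
    by (simp add: csubspace_add A_add A_scaleR m[symmetric] scaleR_add_right)
  moreover have "v \<in> spec_null"
    unfolding v_def using Aw wD csubspace_spec_null
    by (simp add: csubspace_add csubspace_scaleR)
  ultimately have "v = 0"
    unfolding spec_null_def by (metis (mono_tags, lifting) cinner_self_eq_0 mem_Collect_eq)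
  then have "A w = (- m) *\<^sub>R w"
    by (simp add: v_def eq_neg_iff_add_eq_0)
  then have "w \<in> E (- m)"
    using wD by (simp add: eigenspace_def)
  then have "w = 0"
    using wD(2) unfolding spec_null_def by (metis (mono_tags, lifting) cinner_self_eq_0 mem_Collect_eq)
  then show False
    using w(2) by simp
qed

theorem has_sum_P: "((\<lambda>t. P t x) has_sum x) UNIV"
  using spec_null_diff[of x] has_sum_spec_part[of x] by (simp add: spec_null_trivial)

section \<open>Functional calculus by components\<close>

lemma components_eqI: "(\<And>t. P t x = P t y) \<Longrightarrow> x = y"
  using has_sum_P[of x] has_sum_P[of y] has_sum_unique by simp blast

lemma cinner_has_sum: "((\<lambda>t. cinner (P t x) (P t y)) has_sum cinner x y) UNIV"
proof -
  have "((\<lambda>t. cinner (P t x) y) has_sum cinner x y) UNIV"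
    by (rule has_sum_bounded_linear[OF bounded_linear_cinner_left has_sum_P])
  moreover have "cinner (P t x) y = cinner (P t x) (P t y)" for t
    using cinner_P[of t "P t x" y] by (simp add: P_P)
  ultimately show ?thesis
    by simp
qed

lemma cinner_eqI: "(\<And>t. cinner (P t x) (P t y) = cinner (P t x') (P t y')) \<Longrightarrow> cinner x y = cinner x' y'"
  using cinner_has_sum[of x y] cinner_has_sum[of x' y'] has_sum_unique by simp blast

lemma cinner_eq_0I: "(\<And>t. cinner (P t x) (P t y) = 0) \<Longrightarrow> cinner x y = 0"
  using cinner_eqI[of x y 0 0] by (simp add: P_zero)

lemma parseval: "((\<lambda>t. (norm (P t x))\<^sup>2) has_sum (norm x)\<^sup>2) UNIV"
  using cinner_has_sum[of x x] unfolding cinner_self has_sum_of_real_iff .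

lemma norm_le_componentwise:
  assumes "\<And>t. norm (P t x) \<le> C * norm (P t y)" "C \<ge> 0"
  shows "norm x \<le> C * norm y"
proof -
  have "((\<lambda>t. C\<^sup>2 * (norm (P t y))\<^sup>2) has_sum C\<^sup>2 * (norm y)\<^sup>2) UNIV"
    by (intro has_sum_cmult_right parseval)
  moreover have "(norm (P t x))\<^sup>2 \<le> C\<^sup>2 * (norm (P t y))\<^sup>2" for t
    using power_mono[OF assms(1)[of t], of 2] by (simp add: power_mult_distrib)
  ultimately have "(norm x)\<^sup>2 \<le> (C * norm y)\<^sup>2"
    unfolding power_mult_distrib using has_sum_mono[OF parseval[of x]] by blast
  then show ?thesis
    by (rule power2_le_imp_le) (use assms(2) in simp)
qed

lemma mem_fun_calc_dom: "x \<in> fun_calc_dom D A f \<longleftrightarrow> (\<lambda>t. (f t)\<^sup>2 * (norm (P t x))\<^sup>2) summable_on UNIV"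
  by (simp add: fun_calc_dom_def power_mult_distrib)

lemma P_fun_calc: "x \<in> fun_calc_dom D A f \<Longrightarrow> P t (fun_calc D A f x) = f t *\<^sub>R P t x"
  unfolding fun_calc_def fun_calc_dom_def mem_Collect_eq
  by (rule exists_vector_with_components) (use P_in csubspace_E csubspace_scaleR in blast)

lemma fun_calc_eqI:
  assumes "x \<in> fun_calc_dom D A f" "\<And>t. P t y = f t *\<^sub>R P t x"
  shows "fun_calc D A f x = y"
  by (rule components_eqI) (simp add: P_fun_calc assms)

lemma fun_calc_dom_mono:
  assumes "x \<in> fun_calc_dom D A f" "\<And>t. \<bar>g t\<bar> * norm (P t y) \<le> C * (\<bar>f t\<bar> * norm (P t x))"
  shows "y \<in> fun_calc_dom D A g"
  unfolding mem_fun_calc_dom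
proof (rule summable_on_comparison_test)
  show "(\<lambda>t. C\<^sup>2 * ((f t)\<^sup>2 * (norm (P t x))\<^sup>2)) summable_on UNIV"
    using assms(1) unfolding mem_fun_calc_dom by (rule summable_on_cmult_right)
  show "(g t)\<^sup>2 * (norm (P t y))\<^sup>2 \<le> C\<^sup>2 * ((f t)\<^sup>2 * (norm (P t x))\<^sup>2)" for t
    using power_mono[OF assms(2)[of t], of 2] by (simp add: power_mult_distrib)
qed simp

lemma fun_calc_dom_bounded: "(\<And>t. \<bar>f t\<bar> \<le> C) \<Longrightarrow> x \<in> fun_calc_dom D A f"
  using fun_calc_dom_mono[of x "\<lambda>_. 1" f x C] P_square_summable[of x] mult_right_mono[of _ C "norm (P _ x)"]
  by (simp add: mem_fun_calc_dom)

lemma csubspace_fun_calc_dom: "csubspace (fun_calc_dom D A f)"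
proof -
  have "x + y \<in> fun_calc_dom D A f" if "x \<in> fun_calc_dom D A f" "y \<in> fun_calc_dom D A f" for x y
    unfolding mem_fun_calc_dom
  proof (rule summable_on_comparison_test)
    show "(\<lambda>t. 2 * ((f t)\<^sup>2 * (norm (P t x))\<^sup>2) + 2 * ((f t)\<^sup>2 * (norm (P t y))\<^sup>2)) summable_on UNIV"
      using that unfolding mem_fun_calc_dom by (intro summable_on_add summable_on_cmult_right)
    have "(norm (a + b))\<^sup>2 \<le> 2 * (norm a)\<^sup>2 + 2 * (norm b)\<^sup>2" for a b :: 'h
      using parallelogram[of a b] by (smt (verit) zero_le_power2)
    then have "(f t)\<^sup>2 * (norm (P t (x + y)))\<^sup>2 \<le> (f t)\<^sup>2 * (2 * (norm (P t x))\<^sup>2 + 2 * (norm (P t y))\<^sup>2)" for t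
      by (intro mult_left_mono) (auto simp: P_add)
    then show "(f t)\<^sup>2 * (norm (P t (x + y)))\<^sup>2
        \<le> 2 * ((f t)\<^sup>2 * (norm (P t x))\<^sup>2) + 2 * ((f t)\<^sup>2 * (norm (P t y))\<^sup>2)" for t
      by (simp add: algebra_simps)
  qed simp
  moreover have "c *\<^sub>C x \<in> fun_calc_dom D A f" if "x \<in> fun_calc_dom D A f" for c x
    using that by (rule fun_calc_dom_mono[where C = "cmod c"]) (simp add: P_scaleC norm_scaleC)
  moreover have "0 \<in> fun_calc_dom D A f"
    by (simp add: mem_fun_calc_dom P_zero)
  ultimately show ?thesis
    by (simp add: csubspace_def)
qed

lemma fun_calc_add:
  "x \<in> fun_calc_dom D A f \<Longrightarrow> y \<in> fun_calc_dom D A f \<Longrightarrow>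
    fun_calc D A f (x + y) = fun_calc D A f x + fun_calc D A f y"
  by (rule fun_calc_eqI)
    (simp_all add: csubspace_add csubspace_fun_calc_dom P_add P_fun_calc scaleR_add_right)

lemma fun_calc_scaleC:
  "x \<in> fun_calc_dom D A f \<Longrightarrow> fun_calc D A f (c *\<^sub>C x) = c *\<^sub>C fun_calc D A f x"
  by (rule fun_calc_eqI)
    (simp_all add: csubspace_scale csubspace_fun_calc_dom P_scaleC P_fun_calc
      scaleR_eq_scaleC scaleC_scaleC mult.commute)

lemma norm_fun_calc_le:
  assumes "\<And>t. \<bar>f t\<bar> \<le> C"
  shows "norm (fun_calc D A f x) \<le> C * norm x"
proof (rule norm_le_componentwise)
  show "C \<ge> 0"
    using assms[of 0] by simp
  show "norm (P t (fun_calc D A f x)) \<le> C * norm (P t x)" for t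
    using mult_right_mono[OF assms[of t], of "norm (P t x)"] by (simp add: P_fun_calc fun_calc_dom_bounded[OF assms])
qed

lemma bounded_linear_fun_calc:
  assumes "\<And>t. \<bar>f t\<bar> \<le> C"
  shows "bounded_linear (fun_calc D A f)"
proof (rule bounded_linear_intro[where K = C])
  have "x \<in> fun_calc_dom D A f" for x
    using assms by (rule fun_calc_dom_bounded)
  then show "fun_calc D A f (x + y) = fun_calc D A f x + fun_calc D A f y"
    "fun_calc D A f (r *\<^sub>R x) = r *\<^sub>R fun_calc D A f x" for x y r
    by (simp_all add: fun_calc_add fun_calc_scaleC scaleR_eq_scaleC)
  show "norm (fun_calc D A f x) \<le> norm x * C" for x
    using norm_fun_calc_le[OF assms] by (simp add: mult.commute)
qed

text \<open>
  If the \<open>t P\<^sub>t x\<close> are square summable, their sum is the image of \<open>x\<close> under the adjoint of \<open>A\<close>.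
\<close>
lemma D_eq_fun_calc_dom: "D = fun_calc_dom D A (\<lambda>t. t)"
proof
  show "D \<subseteq> fun_calc_dom D A (\<lambda>t. t)"
  proof
    fix x assume "x \<in> D"
    then show "x \<in> fun_calc_dom D A (\<lambda>t. t)"
      using P_square_summable[of "A x"] by (simp add: mem_fun_calc_dom P_A power_mult_distrib)
  qed
  show "fun_calc_dom D A (\<lambda>t. t) \<subseteq> D"
  proof
    fix x assume x: "x \<in> fun_calc_dom D A (\<lambda>t. t)"
    have "cinner (A u) x = cinner u (fun_calc D A (\<lambda>t. t) x)" if "u \<in> D" for u
      by (rule cinner_eqI) (simp add: P_A[OF that] P_fun_calc[OF x] cinner_simps)
    then show "x \<in> D"
      using adjoint_domain(1) by blast
  qed
qed

lemma P_spec_proj: "P t (spec_proj D A J x) = (if t \<in> J then P t x else 0)"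
proof -
  have "x \<in> fun_calc_dom D A (indicator J)"
    by (rule fun_calc_dom_bounded[where C = 1]) (simp add: indicator_def)
  then show ?thesis
    by (simp add: spec_proj_def P_fun_calc indicator_def)
qed

lemma bounded_linear_spec_proj: "bounded_linear (spec_proj D A J)"
  unfolding spec_proj_def by (rule bounded_linear_fun_calc[where C = 1]) (simp add: indicator_def)

lemmas spec_proj_add = linear_simps(1)[OF bounded_linear_spec_proj]
lemmas spec_proj_diff = linear_simps(2)[OF bounded_linear_spec_proj]
lemmas spec_proj_zero = linear_simps(3)[OF bounded_linear_spec_proj]
lemmas tendsto_spec_proj = bounded_linear.tendsto[OF bounded_linear_spec_proj]

lemma spec_proj_scaleC: "spec_proj D A J (c *\<^sub>C x) = c *\<^sub>C spec_proj D A J x"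
  by (rule components_eqI) (simp add: P_spec_proj P_scaleC)

lemma norm_spec_proj_le: "norm (spec_proj D A J x) \<le> norm x"
  using norm_le_componentwise[of "spec_proj D A J x" 1 x] by (simp add: P_spec_proj)

definition trunc :: "nat \<Rightarrow> 'h \<Rightarrow> 'h" where
  "trunc n = spec_proj D A {- real n..real n}"

lemma P_trunc: "P t (trunc n x) = (if \<bar>t\<bar> \<le> real n then P t x else 0)"
  by (auto simp: trunc_def P_spec_proj)

lemmas trunc_add = spec_proj_add[of "{- real n..real n}" for n, folded trunc_def]
lemmas trunc_scaleC = spec_proj_scaleC[of "{- real n..real n}" for n, folded trunc_def]
lemmas norm_trunc_le = norm_spec_proj_le[of "{- real n..real n}" for n, folded trunc_def]

text \<open>
  Truncation to a spectral interval is at least as good an approximation as any finite partial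
  sum of components with indices in the interval.
\<close>
lemma trunc_tendsto: "(\<lambda>n. trunc n x) \<longlonglongrightarrow> x"
proof (rule metric_LIMSEQ_I)
  fix e :: real assume "e > 0"
  then obtain F where F: "finite F" "dist (\<Sum>t\<in>F. P t x) x < e"
    using has_sum_P[of x] unfolding has_sum_def tendsto_iff eventually_finite_subsets_at_top
    by (metis order_refl)
  obtain N where N: "\<And>t. t \<in> F \<Longrightarrow> \<bar>t\<bar> \<le> real N"
  proof -
    obtain N where "Max (insert 0 (abs ` F)) \<le> real N"
      using real_arch_simple by blast
    then show ?thesis
      using that F(1) by (metis Max_ge finite_imageI finite_insert image_eqI insertI2 order_trans)
  qed
  let ?s = "\<Sum>t\<in>F. P t x"
  have "dist (trunc n x) x < e" if "n \<ge> N" for n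
  proof -
    have Ps: "P t ?s = (if t \<in> F then P t x else 0)" for t
      using F(1) by (simp add: P_sum P_P)
    have "norm (P t (trunc n x - x)) \<le> 1 * norm (P t (?s - x))" for t
      using N[of t] that by (auto simp: P_diff P_trunc Ps)
    then have "norm (trunc n x - x) \<le> 1 * norm (?s - x)"
      by (rule norm_le_componentwise) simp
    then show ?thesis
      using F(2) by (simp add: dist_norm)
  qed
  then show "\<exists>N. \<forall>n\<ge>N. dist (trunc n x) x < e"
    by blast
qed

section \<open>The weights and the flattening\<close>

definition supp :: "'h \<Rightarrow> real set \<Rightarrow> bool" where
  "supp x J \<longleftrightarrow> (\<forall>t. t \<notin> J \<longrightarrow> P t x = 0)"

lemma suppD: "supp x J \<Longrightarrow> t \<notin> J \<Longrightarrow> P t x = 0"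
  by (simp add: supp_def)

lemma supp_mono: "supp x I \<Longrightarrow> I \<subseteq> J \<Longrightarrow> supp x J"
  by (auto simp: supp_def)

lemma supp_spec_proj: "supp (spec_proj D A J x) J"
  by (simp add: supp_def P_spec_proj)

lemma spec_proj_id: "supp x J \<Longrightarrow> spec_proj D A J x = x"
  by (rule components_eqI) (simp add: supp_def P_spec_proj)

lemma spec_proj_eq_0: "supp x I \<Longrightarrow> I \<inter> J = {} \<Longrightarrow> spec_proj D A J x = 0"
  by (rule components_eqI) (auto simp: supp_def P_spec_proj P_zero)

lemma cinner_supp_eq_0: "supp x I \<Longrightarrow> supp y J \<Longrightarrow> I \<inter> J = {} \<Longrightarrow> cinner x y = 0"
  by (rule cinner_eq_0I) (auto simp: supp_def, metis cinner_zero_left cinner_zero_right disjoint_iff)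

lemma cinner_spec_proj_left:
  assumes "supp y J"
  shows "cinner (spec_proj D A J x) y = cinner x y"
proof (rule cinner_eqI)
  show "cinner (P t (spec_proj D A J x)) (P t y) = cinner (P t x) (P t y)" for t
    using suppD[OF assms, of t] by (simp add: P_spec_proj)
qed

lemma csubspace_supp: "csubspace {x. supp x J}"
  by (auto simp: csubspace_def supp_def P_zero P_add P_scaleC)

lemma supp_add: "supp x J \<Longrightarrow> supp y J \<Longrightarrow> supp (x + y) J"
  and supp_diff: "supp x J \<Longrightarrow> supp y J \<Longrightarrow> supp (x - y) J"
  and supp_minus: "supp x J \<Longrightarrow> supp (- x) J"
  by (simp_all add: supp_def P_zero P_add P_diff P_minus)

lemma closed_supp: "closed {x. supp x J}"
proof -
  have "{x. supp x J} = {x. spec_proj D A J x = x}"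
    using spec_proj_id supp_spec_proj by (metis (no_types, lifting))
  also have "closed \<dots>"
    by (intro closed_Collect_eq continuous_intros linear_continuous_on bounded_linear_spec_proj)
  finally show ?thesis .
qed

lemma H_neg_eq: "H_neg D A = {x. supp x {..<0}}"
proof (intro set_eqI iffI)
  show "x \<in> {x. supp x {..<0}}" if "x \<in> H_neg D A" for x
    using that supp_spec_proj unfolding H_neg_def by blast
  show "x \<in> H_neg D A" if "x \<in> {x. supp x {..<0}}" for x
    using that spec_proj_id[of x "{..<0}"] rangeI[of "spec_proj D A {..<0}" x] by (simp add: H_neg_def)
qed

lemma E_eq_supp: "E t = {x. supp x {t}}"
proof (intro set_eqI iffI CollectI)
  show "supp x {t}" if "x \<in> E t" for x
    using P_E[OF that] by (simp add: supp_def)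
  show "x \<in> E t" if "x \<in> {x. supp x {t}}" for x
  proof -
    have "P t x = x"
      by (rule components_eqI) (use that in \<open>auto simp: supp_def P_P\<close>)
    then show ?thesis
      using P_in[of t x] by simp
  qed
qed

lemma ker_eq_E: "ker_op D A = E 0"
  by (simp add: ker_op_def eigenspace_def)

lemma ker_eq: "ker_op D A = {x. supp x {0}}"
  unfolding ker_eq_E by (rule E_eq_supp)

abbreviation Qm where "Qm \<equiv> spec_proj D A {..<0}"
abbreviation Qz where "Qz \<equiv> spec_proj D A {0}"
abbreviation Qp where "Qp \<equiv> spec_proj D A {0<..}"
abbreviation Qle where "Qle \<equiv> spec_proj D A {..0}"

lemma eq_Qm_Qz_Qp: "x = Qm x + Qz x + Qp x"
  by (rule components_eqI) (auto simp: P_add P_spec_proj)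

lemma Qle_eq: "Qle x = Qm x + Qz x"
  by (rule components_eqI) (auto simp: P_add P_spec_proj)

lemma eq_Qle_Qp: "x = Qle x + Qp x"
  by (rule components_eqI) (auto simp: P_add P_spec_proj)

definition lam :: "real \<Rightarrow> real" where "lam t = (1 + t\<^sup>2) powr (1/4)"

lemma lam_ge_1: "lam t \<ge> 1"
  by (simp add: lam_def ge_one_powr_ge_zero)

lemma lam_pos: "lam t > 0" and lam_nonneg: "lam t \<ge> 0" and lam_neq_0: "lam t \<noteq> 0"
  using lam_ge_1[of t] by auto

lemma lam_minus: "lam (- t) = lam t"
  by (simp add: lam_def)

lemma lam_0: "lam 0 = 1"
  by (simp add: lam_def)

lemma inverse_lam: "(1 + t\<^sup>2) powr (- (1/4)) = 1 / lam t"
  by (simp add: lam_def powr_minus inverse_eq_divide)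

lemma inverse_lam_le: "\<bar>1 / lam t\<bar> \<le> 1"
  using lam_ge_1[of t] by (simp add: divide_le_eq)

lemma lam_sq: "(lam t)\<^sup>2 = sqrt (1 + t\<^sup>2)"
proof -
  have "(lam t)\<^sup>2 = (1 + t\<^sup>2) powr (1/4 + 1/4)"
    unfolding lam_def power2_eq_square powr_add ..
  then show ?thesis
    by (simp add: powr_half_sqrt)
qed

abbreviation "Lam \<equiv> bessel D A (1/2)"
definition "Li = bessel D A (-1/2)"
abbreviation "Hh \<equiv> sob D A (1/2)"

lemma Lam_eq: "Lam = fun_calc D A lam"
  unfolding bessel_def lam_def by simp

lemma Li_eq: "Li = fun_calc D A (\<lambda>t. 1 / lam t)"
  unfolding Li_def bessel_def by (simp add: inverse_lam)

lemma Hh_eq: "Hh = fun_calc_dom D A lam"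
proof
  have sq: "(\<bar>t\<bar> powr (1/2))\<^sup>2 = \<bar>t\<bar>" for t :: real
    by (simp add: powr_half_sqrt)
  show "Hh \<subseteq> fun_calc_dom D A lam"
  proof
    fix x assume "x \<in> Hh"
    then have "(\<lambda>t. \<bar>t\<bar> * (norm (P t x))\<^sup>2) summable_on UNIV"
      unfolding sob_def mem_fun_calc_dom sq .
    then have "(\<lambda>t. \<bar>t\<bar> * (norm (P t x))\<^sup>2 + (norm (P t x))\<^sup>2) summable_on UNIV"
      by (intro summable_on_add P_square_summable)
    moreover have "(lam t)\<^sup>2 * (norm (P t x))\<^sup>2 \<le> \<bar>t\<bar> * (norm (P t x))\<^sup>2 + (norm (P t x))\<^sup>2" for t
    proof -
      have "sqrt (1 + t\<^sup>2) \<le> \<bar>t\<bar> + 1"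
        by (rule real_le_lsqrt) (simp_all add: power2_eq_square algebra_simps)
      then have "sqrt (1 + t\<^sup>2) * (norm (P t x))\<^sup>2 \<le> (\<bar>t\<bar> + 1) * (norm (P t x))\<^sup>2"
        by (rule mult_right_mono) simp
      then show ?thesis
        unfolding lam_sq by (simp add: distrib_right)
    qed
    ultimately show "x \<in> fun_calc_dom D A lam"
      unfolding mem_fun_calc_dom by (rule summable_on_comparison_test) simp_all
  qed
  show "fun_calc_dom D A lam \<subseteq> Hh"
  proof
    fix x assume x: "x \<in> fun_calc_dom D A lam"
    have "\<bar>\<bar>t\<bar> powr (1/2)\<bar> \<le> lam t" for t
    proof (rule power2_le_imp_le)
      have "\<bar>t\<bar> = sqrt (t\<^sup>2)"
        by simp
      also have "\<dots> \<le> sqrt (1 + t\<^sup>2)"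
        by (subst real_sqrt_le_iff) simp
      finally show "(\<bar>\<bar>t\<bar> powr (1/2)\<bar>)\<^sup>2 \<le> (lam t)\<^sup>2"
        unfolding lam_sq power2_abs sq .
    qed (rule lam_nonneg)
    then have "\<bar>\<bar>t\<bar> powr (1/2)\<bar> * norm (P t x) \<le> 1 * (\<bar>lam t\<bar> * norm (P t x))" for t
      using lam_nonneg[of t] by (simp add: mult_right_mono)
    then show "x \<in> Hh"
      unfolding sob_def by (rule fun_calc_dom_mono[OF x])
  qed
qed

lemma P_Lam: "x \<in> Hh \<Longrightarrow> P t (Lam x) = lam t *\<^sub>R P t x"
  unfolding Hh_eq Lam_eq by (rule P_fun_calc)

lemma Li_dom: "x \<in> fun_calc_dom D A (\<lambda>t. 1 / lam t)"
  by (rule fun_calc_dom_bounded) (rule inverse_lam_le)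

lemma P_Li: "P t (Li x) = (1 / lam t) *\<^sub>R P t x"
  unfolding Li_eq by (rule P_fun_calc[OF Li_dom])

lemma bounded_linear_Li: "bounded_linear Li"
  unfolding Li_eq by (rule bounded_linear_fun_calc[where C = 1]) (rule inverse_lam_le)

lemmas Li_add = linear_simps(1)[OF bounded_linear_Li]
lemmas Li_diff = linear_simps(2)[OF bounded_linear_Li]

lemma Li_scaleC: "Li (c *\<^sub>C x) = c *\<^sub>C Li x"
  unfolding Li_eq by (rule fun_calc_scaleC[OF Li_dom])

lemma norm_Li_le: "norm (Li x) \<le> norm x"
  using norm_fun_calc_le[of "\<lambda>t. 1 / lam t" 1 x, OF inverse_lam_le] by (simp add: Li_eq)

lemma Hh_mono: "x \<in> Hh \<Longrightarrow> (\<And>t. norm (P t y) \<le> C * norm (P t x)) \<Longrightarrow> y \<in> Hh"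
  unfolding Hh_eq
  by (erule fun_calc_dom_mono[where C = C])
    (simp only: mult.left_commute[of C] mult_left_mono abs_ge_zero)

lemma Li_Hh: "Li x \<in> Hh"
  unfolding Hh_eq
proof (rule fun_calc_dom_mono[where f = "\<lambda>_. 1" and C = 1])
  show "x \<in> fun_calc_dom D A (\<lambda>_. 1)"
    by (rule fun_calc_dom_bounded[where C = 1]) simp
  show "\<bar>lam t\<bar> * norm (P t (Li x)) \<le> 1 * (\<bar>1\<bar> * norm (P t x))" for t
    using lam_pos[of t] by (simp add: P_Li)
qed

lemma Lam_Li: "Lam (Li x) = x"
  by (rule components_eqI) (simp add: P_Lam Li_Hh P_Li lam_neq_0)

lemma Li_Lam: "x \<in> Hh \<Longrightarrow> Li (Lam x) = x"
  by (rule components_eqI) (simp add: P_Lam Li_Hh P_Li lam_neq_0)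

lemma csubspace_Hh: "csubspace Hh"
  unfolding Hh_eq by (rule csubspace_fun_calc_dom)

lemmas Hh_add = csubspace_add[OF csubspace_Hh]
lemmas Hh_diff = csubspace_diff[OF csubspace_Hh]
lemmas Hh_scaleC = csubspace_scale[OF csubspace_Hh]
lemmas Hh_zero = csubspace_0[OF csubspace_Hh]
lemmas Hh_minus = csubspace_neg[OF csubspace_Hh]

lemma Lam_add: "x \<in> Hh \<Longrightarrow> y \<in> Hh \<Longrightarrow> Lam (x + y) = Lam x + Lam y"
  unfolding Hh_eq Lam_eq by (rule fun_calc_add)

lemma Lam_scaleC: "x \<in> Hh \<Longrightarrow> Lam (c *\<^sub>C x) = c *\<^sub>C Lam x"
  unfolding Hh_eq Lam_eq by (rule fun_calc_scaleC)

lemma norm_le_Lam: "x \<in> Hh \<Longrightarrow> norm x \<le> norm (Lam x)"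
  using norm_Li_le[of "Lam x"] by (simp add: Li_Lam)

lemma spec_proj_Hh: "x \<in> Hh \<Longrightarrow> spec_proj D A J x \<in> Hh"
  by (erule Hh_mono[where C = 1]) (simp add: P_spec_proj)

lemma trunc_Hh: "trunc n x \<in> Hh"
  unfolding Hh_eq
proof (rule fun_calc_dom_mono[where f = "\<lambda>_. 1" and C = "lam n"])
  show "x \<in> fun_calc_dom D A (\<lambda>_. 1)"
    by (rule fun_calc_dom_bounded[where C = 1]) simp
  show "\<bar>lam t\<bar> * norm (P t (trunc n x)) \<le> lam n * (\<bar>1\<bar> * norm (P t x))" for t
  proof (cases "\<bar>t\<bar> \<le> real n")
    case True
    then have "t\<^sup>2 \<le> (real n)\<^sup>2"
      using abs_le_square_iff[of t "real n"] by simp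
    then have "lam t \<le> lam n"
      unfolding lam_def by (intro powr_mono2) simp_all
    then show ?thesis
      using lam_nonneg[of t] True by (simp add: P_trunc mult_right_mono)
  qed (simp add: P_trunc lam_nonneg)
qed

text \<open>
  Vectors of the kernel are their own truncations at level \<open>0\<close>.
\<close>
lemma ker_subset_Hh: "supp x {0} \<Longrightarrow> x \<in> Hh"
proof -
  assume x: "supp x {0}"
  have "x = trunc 0 x"
    by (rule components_eqI) (use x in \<open>auto simp: P_trunc supp_def\<close>)
  then show ?thesis
    using trunc_Hh[of 0 x] by simp
qed

lemma cinner_Li: "cinner (Li x) y = cinner x (Li y)"
  by (rule cinner_eqI) (simp add: P_Li cinner_simps)

lemma cinner_Lam: "x \<in> Hh \<Longrightarrow> y \<in> Hh \<Longrightarrow> cinner (Lam x) y = cinner x (Lam y)"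
  by (rule cinner_eqI) (simp add: P_Lam cinner_simps)

lemma supp_Lam: "x \<in> Hh \<Longrightarrow> supp x J \<Longrightarrow> supp (Lam x) J"
  by (simp add: supp_def P_Lam)

lemma supp_Li: "supp x J \<Longrightarrow> supp (Li x) J"
  by (simp add: supp_def P_Li)

text \<open>
  The weights of the flattening: \<open>M\<close> below is \<open>(1 + A\<^sup>2)\<^bsup>1/4\<^esup>\<close> on the nonpositive part and
  \<open>(1 + A\<^sup>2)\<^bsup>-1/4\<^esup>\<close> on the positive part. The two weights agree at \<open>0\<close>, so that \<open>weight_minus\<close> holds
  for all \<open>t\<close>.
\<close>
definition weight :: "real \<Rightarrow> real" where
  "weight t = (if t \<le> 0 then lam t else 1 / lam t)"

definition M :: "'h \<Rightarrow> 'h" where "M = fun_calc D A weight"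

lemma weight_pos: "weight t > 0" and weight_neq_0: "weight t \<noteq> 0"
  using lam_pos[of t] by (auto simp: weight_def)

lemma weight_le: "weight t \<le> lam t"
proof -
  have "1 / lam t \<le> 1"
    using inverse_lam_le[of t] by linarith
  then have "1 / lam t \<le> lam t"
    using lam_ge_1[of t] by (rule order_trans)
  then show ?thesis
    by (simp only: weight_def order_refl split: if_split) simp
qed

lemma weight_minus: "weight t * weight (- t) = 1"
  using lam_neq_0[of t] by (auto simp: weight_def lam_minus lam_0)

lemma Hh_subset_dom_M: "x \<in> Hh \<Longrightarrow> x \<in> fun_calc_dom D A weight"
  unfolding Hh_eq
  by (erule fun_calc_dom_mono[where C = 1]) (use weight_le weight_pos less_imp_le[OF weight_pos] lam_nonneg in \<open>simp add: mult_right_mono\<close>)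

lemma P_M: "x \<in> Hh \<Longrightarrow> P t (M x) = weight t *\<^sub>R P t x"
  unfolding M_def by (rule P_fun_calc[OF Hh_subset_dom_M])

lemma M_add: "x \<in> Hh \<Longrightarrow> y \<in> Hh \<Longrightarrow> M (x + y) = M x + M y"
  unfolding M_def by (rule fun_calc_add) (simp_all add: Hh_subset_dom_M)

lemma M_eqI: "x \<in> Hh \<Longrightarrow> (\<And>t. P t y = weight t *\<^sub>R P t x) \<Longrightarrow> M x = y"
  by (rule components_eqI) (simp add: P_M)

lemma M_le: "x \<in> Hh \<Longrightarrow> supp x {..0} \<Longrightarrow> M x = Lam x"
  by (rule M_eqI) (auto simp: P_Lam supp_def weight_def)

lemma M_gt: "x \<in> Hh \<Longrightarrow> supp x {0<..} \<Longrightarrow> M x = Li x"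
  by (rule M_eqI) (auto simp: P_Li supp_def weight_def)

lemma M_ker: "supp x {0} \<Longrightarrow> M x = x"
proof -
  assume x: "supp x {0}"
  have "P t x = weight t *\<^sub>R P t x" for t
    using suppD[OF x, of t] by (cases "t = 0") (simp_all add: weight_def lam_0)
  then show ?thesis
    using M_eqI[OF ker_subset_Hh[OF x], of x] by blast
qed

lemma supp_M: "x \<in> Hh \<Longrightarrow> supp (M x) J \<longleftrightarrow> supp x J"
  by (simp add: supp_def P_M weight_neq_0)

end

section \<open>The action of gamma\<close>

locale dirac = discrete_operator D A for D :: "'h::complex_hilbert set" and A +
  fixes \<gamma> :: "'h \<Rightarrow> 'h"
  assumes gamma_endo: "bounded_endo UNIV \<gamma>"
    and gamma_D: "\<gamma> ` D \<subseteq> D"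
    and gamma_adjoint: "is_adjoint_on UNIV \<gamma> (\<lambda>x. - \<gamma> x)"
    and gamma_gamma: "\<gamma> (\<gamma> x) = - x"
    and gamma_A: "x \<in> D \<Longrightarrow> A (\<gamma> x) + \<gamma> (A x) = 0"
begin

lemma gamma_add: "\<gamma> (x + y) = \<gamma> x + \<gamma> y"
  and gamma_scaleC: "\<gamma> (c *\<^sub>C x) = c *\<^sub>C \<gamma> x"
  using gamma_endo unfolding bounded_endo_def clinear_on_def by auto

lemma gamma_scaleR: "\<gamma> (r *\<^sub>R x) = r *\<^sub>R \<gamma> x"
  by (simp add: scaleR_eq_scaleC gamma_scaleC)

lemma gamma_zero [simp]: "\<gamma> 0 = 0"
  using gamma_add[of 0 0] by simp

lemma gamma_minus: "\<gamma> (- x) = - \<gamma> x"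
  using gamma_add[of x "- x"] by (simp add: eq_neg_iff_add_eq_0 add.commute)

lemma gamma_diff: "\<gamma> (x - y) = \<gamma> x - \<gamma> y"
  using gamma_add[of x "- y"] by (simp add: gamma_minus)

lemmas gamma_simps = gamma_add gamma_minus gamma_diff gamma_gamma gamma_scaleC gamma_scaleR

lemma cinner_gamma_left: "cinner (\<gamma> x) y = - cinner x (\<gamma> y)"
  using gamma_adjoint unfolding is_adjoint_on_def by simp

lemma cinner_gamma_gamma: "cinner (\<gamma> x) (\<gamma> y) = cinner x y"
  by (simp add: cinner_gamma_left gamma_gamma)

lemma norm_gamma [simp]: "norm (\<gamma> x) = norm x"
  using cinner_gamma_gamma[of x x] unfolding cinner_self
  by (metis norm_ge_zero of_real_eq_iff power2_eq_iff_nonneg)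

lemma bounded_linear_gamma: "bounded_linear \<gamma>"
  by (rule bounded_linear_intro[where K = 1]) (simp_all add: gamma_simps)

lemma gamma_eq_0 [simp]: "\<gamma> x = 0 \<longleftrightarrow> x = 0"
  by (metis norm_gamma norm_eq_zero)

lemma gamma_E: "x \<in> E t \<Longrightarrow> \<gamma> x \<in> E (- t)"
  using gamma_A[of x] gamma_D by (auto simp: eigenspace_def gamma_scaleR eq_neg_iff_add_eq_0)

text \<open>
  \<open>\<gamma>\<close> anticommutes with \<open>A\<close>, hence maps the eigenspace of \<open>-t\<close> to the one of \<open>t\<close>.
\<close>
lemma P_gamma: "P t (\<gamma> x) = \<gamma> (P (- t) x)"
proof (rule orth_proj_eqI[OF csubspace_E])
  show "\<gamma> (P (- t) x) \<in> E t"
    using gamma_E[OF P_in[of "- t" x]] by simp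
  fix z assume "z \<in> E t"
  then have "cinner (x - P (- t) x) (\<gamma> z) = 0"
    using P_ortho gamma_E by blast
  then show "cinner (\<gamma> x - \<gamma> (P (- t) x)) z = 0"
    by (simp add: gamma_diff[symmetric] cinner_gamma_left)
qed

lemma supp_gamma: "supp x J \<Longrightarrow> (\<And>t. t \<in> J \<Longrightarrow> - t \<in> I) \<Longrightarrow> supp (\<gamma> x) I"
  unfolding supp_def P_gamma by (metis gamma_zero minus_minus)

lemma gamma_fun_calc_dom:
  assumes "x \<in> fun_calc_dom D A f" "\<And>t. f (- t) = f t"
  shows "\<gamma> x \<in> fun_calc_dom D A f"
proof -
  have "(\<lambda>t. (f t)\<^sup>2 * (norm (P t x))\<^sup>2) summable_on UNIV"
    using assms(1) by (simp add: mem_fun_calc_dom)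
  moreover have "bij_betw (uminus :: real \<Rightarrow> real) UNIV UNIV"
    by (simp add: bij_uminus)
  ultimately have "(\<lambda>t. (f (- t))\<^sup>2 * (norm (P (- t) x))\<^sup>2) summable_on UNIV"
    using summable_on_reindex_bij_betw[of uminus UNIV UNIV "\<lambda>t. (f t)\<^sup>2 * (norm (P t x))\<^sup>2"] by simp
  then show ?thesis
    by (simp add: mem_fun_calc_dom P_gamma assms(2))
qed

lemma gamma_Hh: "x \<in> Hh \<Longrightarrow> \<gamma> x \<in> Hh"
  unfolding Hh_eq by (rule gamma_fun_calc_dom[where f = lam]) (simp_all add: lam_minus)

lemma Li_gamma: "Li (\<gamma> x) = \<gamma> (Li x)"
  by (rule components_eqI) (simp add: P_Li P_gamma lam_minus gamma_scaleR)

text \<open>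
  The reason for the choice of weights: the components paired by \<open>\<langle>x, \<gamma> y\<rangle>\<close> belong to opposite
  eigenvalues, so the weights cancel.
\<close>
lemma cinner_M: "x \<in> Hh \<Longrightarrow> y \<in> Hh \<Longrightarrow> cinner (M x) (\<gamma> (M y)) = cinner x (\<gamma> y)"
proof (rule cinner_eqI)
  fix t assume "x \<in> Hh" "y \<in> Hh"
  then have "cinner (P t (M x)) (P t (\<gamma> (M y))) = complex_of_real (weight t * weight (- t)) * cinner (P t x) (\<gamma> (P (- t) y))"
    by (simp add: P_gamma P_M gamma_scaleR cinner_simps)
  then show "cinner (P t (M x)) (P t (\<gamma> (M y))) = cinner (P t x) (P t (\<gamma> y))"
    by (simp add: weight_minus P_gamma)
qed

text \<open>
  The image under \<open>M\<close> is its own annihilator for \<open>\<langle>x, \<gamma> y\<rangle>\<close>, that is, a Lagrangian subspace of \<open>H\<close>.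
  These \<open>X\<close> correspond to the regular self-adjoint boundary conditions.
\<close>
definition half_lag :: "'h set \<Rightarrow> bool" where
  "half_lag X \<longleftrightarrow> csubspace X \<and> X \<subseteq> Hh \<and> M ` X = {b. \<forall>x\<in>X. cinner (M x) (\<gamma> b) = 0}"

section \<open>From data to Lagrangian subspaces\<close>

lemma lagrangian_data:
  assumes "lagrangian D A \<gamma> L"
  shows "csubspace L" "l \<in> L \<Longrightarrow> supp l {0}" "l \<in> L \<Longrightarrow> l' \<in> L \<Longrightarrow> cinner l (\<gamma> l') = 0"
    "supp x {0} \<Longrightarrow> \<exists>l\<in>L. \<exists>l'\<in>L. x = l + \<gamma> l'"
  using assms unfolding lagrangian_def orthogonal_sets_def ker_eq sum_set_def by blast+

text \<open>
  Think of \<open>e\<close> as the element \<open>Lam e\<close> of \<open>H\<^bsup>-1/2\<^esup>\<close>: if it annihilates \<open>V \<inter> H\<^bsup>1/2\<^esup>\<close>, then it is an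
  element of \<open>F\<close>. The functional that it induces on \<open>F\<close> is represented by some \<open>z \<in> F\<close>. As \<open>F\<close>
  lies in \<open>H\<^bsup>1/2\<^esup>\<close>, the splitting along \<open>F\<close> and \<open>V\<close> preserves \<open>H\<^bsup>1/2\<^esup>\<close>, and so \<open>z\<close> represents the functional
  on all of \<open>H\<^sub><\<close>.
\<close>
lemma annihilator_of_complement:
  assumes F: "finite_dimensional F" "F \<subseteq> Hh" "\<And>f. f \<in> F \<Longrightarrow> supp f {..<0}"
    and FV: "\<And>f v. f \<in> F \<Longrightarrow> v \<in> V \<Longrightarrow> cinner f v = 0"
    and dec: "\<And>x. supp x {..<0} \<Longrightarrow> \<exists>f\<in>F. \<exists>v\<in>V. x = f + v"
    and e: "supp e {..<0}" "\<And>v. v \<in> V \<Longrightarrow> v \<in> Hh \<Longrightarrow> cinner (Lam v) e = 0"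
  shows "\<exists>f\<in>F. e = Li f"
proof -
  have "\<exists>z\<in>F. \<forall>x\<in>F. cinner (Lam x) e = cinner x z"
    using F(2) by (intro riesz_finite_dimensional[OF F(1)]) (simp_all add: subset_iff Lam_add Lam_scaleC cinner_simps)
  then obtain z where z: "z \<in> F" "\<And>x. x \<in> F \<Longrightarrow> cinner (Lam x) e = cinner x z"
    by blast
  have "cinner a e = cinner a (Li z)" if a: "supp a {..<0}" for a
  proof -
    obtain f v where fv: "f \<in> F" "v \<in> V" "Li a = f + v"
      using dec[OF supp_Li[OF a]] by blast
    have f: "f \<in> Hh"
      using F(2) fv by blast
    have "v = Li a - f"
      using fv by simp
    then have v: "v \<in> Hh"
      using f Li_Hh Hh_diff by blast
    have "cinner v z = 0"
      using FV[OF z(1) fv(2)] cinner_eq_0_commute by blast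
    then have "cinner (Li a) z = cinner f z"
      by (simp add: fv cinner_simps)
    moreover have "cinner a e = cinner (Lam (f + v)) e"
      using Lam_Li[of a] fv by simp
    then have "cinner a e = cinner f z"
      using e(2)[OF fv(2) v] z(2)[OF fv(1)] f v by (simp add: Lam_add cinner_simps)
    ultimately show ?thesis
      by (simp add: cinner_Li)
  qed
  from this[of "e - Li z"] have "cinner (e - Li z) (e - Li z) = 0"
    using e(1) F(3)[OF z(1)] by (simp add: cinner_diff_right supp_diff supp_Li)
  then show ?thesis
    using z(1) by auto
qed

lemma bc_data_facts:
  assumes "bc_data D A \<gamma> L F V g"
  shows "lagrangian D A \<gamma> L" "csubspace F" "csubspace V" "finite_dimensional F"
    and "f \<in> F \<Longrightarrow> v \<in> V \<Longrightarrow> cinner f v = 0"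
    and "f \<in> F \<Longrightarrow> supp f {..<0}" "f \<in> F \<Longrightarrow> f \<in> Hh"
    and "v \<in> V \<Longrightarrow> supp v {..<0}"
    and "supp x {..<0} \<Longrightarrow> \<exists>f\<in>F. \<exists>v\<in>V. x = f + v"
    and "csubspace (sum_set V L)"
    and "w \<in> sum_set V L \<Longrightarrow> g w \<in> sum_set V L"
    and "w \<in> sum_set V L \<Longrightarrow> w' \<in> sum_set V L \<Longrightarrow> g (w + w') = g w + g w'"
    and "w \<in> sum_set V L \<Longrightarrow> g (c *\<^sub>C w) = c *\<^sub>C g w"
    and "w \<in> sum_set V L \<Longrightarrow> w \<in> Hh \<Longrightarrow> g w \<in> Hh"
    and "w \<in> sum_set V L \<Longrightarrow> w' \<in> sum_set V L \<Longrightarrow> cinner (g w) w' = cinner w (g w')"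
proof -
  note d = assms[unfolded bc_data_def]
  show "lagrangian D A \<gamma> L" and F: "csubspace F" and V: "csubspace V" "finite_dimensional F"
    using d by blast+
  have FV: "sum_set F V = {x. supp x {..<0}}"
    using d unfolding H_neg_eq by blast
  show "f \<in> F \<Longrightarrow> v \<in> V \<Longrightarrow> cinner f v = 0"
    using d unfolding orthogonal_sets_def by blast
  show "f \<in> F \<Longrightarrow> supp f {..<0}"
  proof -
    assume "f \<in> F"
    then have "f + 0 \<in> sum_set F V"
      unfolding sum_set_def using csubspace_0[OF V(1)] by blast
    then show ?thesis
      unfolding FV by simp
  qed
  show "v \<in> V \<Longrightarrow> supp v {..<0}"
  proof -
    assume "v \<in> V"
    then have "0 + v \<in> sum_set F V"
      unfolding sum_set_def using csubspace_0[OF F] by blast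
    then show ?thesis
      unfolding FV by simp
  qed
  have "F \<subseteq> sob_spec D A (1/2) {..<0}"
    using d by blast
  then show "f \<in> F \<Longrightarrow> f \<in> Hh"
    unfolding sob_spec_def using spec_proj_Hh by blast
  show "supp x {..<0} \<Longrightarrow> \<exists>f\<in>F. \<exists>v\<in>V. x = f + v"
    using FV unfolding sum_set_def by blast
  have hs: "half_smooth D A (sum_set V L) g" and sa: "is_adjoint_on (sum_set V L) g g"
    using d by blast+
  show "csubspace (sum_set V L)"
    using hs unfolding half_smooth_def by blast
  have be: "bounded_endo (sum_set V L) g"
    using hs unfolding half_smooth_def by blast
  then show "w \<in> sum_set V L \<Longrightarrow> g w \<in> sum_set V L"
    unfolding bounded_endo_def by blast
  have "clinear_on (sum_set V L) g"
    using be unfolding bounded_endo_def by blast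
  then show "w \<in> sum_set V L \<Longrightarrow> w' \<in> sum_set V L \<Longrightarrow> g (w + w') = g w + g w'"
    "w \<in> sum_set V L \<Longrightarrow> g (c *\<^sub>C w) = c *\<^sub>C g w"
    unfolding clinear_on_def by blast+
  show "w \<in> sum_set V L \<Longrightarrow> w \<in> Hh \<Longrightarrow> g w \<in> Hh"
    using hs unfolding half_smooth_def by blast
  show "w \<in> sum_set V L \<Longrightarrow> w' \<in> sum_set V L \<Longrightarrow> cinner (g w) w' = cinner w (g w')"
    using sa unfolding is_adjoint_on_def by blast
qed

text \<open>
  Isotropy holds because all pairings between the summands vanish for reasons of spectral support
  or orthogonality, except for \<open>\<langle>g w, w'\<rangle> - \<langle>w, g w'\<rangle>\<close>. For maximality, an annihilating \<open>b\<close> is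
  reduced in three steps: its component in \<open>F\<close> vanishes, subtracting an element of the graph
  removes its components in \<open>V\<close> and \<open>L\<close>, and the rest is in \<open>M (\<gamma> F)\<close>. The sum is
  direct because both \<open>\<gamma> F\<close> and \<open>\<gamma> (V \<oplus> L)\<close> are orthogonal to \<open>V \<oplus> L\<close>, so that a common element has
  \<open>w = 0\<close>.
\<close>
theorem half_lag_of_data:
  assumes "bc_data D A \<gamma> L F V g"
  shows "half_lag (sum_set (\<gamma> ` F) (bc_graph D A \<gamma> L V g))"
    and "\<gamma> ` F \<inter> bc_graph D A \<gamma> L V g = {0}"
proof -
  note d = bc_data_facts[OF assms]
  note lag = lagrangian_data[OF d(1)]
  define U where "U = sum_set V L"
  define X where "X = {\<gamma> f + (w + \<gamma> (g w)) | f w. f \<in> F \<and> w \<in> U \<and> w \<in> Hh}"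
  have X_eq: "sum_set (\<gamma> ` F) (bc_graph D A \<gamma> L V g) = X"
    unfolding sum_set_def bc_graph_def X_def U_def by blast
  note g = d(11-15)[folded U_def]
  have subU: "csubspace U"
    using d(10) by (simp add: U_def)
  have subL: "csubspace L"
    by (rule lag(1))
  have U_dec: "\<exists>v\<in>V. \<exists>l\<in>L. u = v + l" if "u \<in> U" for u
    using that by (auto simp: U_def sum_set_def)
  have VL_U: "v + l \<in> U" if "v \<in> V" "l \<in> L" for v l
    using that by (auto simp: U_def sum_set_def)
  have V_U: "v \<in> U" if "v \<in> V" for v
    using VL_U[OF that csubspace_0[OF subL]] by simp
  have L_U: "l \<in> U" if "l \<in> L" for l
    using VL_U[OF csubspace_0[OF d(3)] that] by simp
  have suppV: "supp v {..0}" if "v \<in> V" for v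
    by (rule supp_mono[OF d(8)[OF that]]) auto
  have suppL: "supp l {..0}" if "l \<in> L" for l
    by (rule supp_mono[OF lag(2)[OF that]]) auto
  have suppU: "supp u {..0}" if "u \<in> U" for u
    using U_dec[OF that] suppV suppL supp_add by blast
  have supp\<gamma>: "supp (\<gamma> x) {0..}" if "supp x {..0}" for x
    by (rule supp_gamma[OF that]) auto
  have supp\<gamma>': "supp (\<gamma> x) {0<..}" if "supp x {..<0}" for x
    by (rule supp_gamma[OF that]) auto
  have supp\<gamma>'': "supp (\<gamma> x) {..<0}" if "supp x {0<..}" for x
    by (rule supp_gamma[OF that]) auto
  have supp\<gamma>0: "supp (\<gamma> x) {0}" if "supp x {0}" for x
    by (rule supp_gamma[OF that]) auto
  have FU: "cinner f u = 0" "cinner u f = 0" if fu: "f \<in> F" "u \<in> U" for f u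
  proof -
    obtain v l where vl: "v \<in> V" "l \<in> L" "u = v + l"
      using U_dec[OF fu(2)] by blast
    have "cinner f l = 0"
      by (rule cinner_supp_eq_0[OF d(6)[OF fu(1)] lag(2)[OF vl(2)]]) auto
    then show "cinner f u = 0"
      using d(5)[OF fu(1) vl(1)] by (simp add: vl(3) cinner_simps)
    then show "cinner u f = 0"
      using cinner_eq_0_commute by blast
  qed
  have U\<gamma>U: "cinner u (\<gamma> u') = 0" if uu: "u \<in> U" "u' \<in> U" for u u'
  proof -
    obtain v l where vl: "v \<in> V" "l \<in> L" "u = v + l"
      using U_dec[OF uu(1)] by blast
    obtain v' l' where vl': "v' \<in> V" "l' \<in> L" "u' = v' + l'"
      using U_dec[OF uu(2)] by blast
    have "cinner v (\<gamma> u') = 0"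
      by (rule cinner_supp_eq_0[OF d(8)[OF vl(1)] supp\<gamma>[OF suppU[OF uu(2)]]]) auto
    moreover have "cinner l (\<gamma> v') = 0"
      by (rule cinner_supp_eq_0[OF lag(2)[OF vl(2)] supp\<gamma>'[OF d(8)[OF vl'(1)]]]) auto
    moreover have "cinner l (\<gamma> l') = 0"
      by (rule lag(3)) (use vl vl' in auto)
    ultimately show ?thesis
      by (simp add: vl(3) vl'(3) gamma_add cinner_add_left cinner_add_right)
  qed
  have F\<gamma>: "cinner f (\<gamma> x) = 0" if "f \<in> F" "supp x {..0}" for f x
    by (rule cinner_supp_eq_0[OF d(6)[OF that(1)] supp\<gamma>[OF that(2)]]) auto
  have U\<gamma>F: "cinner u (\<gamma> f) = 0" if "f \<in> F" "u \<in> U" for f u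
    by (rule cinner_supp_eq_0[OF suppU[OF that(2)] supp\<gamma>'[OF d(6)[OF that(1)]]]) auto
  have suppF: "supp f {..0}" if "f \<in> F" for f
    by (rule supp_mono[OF d(6)[OF that]]) auto
  have gU: "g w \<in> U" if "w \<in> U" for w
    by (rule g(1)[OF that])
  have X_Hh: "x \<in> Hh" if "x \<in> X" for x
    using that g(4) d(7) unfolding X_def by (auto intro!: Hh_add gamma_Hh)
  have F0: "0 \<in> F" and U0: "0 \<in> U"
    using d(2) subU csubspace_0 by blast+
  have g0: "g 0 = 0"
    using g(3)[OF U0, of 0] by simp
  have XI: "\<gamma> f + (w + \<gamma> (g w)) \<in> X" if "f \<in> F" "w \<in> U" "w \<in> Hh" for f w
    using that unfolding X_def by blast
  have XF: "\<gamma> f \<in> X" if "f \<in> F" for f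
    using XI[OF that U0 Hh_zero] by (simp add: g0)
  have XU: "w + \<gamma> (g w) \<in> X" if "w \<in> U" "w \<in> Hh" for w
    using XI[OF F0 that] by simp
  have subX: "csubspace X"
    unfolding csubspace_def
  proof (intro conjI ballI allI)
    show "0 \<in> X"
      using XF[OF F0] by simp
    fix x assume x: "x \<in> X"
    then obtain f w where fw: "f \<in> F" "w \<in> U" "w \<in> Hh" "x = \<gamma> f + (w + \<gamma> (g w))"
      unfolding X_def by blast
    show "c *\<^sub>C x \<in> X" for c
    proof -
      have "c *\<^sub>C x = \<gamma> (c *\<^sub>C f) + (c *\<^sub>C w + \<gamma> (g (c *\<^sub>C w)))"
        using fw by (simp add: gamma_scaleC scaleC_add_right g(3))
      then show ?thesis
        using XI[of "c *\<^sub>C f" "c *\<^sub>C w"] fw d(2) subU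
        by (simp add: csubspace_scale Hh_scaleC)
    qed
    fix y assume y: "y \<in> X"
    then obtain f' w' where fw': "f' \<in> F" "w' \<in> U" "w' \<in> Hh" "y = \<gamma> f' + (w' + \<gamma> (g w'))"
      unfolding X_def by blast
    have "x + y = \<gamma> (f + f') + ((w + w') + \<gamma> (g (w + w')))"
      using fw fw' by (simp add: gamma_add g(2))
    also have "\<dots> \<in> X"
      using fw fw' d(2) subU by (intro XI) (simp_all add: csubspace_add Hh_add)
    finally show "x + y \<in> X" .
  qed
  have iso: "cinner x (\<gamma> y) = 0" if xy: "x \<in> X" "y \<in> X" for x y
  proof -
    obtain f w where fw: "f \<in> F" "w \<in> U" "w \<in> Hh" "x = \<gamma> f + (w + \<gamma> (g w))"
      using xy(1) unfolding X_def by blast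
    obtain f' w' where fw': "f' \<in> F" "w' \<in> U" "w' \<in> Hh" "y = \<gamma> f' + (w' + \<gamma> (g w'))"
      using xy(2) unfolding X_def by blast
    have "cinner w (g w') = cinner (g w) w'"
      using g(5) fw fw' by simp
    then show ?thesis
      using FU[OF fw(1) fw'(2)] FU[OF fw'(1) fw(2)] U\<gamma>U[OF fw(2) fw'(2)]
        F\<gamma>[OF fw(1) suppF[OF fw'(1)]] F\<gamma>[OF fw(1) suppU[OF gU[OF fw'(2)]]]
        U\<gamma>U[OF gU[OF fw(2)] gU[OF fw'(2)]] F\<gamma>[OF fw'(1) suppU[OF gU[OF fw(2)]]]
        U\<gamma>F[OF fw'(1) gU[OF fw(2)]]
      by (simp add: fw(4) fw'(4) gamma_simps cinner_gamma_left cinner_simps)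
  qed
  have MX: "cinner (M x) (\<gamma> (M y)) = 0" if "x \<in> X" "y \<in> X" for x y
    using cinner_M[OF X_Hh[OF that(1)] X_Hh[OF that(2)]] iso[OF that] by simp
  have maximal: "b \<in> M ` X" if b: "\<forall>x\<in>X. cinner (M x) (\<gamma> b) = 0" for b
  proof -
    \<comment> \<open>the nonpositive part of the element of the boundary space that \<open>b\<close> stands for; only this part is
        known to be in \<open>H\<^bsup>1/2\<^esup>\<close>\<close>
    define y where "y = Li (Qle b)"
    have yH: "y \<in> Hh" and sy: "supp y {..0}"
      unfolding y_def by (simp_all add: Li_Hh supp_Li supp_spec_proj)
    obtain f0 v0 where fv0: "f0 \<in> F" "v0 \<in> V" "Qm y = f0 + v0"
      using d(9)[OF supp_spec_proj] by blast
    obtain l0 l1 where l01: "l0 \<in> L" "l1 \<in> L" "Qz y = l0 + \<gamma> l1"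
      using lag(4)[OF supp_spec_proj] by blast
    \<comment> \<open>test \<open>b\<close> against \<open>\<gamma> f0\<close>\<close>
    have f0: "f0 = 0"
    proof -
      have "0 = cinner (M (\<gamma> f0)) (\<gamma> b)"
        using b XF[OF fv0(1)] by simp
      also have "M (\<gamma> f0) = Li (\<gamma> f0)"
        by (rule M_gt[OF gamma_Hh[OF d(7)[OF fv0(1)]] supp\<gamma>'[OF d(6)[OF fv0(1)]]])
      also have "cinner (Li (\<gamma> f0)) (\<gamma> b) = cinner (Li f0) b"
        by (simp add: Li_gamma cinner_gamma_gamma)
      also have "\<dots> = cinner f0 (Li b)"
        by (rule cinner_Li)
      also have "\<dots> = cinner f0 (Qm y)"
      proof (rule cinner_eqI)
        show "cinner (P t f0) (P t (Li b)) = cinner (P t f0) (P t (Qm y))" for t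
          using suppD[OF d(6)[OF fv0(1)], of t] by (cases "t < 0") (simp_all add: y_def P_Li P_spec_proj)
      qed
      also have "\<dots> = cinner f0 f0"
        using d(5)[OF fv0(1,2)] by (simp add: fv0(3) cinner_simps)
      finally show ?thesis
        by simp
    qed
    define w0 where "w0 = v0 + l0"
    have w0U: "w0 \<in> U"
      unfolding w0_def using VL_U fv0 l01 by blast
    have l0H: "l0 \<in> Hh"
      using ker_subset_Hh lag(2) l01 by blast
    have w0H: "w0 \<in> Hh"
      using spec_proj_Hh[OF yH, of "{..<0}"] l0H by (simp add: w0_def fv0(3) f0 Hh_add)
    \<comment> \<open>the element of the graph over \<open>w0\<close>; after subtracting it, only \<open>\<gamma> L\<close> and the positive part are
        left\<close>
    define x1 where "x1 = w0 + \<gamma> (g w0)"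
    have x1: "x1 \<in> X"
      unfolding x1_def by (rule XU[OF w0U w0H])
    define b' where "b' = b - M x1"
    have b': "cinner (M x) (\<gamma> b') = 0" if "x \<in> X" for x
      using b that MX[OF that x1] by (simp add: b'_def gamma_diff cinner_simps)
    obtain v1 l3 where vl1: "v1 \<in> V" "l3 \<in> L" "g w0 = v1 + l3"
      using U_dec[OF gU[OF w0U]] by blast
    define l2 where "l2 = l1 - l3"
    have l2: "l2 \<in> L"
      unfolding l2_def using l01 vl1 subL csubspace_diff by blast
    have sl: "supp l0 {0}" "supp l1 {0}" "supp l2 {0}" "supp l3 {0}"
      using lag(2) l01 l2 vl1 by auto
    have Py: "P t y = (if t < 0 then P t v0 else if t = 0 then P t l0 + P t (\<gamma> l1) else 0)" for t
    proof -
      have "P t (Qm y) = P t v0" if "t < 0"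
        using fv0 f0 by simp
      moreover have "P t (Qz y) = P t (l0 + \<gamma> l1)" if "t = 0"
        using l01 by simp
      ultimately show ?thesis
        using suppD[OF sy, of t] by (auto simp: P_spec_proj P_add)
    qed
    have Py': "P t y = (1 / lam t) *\<^sub>R P t b" if "t \<le> 0" for t
      using that by (simp add: y_def P_Li P_spec_proj)
    define c where "c = Qp b'"
    have b'_eq: "b' = \<gamma> l2 + c"
    proof (rule components_eqI)
      fix t :: real
      have Pb': "P t b' = P t b - weight t *\<^sub>R P t x1"
        using X_Hh[OF x1] by (simp add: b'_def P_diff P_M)
      have Px1: "P t x1 = P t v0 + P t l0 + \<gamma> (P (- t) v1) + P t (\<gamma> l3)"
        by (simp only: x1_def vl1(3) gamma_add P_add P_gamma) (simp add: w0_def P_add P_gamma)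
      consider "t < 0" | "t = 0" | "t > 0" by linarith
      then show "P t b' = P t (\<gamma> l2 + c)"
      proof cases
        case 1
        then have "P t b = lam t *\<^sub>R P t y"
          using Py'[of t] lam_neq_0[of t] by simp
        then have "P t b = lam t *\<^sub>R P t v0"
          using Py[of t] 1 by simp
        moreover have "P (- t) v1 = 0" "P t l0 = 0" "P t (\<gamma> l3) = 0" "P t (\<gamma> l2) = 0"
          using 1 suppD[OF suppV[OF vl1(1)], of "- t"] suppD[OF sl(1), of t]
            suppD[OF supp\<gamma>0[OF sl(4)], of t] suppD[OF supp\<gamma>0[OF sl(3)], of t] by auto
        ultimately show ?thesis
          unfolding Pb' Px1 using 1 by (simp add: P_add c_def P_spec_proj weight_def)
      next
        case 2
        then have "P t b = P t l0 + P t (\<gamma> l1)"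
          using Py[of t] Py'[of t] by (simp add: lam_0)
        moreover have "P t v0 = 0" "P (- t) v1 = 0"
          using 2 suppD[OF d(8)[OF fv0(2)], of t] suppD[OF d(8)[OF vl1(1)], of "- t"] by auto
        ultimately show ?thesis
          unfolding Pb' Px1 using 2 by (simp add: P_add c_def P_spec_proj weight_def lam_0 l2_def gamma_diff P_diff)
      next
        case 3
        then show ?thesis
          using suppD[OF supp\<gamma>0[OF sl(3)], of t] by (simp add: P_add c_def P_spec_proj)
      qed
    qed
    have sc: "supp c {0<..}"
      unfolding c_def by (rule supp_spec_proj)
    have \<gamma>b': "\<gamma> b' = \<gamma> c - l2"
      by (simp add: b'_eq gamma_simps)
    \<comment> \<open>the term \<open>\<gamma> (g w)\<close> of the graph does not see the remainder\<close>
    have red: "cinner (M w) (\<gamma> b') = 0" if w: "w \<in> U" "w \<in> Hh" for w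
    proof -
      obtain v l where vl: "v \<in> V" "l \<in> L" "g w = v + l"
        using U_dec[OF gU[OF w(1)]] by blast
      have gwH: "\<gamma> (g w) \<in> Hh"
        by (intro gamma_Hh g(4) w)
      have lH: "\<gamma> l \<in> Hh"
        using vl ker_subset_Hh lag(2) gamma_Hh by blast
      then have vH: "\<gamma> v \<in> Hh"
        using gwH Hh_diff[of "\<gamma> (g w)" "\<gamma> l"] by (simp add: vl(3) gamma_add)
      have "M (\<gamma> (g w)) = M (\<gamma> v) + \<gamma> l"
        using lH vH M_ker[OF supp\<gamma>0[OF lag(2)[OF vl(2)]]] by (simp add: vl(3) gamma_add M_add)
      moreover have "cinner (M (\<gamma> v)) (\<gamma> b') = 0"
      proof (rule cinner_supp_eq_0[where I = "{0<..}" and J = "{..0}"])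
        show "supp (M (\<gamma> v)) {0<..}"
          unfolding supp_M[OF vH] by (rule supp\<gamma>'[OF d(8)[OF vl(1)]])
        show "supp (\<gamma> b') {..0}"
          unfolding \<gamma>b' by (rule supp_diff[OF supp_mono[OF supp\<gamma>''[OF sc]] suppL[OF l2]]) auto
      qed auto
      moreover have "cinner (\<gamma> l) (\<gamma> c) = 0"
        unfolding cinner_gamma_gamma by (rule cinner_supp_eq_0[OF lag(2)[OF vl(2)] sc]) auto
      moreover have "cinner (\<gamma> l) l2 = 0"
        using lag(3)[OF l2 vl(2)] cinner_eq_0_commute by blast
      ultimately have "cinner (M (\<gamma> (g w))) (\<gamma> b') = 0"
        by (simp add: cinner_add_left) (simp add: \<gamma>b' cinner_simps)
      moreover have "cinner (M (w + \<gamma> (g w))) (\<gamma> b') = 0"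
        by (rule b'[OF XU[OF w]])
      ultimately show ?thesis
        using w gwH by (simp add: M_add cinner_simps)
    qed
    have "l2 = 0"
    proof -
      have "cinner (M l2) (\<gamma> b') = 0"
        using red[OF L_U[OF l2] ker_subset_Hh[OF sl(3)]] .
      moreover have "cinner l2 (\<gamma> c) = 0"
        by (rule cinner_supp_eq_0[OF sl(3) supp\<gamma>''[OF sc]]) auto
      ultimately show ?thesis
        by (simp add: M_ker[OF sl(3)] \<gamma>b' cinner_simps)
    qed
    have "\<exists>f\<in>F. \<gamma> c = Li f"
    proof (rule annihilator_of_complement[OF d(4) _ d(6) d(5) d(9)])
      show "F \<subseteq> Hh"
        using d(7) by blast
      show "supp (\<gamma> c) {..<0}"
        by (rule supp\<gamma>''[OF sc])
      show "cinner (Lam v) (\<gamma> c) = 0" if "v \<in> V" "v \<in> Hh" for v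
        using red[OF V_U[OF that(1)] that(2)] M_le[OF that(2) suppV[OF that(1)]]
        by (simp add: \<gamma>b' \<open>l2 = 0\<close>)
    qed
    then obtain f where f: "f \<in> F" "\<gamma> c = Li f"
      by blast
    have nf: "- f \<in> F"
      using f d(2) csubspace_neg by blast
    have "c = - \<gamma> (\<gamma> c)"
      by (simp add: gamma_gamma)
    also have "\<dots> = Li (\<gamma> (- f))"
      by (simp add: f(2) Li_gamma gamma_minus linear_simps(4)[OF bounded_linear_Li])
    also have "\<dots> = M (\<gamma> (- f))"
      by (rule M_gt[symmetric, OF gamma_Hh[OF d(7)[OF nf]] supp\<gamma>'[OF d(6)[OF nf]]])
    finally have "b = M (\<gamma> (- f)) + M x1"
      using b'_eq by (simp add: b'_def \<open>l2 = 0\<close> diff_eq_eq)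
    also have "\<dots> = M (\<gamma> (- f) + x1)"
      using X_Hh[OF x1] gamma_Hh[OF d(7)[OF nf]] by (simp add: M_add)
    finally show ?thesis
      using XF[OF nf] x1 subX csubspace_add by blast
  qed
  have "M ` X = {b. \<forall>x\<in>X. cinner (M x) (\<gamma> b) = 0}"
    using MX maximal by blast
  then show "half_lag (sum_set (\<gamma> ` F) (bc_graph D A \<gamma> L V g))"
    unfolding X_eq half_lag_def using subX X_Hh by blast
  show "\<gamma> ` F \<inter> bc_graph D A \<gamma> L V g = {0}"
  proof
    show "\<gamma> ` F \<inter> bc_graph D A \<gamma> L V g \<subseteq> {0}"
    proof
      fix z assume z: "z \<in> \<gamma> ` F \<inter> bc_graph D A \<gamma> L V g"
      then obtain f w where fw: "f \<in> F" "z = \<gamma> f" "w \<in> U" "z = w + \<gamma> (g w)"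
        unfolding bc_graph_def U_def by blast
      have "cinner w w = cinner w (z - \<gamma> (g w))"
        using fw(4) by simp
      also have "\<dots> = cinner w (\<gamma> f) - cinner w (\<gamma> (g w))"
        using fw(2) by (simp add: cinner_simps)
      also have "cinner w (\<gamma> f) = 0"
        by (rule U\<gamma>F[OF fw(1,3)])
      also have "cinner w (\<gamma> (g w)) = 0"
        by (rule U\<gamma>U[OF fw(3) gU[OF fw(3)]])
      finally have "w = 0"
        by simp
      then show "z \<in> {0}"
        using fw(4) g0 by simp
    qed
    have "0 + \<gamma> (g 0) \<in> bc_graph D A \<gamma> L V g"
      unfolding bc_graph_def U_def[symmetric] using U0 Hh_zero by blast
    moreover have "\<gamma> 0 \<in> \<gamma> ` F"
      using F0 by blast
    ultimately show "{0} \<subseteq> \<gamma> ` F \<inter> bc_graph D A \<gamma> L V g"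
      by (simp add: g0)
  qed
qed

section \<open>Lagrangian subspaces of the kernel\<close>

lemma gamma_ker: "x \<in> ker_op D A \<Longrightarrow> \<gamma> x \<in> ker_op D A"
  unfolding ker_eq_E using gamma_E[of x 0] by simp

lemma csubspace_gamma_image: "csubspace S \<Longrightarrow> csubspace (\<gamma> ` S)"
  unfolding csubspace_def
  by (auto simp: gamma_add[symmetric] gamma_scaleC[symmetric])

lemma csubspace_ker: "csubspace (ker_op D A)"
  unfolding ker_eq_E by (rule csubspace_E)

lemma finite_dimensional_subset_ker:
  assumes "csubspace Y" "Y \<subseteq> ker_op D A"
  shows "finite_dimensional Y"
  by (rule finite_dimensional_if_A_bounded[OF assms(1), where C = 0]) (use assms(2) in \<open>auto simp: ker_op_def\<close>)

lemma csubspace_gamma_eigenspace: "csubspace {x \<in> ker_op D A. c *\<^sub>C \<gamma> x = x}"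
proof -
  have "c *\<^sub>C \<gamma> (a *\<^sub>C x) = a *\<^sub>C c *\<^sub>C \<gamma> x" for a x
    by (simp add: gamma_scaleC scaleC_scaleC mult.commute)
  then show ?thesis
    using csubspace_ker by (auto simp: csubspace_def gamma_add scaleC_add_right simp del: complex_vector.scale_scale)
qed

text \<open>
  For \<open>c = \<plusminus>\<i>\<close> the map \<open>e\<close> is, up to the factor \<open>sqrt 2\<close>, the projection to the eigenspace of \<open>c \<gamma>\<close>
  for the eigenvalue \<open>1\<close>. Since \<open>L\<close> and \<open>\<gamma> L\<close> are orthogonal, \<open>e\<close> is isometric on \<open>L\<close>; since they
  span the kernel and \<open>e \<circ> \<gamma>\<close> is a multiple of \<open>e\<close>, it is onto.
\<close>
lemma onb_gamma_eigenspace: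
  assumes L: "lagrangian D A \<gamma> L" and B: "onb B L" and c: "c * c = -1" "c * cnj c = 1"
  defines "e \<equiv> \<lambda>b. (1 / sqrt 2) *\<^sub>R (b + c *\<^sub>C \<gamma> b)"
  shows "onb (e ` B) {x \<in> ker_op D A. c *\<^sub>C \<gamma> x = x}" "inj_on e B"
proof -
  note lag = lagrangian_data[OF L]
  let ?K = "{x \<in> ker_op D A. c *\<^sub>C \<gamma> x = x}"
  have BL: "b \<in> L" if "b \<in> B" for b
    using onb_subset[OF B] that by blast
  have Lker: "l \<in> ker_op D A" if "l \<in> L" for l
    using L that unfolding lagrangian_def by blast
  have cc: "c *\<^sub>C c *\<^sub>C x = - x" for x :: 'h
    using complex_vector.scale_minus_left[of 1 x] by (simp add: scaleC_scaleC c)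
  have sq2: "complex_of_real (1 / sqrt 2) * complex_of_real (1 / sqrt 2) = 1 / 2"
    by (simp flip: of_real_mult)
  have ee: "cinner (e b) (e b') = cinner b b'" if "b \<in> L" "b' \<in> L" for b b'
  proof -
    have "cinner b (\<gamma> b') = 0" "cinner (\<gamma> b) b' = 0"
      using lag(3) that by (auto simp: cinner_gamma_left)
    then have "cinner (b + c *\<^sub>C \<gamma> b) (b' + c *\<^sub>C \<gamma> b') = cinner b b' + (c * cnj c) * cinner b b'"
      by (simp add: cinner_add_left cinner_add_right cinner_scaleC_left cinner_scaleC_right cinner_gamma_gamma)
    then have "cinner (b + c *\<^sub>C \<gamma> b) (b' + c *\<^sub>C \<gamma> b') = 2 * cinner b b'"
      by (simp add: c)
    then have "cinner (e b) (e b') = (complex_of_real (1 / sqrt 2) * complex_of_real (1 / sqrt 2)) * (2 * cinner b b')"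
      unfolding e_def cinner_scaleR_left cinner_scaleR_right by (simp only: mult.assoc)
    then show ?thesis
      by (simp only: sq2) simp
  qed
  have ortho: "cinner b b' = (if b = b' then 1 else 0)" if "b \<in> B" "b' \<in> B" for b b'
    using B that unfolding onb_def by blast
  show inj: "inj_on e B"
  proof (rule inj_onI)
    fix b b' assume b: "b \<in> B" "b' \<in> B" "e b = e b'"
    have "cinner b b' = cinner b b"
      using ee[OF BL[OF b(1)] BL[OF b(2)]] ee[OF BL[OF b(1)] BL[OF b(1)]] b(3) by simp
    then show "b = b'"
      using ortho b by (metis zero_neq_one)
  qed
  have K: "csubspace ?K"
    by (rule csubspace_gamma_eigenspace)
  have e_K: "e b \<in> ?K" if "b \<in> L" for b
  proof -
    have "c *\<^sub>C \<gamma> (b + c *\<^sub>C \<gamma> b) = b + c *\<^sub>C \<gamma> b"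
      using cc[of b] by (simp add: gamma_simps scaleC_add_right complex_vector.scale_minus_right
          complex_vector.scale_right_diff_distrib)
    moreover have "b + c *\<^sub>C \<gamma> b \<in> ker_op D A"
      using Lker[OF that] gamma_ker csubspace_ker csubspace_add csubspace_scale by blast
    ultimately show ?thesis
      using csubspace_scaleR[OF K, of "b + c *\<^sub>C \<gamma> b" "1 / sqrt 2"] by (simp add: e_def)
  qed
  have "cspan (e ` B) = ?K"
  proof
    show "cspan (e ` B) \<subseteq> ?K"
      using e_K BL K by (intro complex_vector.span_minimal) auto
    show "?K \<subseteq> cspan (e ` B)"
    proof
      fix x assume x: "x \<in> ?K"
      obtain l l' where l: "l \<in> L" "l' \<in> L" "x = l + \<gamma> l'"
        using lag(4)[of x] x unfolding ker_eq by blast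
      define m where "m = l - c *\<^sub>C l'"
      have m: "m \<in> L"
        unfolding m_def using l lag(1) csubspace_diff csubspace_scale by blast
      have "x + x = x + c *\<^sub>C \<gamma> x"
        using x by simp
      also have "\<dots> = m + c *\<^sub>C \<gamma> m"
        using cc[of "\<gamma> l'"] by (simp add: l m_def gamma_simps scaleC_add_right complex_vector.scale_minus_right
            complex_vector.scale_right_diff_distrib)
      also have "\<dots> = sqrt 2 *\<^sub>R e m"
        by (simp add: e_def)
      finally have "(1 / 2) *\<^sub>R (x + x) = (1 / 2) *\<^sub>R (sqrt 2 *\<^sub>R e m)"
        by simp
      then have x_eq: "x = (sqrt 2 / 2) *\<^sub>R e m"
        by (simp flip: scaleR_2)
      have e_add: "e (y + z) = e y + e z" and e_scale: "e (a *\<^sub>C y) = a *\<^sub>C e y" for y z a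
        by (simp_all add: e_def gamma_simps scaleC_add_right scaleR_add_right scaleC_scaleC scaleR_eq_scaleC mult.commute)
      have "e y \<in> cspan (e ` B)" if "y \<in> cspan B" for y
        using that
      proof (induction rule: complex_vector.span_induct_alt)
        case base
        then show ?case
          using e_scale[of 0 0] complex_vector.span_zero by simp
      next
        case (step a b y)
        then show ?case
          unfolding e_add e_scale
          by (intro complex_vector.span_add complex_vector.span_scale) (simp_all add: complex_vector.span_base)
      qed
      then have "e m \<in> cspan (e ` B)"
        using m B unfolding onb_def by blast
      then show "x \<in> cspan (e ` B)"
        unfolding x_eq scaleR_eq_scaleC by (rule complex_vector.span_scale)
    qed
  qed
  then show "onb (e ` B) ?K"
    using B ee[OF BL BL] ortho inj unfolding onb_def by (auto simp: inj_on_eq_iff)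
qed

lemma minus_eigenspace_eq: "{x \<in> ker_op D A. \<i> *\<^sub>C \<gamma> x = - x} = {x \<in> ker_op D A. (- \<i>) *\<^sub>C \<gamma> x = x}"
  by (auto simp: complex_vector.scale_minus_left minus_equation_iff)

text \<open>
  Both eigenspaces are isometric to \<open>L\<close>.
\<close>
theorem hermitian_symplectic_if_lagrangian:
  assumes "lagrangian D A \<gamma> L"
  shows "hermitian_symplectic D A \<gamma>"
proof -
  have "finite_dimensional L"
    using assms unfolding lagrangian_def by (intro finite_dimensional_subset_ker) blast+
  then obtain B where B: "onb B L"
    using exists_onb by blast
  note p = onb_gamma_eigenspace[OF assms B, of \<i>] and m = onb_gamma_eigenspace[OF assms B, of "- \<i>"]
  have "complex_vector.dim {x \<in> ker_op D A. \<i> *\<^sub>C \<gamma> x = x} = card B"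
    using onb_dim[OF p(1)] card_image[OF p(2)] by simp
  moreover have "complex_vector.dim {x \<in> ker_op D A. (- \<i>) *\<^sub>C \<gamma> x = x} = card B"
    using onb_dim[OF m(1)] card_image[OF m(2)] by simp
  ultimately show ?thesis
    unfolding hermitian_symplectic_def minus_eigenspace_eq by simp
qed

text \<open>
  Match orthonormal bases of the two eigenspaces by a bijection \<open>h\<close> and take the span of the
  \<open>b + h b\<close>: \<open>\<gamma>\<close> multiplies the two summands by \<open>-\<i>\<close> and \<open>\<i>\<close>, so the pairings of both parts cancel.
\<close>
theorem exists_lagrangian:
  assumes "hermitian_symplectic D A \<gamma>"
  shows "\<exists>L. lagrangian D A \<gamma> L"
proof -
  define Kp where "Kp = {x \<in> ker_op D A. \<i> *\<^sub>C \<gamma> x = x}"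
  define Km where "Km = {x \<in> ker_op D A. \<i> *\<^sub>C \<gamma> x = - x}"
  have ii: "\<i> *\<^sub>C \<i> *\<^sub>C x = - x" for x :: 'h
    using complex_vector.scale_minus_left[of 1 x] by (simp add: scaleC_scaleC)
  have "csubspace Kp" "csubspace Km"
    unfolding Kp_def Km_def minus_eigenspace_eq by (rule csubspace_gamma_eigenspace)+
  then have "finite_dimensional Kp" "finite_dimensional Km"
    by (auto intro!: finite_dimensional_subset_ker simp: Kp_def Km_def)
  then obtain Bp Bm where B: "onb Bp Kp" "onb Bm Km"
    using exists_onb by blast
  have "card Bp = card Bm"
    using assms onb_dim[OF B(1)] onb_dim[OF B(2)] unfolding hermitian_symplectic_def Kp_def Km_def by simp
  then obtain h where h: "bij_betw h Bp Bm"
    using B unfolding onb_def by (metis finite_same_card_bij)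
  have hB: "h b \<in> Bm" if "b \<in> Bp" for b
    using h that by (auto simp: bij_betw_def)
  have mem: "b \<in> Kp" if "b \<in> Bp" for b
    using onb_subset[OF B(1)] that by blast
  have mem': "b \<in> Km" if "b \<in> Bm" for b
    using onb_subset[OF B(2)] that by blast
  have gp: "\<gamma> x = - (\<i> *\<^sub>C x)" if "x \<in> Kp" for x
  proof -
    have "\<i> *\<^sub>C \<i> *\<^sub>C \<gamma> x = \<i> *\<^sub>C x"
      using that by (simp add: Kp_def)
    then show ?thesis
      unfolding ii by (metis minus_minus)
  qed
  have gm: "\<gamma> x = \<i> *\<^sub>C x" if "x \<in> Km" for x
  proof -
    have "\<i> *\<^sub>C \<i> *\<^sub>C \<gamma> x = - (\<i> *\<^sub>C x)"
      using that by (simp add: Km_def complex_vector.scale_minus_right)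
    then show ?thesis
      unfolding ii by simp
  qed
  have pm: "cinner x y = 0" "cinner y x = 0" if "x \<in> Kp" "y \<in> Km" for x y
  proof -
    have "cinner (\<gamma> x) y = - cinner x (\<gamma> y)"
      by (rule cinner_gamma_left)
    then have "cinner x y = 0"
      using gp[OF that(1)] gm[OF that(2)] by (simp add: cinner_simps)
    then show "cinner x y = 0" "cinner y x = 0"
      using cinner_eq_0_commute by blast+
  qed
  define S where "S = (\<lambda>b. b + h b) ` Bp"
  define L where "L = cspan S"
  have Sker: "S \<subseteq> ker_op D A"
    using mem mem' hB csubspace_ker by (auto simp: S_def Kp_def Km_def intro!: csubspace_add)
  have Lker: "L \<subseteq> ker_op D A"
    unfolding L_def by (rule complex_vector.span_minimal[OF Sker csubspace_ker])
  have subL: "csubspace L"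
    by (simp add: L_def)
  have gen: "cinner s (\<gamma> s') = 0" if "s \<in> S" "s' \<in> S" for s s'
  proof -
    obtain b b' where b: "b \<in> Bp" "s = b + h b" "b' \<in> Bp" "s' = b' + h b'"
      using \<open>s \<in> S\<close> \<open>s' \<in> S\<close> by (auto simp: S_def)
    have "h b = h b' \<longleftrightarrow> b = b'"
      using h b by (meson bij_betw_def inj_on_eq_iff)
    then have "cinner b b' = cinner (h b) (h b')"
      using B b hB unfolding onb_def by simp
    then show ?thesis
      using pm[OF mem[OF b(1)] mem'[OF hB[OF b(3)]]] pm[OF mem[OF b(3)] mem'[OF hB[OF b(1)]]]
        gp[OF mem[OF b(3)]] gm[OF mem'[OF hB[OF b(3)]]]
      by (simp add: b gamma_add cinner_simps)
  qed
  have gen2: "cinner s (\<gamma> y) = 0" if "s \<in> S" "y \<in> L" for s y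
    using that(2) unfolding L_def
  proof (induction rule: complex_vector.span_induct)
    case base
    show ?case
      by (auto simp: csubspace_def gamma_simps cinner_simps)
  qed (rule gen[OF that(1)])
  have iso: "cinner x (\<gamma> y) = 0" if "x \<in> L" "y \<in> L" for x y
    using that(1) unfolding L_def
  proof (induction rule: complex_vector.span_induct)
    case base
    show ?case
      by (auto simp: csubspace_def cinner_simps)
  qed (rule gen2[OF _ that(2)])
  define R where "R = sum_set L (\<gamma> ` L)"
  have subR: "csubspace R"
    unfolding R_def sum_set_def by (rule csubspace_sums[OF subL csubspace_gamma_image[OF subL]])
  have inR: "l + \<gamma> l' \<in> R" if "l \<in> L" "l' \<in> L" for l l'
    using that by (auto simp: R_def sum_set_def)
  have bR: "b \<in> R \<and> h b \<in> R" if b: "b \<in> Bp" for b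
  proof -
    define s where "s = b + h b"
    have s: "s \<in> L"
      unfolding L_def by (rule complex_vector.span_base) (use b in \<open>auto simp: S_def s_def\<close>)
    have g: "\<gamma> s = \<i> *\<^sub>C h b - \<i> *\<^sub>C b"
      using gp[OF mem[OF b]] gm[OF mem'[OF hB[OF b]]] by (simp add: s_def gamma_add)
    have sc: "a *\<^sub>C s \<in> L" for a
      using s subL csubspace_scale by blast
    have half: "(1/2 :: complex) *\<^sub>C y + (1/2) *\<^sub>C y = y" for y :: 'h
      by (simp flip: scaleC_add_left)
    have "(1/2) *\<^sub>C s + \<gamma> ((\<i>/2) *\<^sub>C s) = b"
      using half[of b] unfolding gamma_scaleC g by (simp add: s_def scaleC_add_right complex_vector.scale_right_diff_distrib scaleC_scaleC)
    moreover have "(1/2) *\<^sub>C s + \<gamma> ((-\<i>/2) *\<^sub>C s) = h b"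
      using half[of "h b"] unfolding gamma_scaleC g by (simp add: s_def scaleC_add_right complex_vector.scale_right_diff_distrib scaleC_scaleC)
    ultimately show ?thesis
      using inR[OF sc sc] by metis
  qed
  have "Kp \<subseteq> R"
    using complex_vector.span_minimal[of Bp R, OF _ subR] bR B(1) unfolding onb_def by blast
  moreover have "Km \<subseteq> R"
    using complex_vector.span_minimal[of Bm R, OF _ subR] bR h B(2) unfolding onb_def bij_betw_def by blast
  moreover have "\<exists>p\<in>Kp. \<exists>m\<in>Km. x = p + m" if x: "x \<in> ker_op D A" for x
  proof -
    define p where "p = (1/2) *\<^sub>R (x + \<i> *\<^sub>C \<gamma> x)"
    define m where "m = (1/2) *\<^sub>R (x - \<i> *\<^sub>C \<gamma> x)"
    have gx: "\<i> *\<^sub>C \<gamma> x \<in> ker_op D A"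
      using gamma_ker[OF x] csubspace_ker csubspace_scale by blast
    have "p \<in> ker_op D A" "m \<in> ker_op D A"
      unfolding p_def m_def using x gx csubspace_ker
      by (simp_all add: csubspace_scaleR csubspace_add csubspace_diff)
    moreover have "\<i> *\<^sub>C r *\<^sub>R y = r *\<^sub>R \<i> *\<^sub>C y" for r and y :: 'h
      by (simp add: scaleR_eq_scaleC scaleC_scaleC mult.commute)
    then have "\<i> *\<^sub>C \<gamma> p = p" "\<i> *\<^sub>C \<gamma> m = - m"
      unfolding p_def m_def gamma_scaleR
      by (simp_all add: gamma_simps scaleC_add_right complex_vector.scale_right_diff_distrib
          complex_vector.scale_minus_right ii flip: scaleR_minus_right)
    moreover have "x = p + m"
      unfolding p_def m_def scaleR_add_right[symmetric] by (simp flip: scaleR_2)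
    ultimately show ?thesis
      unfolding Kp_def Km_def by blast
  qed
  ultimately have "ker_op D A \<subseteq> R"
    using subR csubspace_add by blast
  moreover have "R \<subseteq> ker_op D A"
    unfolding R_def sum_set_def using Lker gamma_ker csubspace_ker csubspace_add by blast
  ultimately have "lagrangian D A \<gamma> L"
    unfolding lagrangian_def orthogonal_sets_def R_def using subL Lker iso by blast
  then show ?thesis ..
qed

end

section \<open>Lagrangian subspaces in the domain of the square root\<close>

locale half_lagrangian = dirac D A \<gamma>
  for D :: "'h::complex_hilbert set" and A and \<gamma> :: "'h \<Rightarrow> 'h" +
  fixes X :: "'h set"
  assumes half_lag: "half_lag X"
begin

lemma csubspace_X: "csubspace X" and X_Hh: "x \<in> X \<Longrightarrow> x \<in> Hh"
  using half_lag unfolding half_lag_def by blast+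

definition S :: "'h set" where "S = M ` X"

lemma S_iff: "s \<in> S \<longleftrightarrow> (\<forall>x\<in>X. cinner (M x) (\<gamma> s) = 0)"
  using half_lag unfolding half_lag_def S_def by blast

lemma S_eq: "S = {s. \<forall>y\<in>\<gamma> ` M ` X. cinner s y = 0}"
proof -
  have "cinner (M x) (\<gamma> s) = 0 \<longleftrightarrow> cinner s (\<gamma> (M x)) = 0" for x s
    using cinner_gamma_left[of "M x" s] cinner_eq_0_commute[of s "\<gamma> (M x)"] by simp
  then show ?thesis
    using S_iff by auto
qed

lemma csubspace_S: "csubspace S" and closed_S: "closed S"
  unfolding S_eq by (rule csubspace_orthogonal closed_orthogonal)+

lemma X_isotropic: "x \<in> X \<Longrightarrow> y \<in> X \<Longrightarrow> cinner x (\<gamma> y) = 0"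
  using S_iff[of "M y"] cinner_M[OF X_Hh X_Hh, of x y] by (auto simp: S_def)

text \<open>
  Regularity says that elements of \<open>S\<close> have positive part in \<open>D\<close>. The truncations of \<open>A Qp\<close> are
  bounded operators that are bounded at each element of the Hilbert space \<open>S\<close>, so the uniform
  boundedness principle applies.
\<close>
lemma A_bounded_on_positive_part:
  shows "\<exists>C. \<forall>s\<in>S. Qp s \<in> D \<and> norm (A (Qp s)) \<le> C * norm s"
proof -
  define w where "w n t = (if 0 < t \<and> t \<le> real n then t else 0)" for n t
  have w_le: "\<bar>w n t\<bar> \<le> real n" for n t
    by (simp add: w_def)
  \<comment> \<open>composition with the projection to \<open>S\<close> makes the operators total\<close>
  define T where "T n a = fun_calc D A (w n) (orth_proj S a)" for n a
  have PT: "P t (T n a) = w n t *\<^sub>R P t (orth_proj S a)" for n a t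
    unfolding T_def by (rule P_fun_calc[OF fun_calc_dom_bounded[OF w_le]])
  have linT: "bounded_linear (T n)" for n
    unfolding T_def
    by (rule bounded_linear_compose[OF bounded_linear_fun_calc[OF w_le] bounded_linear_orth_proj[OF csubspace_S closed_S]])
  have t_le: "t * weight t \<le> lam t" if "t > 0" for t
  proof -
    have "sqrt (t\<^sup>2) \<le> sqrt (1 + t\<^sup>2)"
      by (subst real_sqrt_le_iff) simp
    then have "t \<le> lam t * lam t"
      using that lam_sq[of t] by (simp add: power2_eq_square)
    then show ?thesis
      using that lam_pos[of t] by (simp add: weight_def pos_divide_le_eq)
  qed
  have "\<exists>K. \<forall>n. norm (T n a) \<le> K" for a
  proof -
    have "orth_proj S a \<in> S"
      by (rule orth_proj_in[OF csubspace_S closed_S])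
    then obtain x where x: "x \<in> X" "orth_proj S a = M x"
      by (auto simp: S_def)
    have "norm (T n a) \<le> 1 * norm (Lam x)" for n
    proof (rule norm_le_componentwise)
      fix t
      have "w n t * weight t \<le> lam t"
        using t_le[of t] lam_nonneg[of t] by (simp add: w_def)
      moreover have "w n t * weight t \<ge> 0"
        using weight_pos[of t] by (simp add: w_def)
      ultimately show "norm (P t (T n a)) \<le> 1 * norm (P t (Lam x))"
        using X_Hh[OF x(1)] lam_nonneg[of t]
        by (simp add: PT x(2) P_M P_Lam mult_right_mono abs_mult[symmetric] mult.assoc[symmetric])
    qed simp
    then show ?thesis
      by auto
  qed
  then obtain C where C: "\<And>n a. norm (T n a) \<le> C * norm a"
    using banach_steinhaus[of T, OF linT] by blast
  have "Qp s \<in> D \<and> norm (A (Qp s)) \<le> C * norm s" if s: "s \<in> S" for s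
  proof -
    obtain x where x: "x \<in> X" "s = M x"
      using s by (auto simp: S_def)
    have "Qp s \<in> fun_calc_dom D A (\<lambda>t. t)"
    proof (rule fun_calc_dom_mono[where f = lam and x = x and C = 1])
      show "x \<in> fun_calc_dom D A lam"
        using X_Hh[OF x(1)] by (simp add: Hh_eq)
      show "\<bar>t\<bar> * norm (P t (Qp s)) \<le> 1 * (\<bar>lam t\<bar> * norm (P t x))" for t
        using t_le[of t] weight_pos[of t] lam_nonneg[of t] X_Hh[OF x(1)]
        by (simp add: P_spec_proj x(2) P_M mult_right_mono mult.assoc[symmetric])
    qed
    then have QD: "Qp s \<in> D"
      unfolding D_eq_fun_calc_dom[symmetric] .
    have "trunc n (A (Qp s)) = T n s" for n
      by (rule components_eqI)
        (auto simp: P_trunc PT P_A[OF QD] P_spec_proj w_def orth_proj_id[OF csubspace_S s])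
    then have "norm (trunc n (A (Qp s))) \<le> C * norm s" for n
      using C by metis
    then have "norm (A (Qp s)) \<le> C * norm s"
      by (intro LIMSEQ_le_const2[OF tendsto_norm[OF trunc_tendsto]]) auto
    then show ?thesis
      using QD by blast
  qed
  then show ?thesis
    by blast
qed

definition NS :: "'h set" where "NS = S \<inter> {s. supp s {0<..}}"

lemma csubspace_NS: "csubspace NS" and closed_NS: "closed NS"
  unfolding NS_def using csubspace_S closed_S csubspace_supp closed_supp
  by (simp_all add: csubspace_inter closed_Int)

text \<open>
  Otherwise there are unit vectors in \<open>S\<close>, orthogonal to \<open>NS\<close>, with nonpositive parts tending to zero.
  Their positive parts are bounded in the graph norm, so a subsequence converges; the limit is a unit
  vector both in \<open>NS\<close> and orthogonal to it.
\<close>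
lemma Qle_bounded_below:
  "\<exists>K. \<forall>r\<in>S. (\<forall>n\<in>NS. cinner r n = 0) \<longrightarrow> norm r \<le> K * norm (Qle r)"
proof (rule ccontr)
  obtain C where C: "\<And>s. s \<in> S \<Longrightarrow> Qp s \<in> D" "\<And>s. s \<in> S \<Longrightarrow> norm (A (Qp s)) \<le> C * norm s"
    using A_bounded_on_positive_part by blast
  assume *: "\<nexists>K. \<forall>r\<in>S. (\<forall>n\<in>NS. cinner r n = 0) \<longrightarrow> norm r \<le> K * norm (Qle r)"
  have "\<exists>r. r \<in> S \<and> (\<forall>n\<in>NS. cinner r n = 0) \<and> norm r = 1 \<and> norm (Qle r) \<le> 1 / real (Suc k)" for k
  proof -
    obtain r where r: "r \<in> S" "\<forall>n\<in>NS. cinner r n = 0" "norm r > real (Suc k) * norm (Qle r)"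
      using * by (meson not_le)
    then have "norm r > 0"
      by (smt (verit) mult_nonneg_nonneg norm_ge_zero of_nat_0_le_iff)
    define e where "e = (1 / norm r) *\<^sub>R r"
    have "e \<in> S"
      unfolding e_def using r csubspace_S csubspace_scaleR by blast
    moreover have "\<forall>n\<in>NS. cinner e n = 0"
      using r by (simp add: e_def cinner_simps)
    moreover have "norm e = 1"
      using \<open>norm r > 0\<close> by (simp add: e_def)
    moreover have "norm (Qle e) = norm (Qle r) / norm r"
      by (simp add: e_def linear_simps(5)[OF bounded_linear_spec_proj])
    then have "norm (Qle e) \<le> 1 / real (Suc k)"
      using r(3) \<open>norm r > 0\<close> by (simp add: divide_le_eq pos_le_divide_eq mult.commute)
    ultimately show ?thesis
      by blast
  qed
  then obtain r where r: "\<And>k. r k \<in> S" "\<And>k n. n \<in> NS \<Longrightarrow> cinner (r k) n = 0" "\<And>k. norm (r k) = 1"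
    "\<And>k. norm (Qle (r k)) \<le> 1 / real (Suc k)"
    by metis
  have "\<exists>\<sigma> l. strict_mono \<sigma> \<and> ((\<lambda>k. Qp (r k)) \<circ> \<sigma>) \<longlonglongrightarrow> l"
  proof (rule graph_bounded_subseq)
    show "Qp (r k) \<in> D" for k
      by (rule C(1)[OF r(1)])
    show "norm (Qp (r k)) \<le> max 1 C" for k
      using norm_spec_proj_le[of "{0<..}" "r k"] r(3)[of k] by linarith
    show "norm (A (Qp (r k))) \<le> max 1 C" for k
      using C(2)[OF r(1)[of k]] r(3)[of k] by simp
  qed
  then obtain \<sigma> q where \<sigma>: "strict_mono \<sigma>" "(\<lambda>k. Qp (r (\<sigma> k))) \<longlonglongrightarrow> q"
    by (auto simp: o_def)
  have "(\<lambda>k. Qle (r k)) \<longlonglongrightarrow> 0"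
    by (rule Lim_null_comparison[OF _ lim_1_over_n[THEN LIMSEQ_Suc]]) (use r(4) in auto)
  then have "(\<lambda>k. Qle (r (\<sigma> k))) \<longlonglongrightarrow> 0"
    using LIMSEQ_subseq_LIMSEQ[OF _ \<sigma>(1)] by (auto simp: o_def)
  then have "(\<lambda>k. Qle (r (\<sigma> k)) + Qp (r (\<sigma> k))) \<longlonglongrightarrow> 0 + q"
    by (intro tendsto_add \<sigma>(2))
  then have rq: "(\<lambda>k. r (\<sigma> k)) \<longlonglongrightarrow> q"
    using eq_Qle_Qp by simp
  have "q \<in> S"
    using closed_sequentially[OF closed_S, of "\<lambda>k. r (\<sigma> k)"] r(1) rq by blast
  moreover have "supp q {0<..}"
    using closed_sequentially[OF closed_supp, of "\<lambda>k. Qp (r (\<sigma> k))"] \<sigma>(2) supp_spec_proj by blast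
  ultimately have qN: "q \<in> NS"
    by (simp add: NS_def)
  have "(\<lambda>k. cinner (r (\<sigma> k)) q) \<longlonglongrightarrow> cinner q q"
    by (intro tendsto_cinner rq tendsto_const)
  then have "cinner q q = 0"
    using r(2)[OF qN] by (simp add: LIMSEQ_const_iff)
  moreover have "norm q = 1"
    using tendsto_norm[OF rq] r(3) by (simp add: LIMSEQ_const_iff)
  ultimately show False
    by simp
qed

text \<open>
  The set is the sum of \<open>S\<close> and the positive part of \<open>H\<close>. Removing the component in \<open>NS\<close>
  does not change the nonpositive part, and then \<open>Qle_bounded_below\<close> makes preimages of Cauchy
  sequences Cauchy.
\<close>
lemma closed_Qle_S: "closed {z. \<exists>s\<in>S. Qle z = Qle s}"
proof (rule closed_sequential_limits[THEN iffD2], intro allI impI)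
  obtain K where K: "\<And>r. r \<in> S \<Longrightarrow> (\<And>n. n \<in> NS \<Longrightarrow> cinner r n = 0) \<Longrightarrow> norm r \<le> K * norm (Qle r)"
    using Qle_bounded_below by blast
  fix z l assume zl: "(\<forall>k. z k \<in> {z. \<exists>s\<in>S. Qle z = Qle s}) \<and> z \<longlonglongrightarrow> l"
  then have "\<forall>k. \<exists>s. s \<in> S \<and> Qle (z k) = Qle s"
    by blast
  then obtain s where s: "\<And>k. s k \<in> S" "\<And>k. Qle (z k) = Qle (s k)"
    by metis
  define r where "r k = s k - orth_proj NS (s k)" for k
  have PN: "orth_proj NS (s k) \<in> NS" for k
    by (rule orth_proj_in[OF csubspace_NS closed_NS])
  have rS: "r k \<in> S" for k
    unfolding r_def using s(1)[of k] PN[of k] csubspace_S by (simp add: NS_def csubspace_diff)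
  have rN: "cinner (r k) n = 0" if "n \<in> NS" for k n
    unfolding r_def by (rule orth_proj_ortho[OF csubspace_NS closed_NS that])
  have Qr: "Qle (r k) = Qle (z k)" for k
  proof -
    have "supp (orth_proj NS (s k)) {0<..}"
      using PN[of k] unfolding NS_def by blast
    then have "Qle (orth_proj NS (s k)) = 0"
      by (rule spec_proj_eq_0) auto
    then show ?thesis
      by (simp add: r_def s spec_proj_diff)
  qed
  have dom: "norm (r m - r n) \<le> \<bar>K\<bar> * norm (z m - z n)" for m n
  proof -
    have "norm (r m - r n) \<le> K * norm (Qle (r m - r n))"
    proof (rule K)
      show "r m - r n \<in> S"
        by (rule csubspace_diff[OF csubspace_S rS rS])
      show "cinner (r m - r n) k = 0" if "k \<in> NS" for k
        using rN[OF that] by (simp add: cinner_diff_left)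
    qed
    also have "Qle (r m - r n) = Qle (z m - z n)"
      by (simp add: spec_proj_diff Qr)
    also have "K * norm (Qle (z m - z n)) \<le> \<bar>K\<bar> * norm (z m - z n)"
      by (intro mult_mono norm_spec_proj_le) auto
    finally show ?thesis .
  qed
  have "Cauchy (\<lambda>k. \<bar>K\<bar> *\<^sub>R z k)"
    using zl by (intro LIMSEQ_imp_Cauchy[OF tendsto_scaleR[OF tendsto_const]]) blast
  moreover have "dist (r m) (r n) \<le> dist (\<bar>K\<bar> *\<^sub>R z m) (\<bar>K\<bar> *\<^sub>R z n)" for m n
    using dom[of m n] unfolding dist_norm scaleR_diff_right[symmetric] norm_scaleR abs_abs .
  ultimately have "Cauchy r"
    unfolding Cauchy_def by (meson le_less_trans)
  then obtain q where q: "r \<longlonglongrightarrow> q"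
    using Cauchy_convergent_iff convergent_def by blast
  have "q \<in> S"
    using closed_sequentially[OF closed_S] rS q by blast
  moreover have "Qle l = Qle q"
  proof (rule LIMSEQ_unique)
    show "(\<lambda>k. Qle (r k)) \<longlonglongrightarrow> Qle q"
      by (rule tendsto_spec_proj[OF q])
    show "(\<lambda>k. Qle (r k)) \<longlonglongrightarrow> Qle l"
      unfolding Qr using zl by (intro tendsto_spec_proj) blast
  qed
  ultimately show "l \<in> {z. \<exists>s\<in>S. Qle z = Qle s}"
    by blast
qed

text \<open>
  The sum \<open>T\<close> of \<open>S\<close> and the positive part is closed. The component \<open>y\<close> of \<open>z\<close> orthogonal to \<open>T\<close> has
  nonpositive support, and as \<open>S\<close> is its own annihilator, \<open>\<gamma> y\<close> is in \<open>S\<close> with nonnegative support.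
  So the assumption applies to \<open>\<gamma> y\<close> and gives \<open>y = 0\<close>.
\<close>
lemma exists_S_with_nonpositive_part:
  assumes z: "\<And>s. s \<in> S \<Longrightarrow> supp s {0..} \<Longrightarrow> cinner z (\<gamma> s) = 0"
  shows "\<exists>s\<in>S. Qle z = Qle s"
proof -
  define T where "T = {z. \<exists>s\<in>S. Qle z = Qle s}"
  have closedT: "closed T"
    unfolding T_def by (rule closed_Qle_S)
  have subT: "csubspace T"
    unfolding csubspace_def
  proof (intro conjI ballI allI)
    show "0 \<in> T"
      unfolding T_def using csubspace_0[OF csubspace_S] by blast
    fix x assume "x \<in> T"
    then obtain s where s: "s \<in> S" "Qle x = Qle s"
      by (auto simp: T_def)
    show "c *\<^sub>C x \<in> T" for c
      unfolding T_def using s csubspace_scale[OF csubspace_S, of s c]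
      by (auto simp: spec_proj_scaleC intro!: bexI[of _ "c *\<^sub>C s"])
    fix y assume "y \<in> T"
    then obtain s' where "s' \<in> S" "Qle y = Qle s'"
      by (auto simp: T_def)
    then show "x + y \<in> T"
      unfolding T_def using s csubspace_add[OF csubspace_S, of s s']
      by (auto simp: spec_proj_add intro!: bexI[of _ "s + s'"])
  qed
  define y where "y = z - orth_proj T z"
  have yT: "cinner y u = 0" "cinner u y = 0" if "u \<in> T" for u
    unfolding y_def using orth_proj_ortho[OF subT closedT that] orth_proj_ortho'[OF subT closedT that] by auto
  have "Qp y \<in> T"
  proof -
    have "Qle (Qp y) = Qle 0"
      unfolding spec_proj_zero by (rule spec_proj_eq_0[OF supp_spec_proj]) auto
    then show ?thesis
      unfolding T_def using csubspace_0[OF csubspace_S] by blast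
  qed
  then have "cinner y (Qp y) = 0"
    by (rule yT)
  moreover have "cinner y (Qp y) = cinner (Qp y) (Qp y)"
    by (rule cinner_eqI) (simp add: P_spec_proj)
  ultimately have "Qp y = 0"
    by simp
  then have "Qle y = y"
    using eq_Qle_Qp[of y] by simp
  then have "supp y {..0}"
    using supp_spec_proj[of "{..0}" y] by simp
  then have "supp (\<gamma> y) {0..}"
    by (rule supp_gamma) auto
  moreover have "\<gamma> y \<in> S"
    unfolding S_iff
  proof
    fix x assume "x \<in> X"
    then have "M x \<in> T"
      unfolding T_def S_def by blast
    then show "cinner (M x) (\<gamma> (\<gamma> y)) = 0"
      using yT by (simp add: gamma_gamma)
  qed
  ultimately have "cinner z (\<gamma> (\<gamma> y)) = 0"
    by (intro z)
  then have "cinner z y = 0"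
    by (simp add: gamma_gamma)
  moreover have "cinner (orth_proj T z) y = 0"
    by (rule yT(2)[OF orth_proj_in[OF subT closedT]])
  moreover have "cinner y y = cinner z y - cinner (orth_proj T z) y"
    by (subst (1) y_def) (rule cinner_diff_left)
  ultimately have "cinner y y = 0"
    by simp
  then have "z = orth_proj T z"
    by (simp add: y_def)
  then have "z \<in> T"
    using orth_proj_in[OF subT closedT, of z] by simp
  then show ?thesis
    by (simp add: T_def)
qed

text \<open>
  The same for \<open>X\<close>, by means of \<open>M\<close>.
\<close>
lemma exists_X_with_nonpositive_part:
  assumes z: "supp z {..0}" "z \<in> Hh" and ortho: "\<And>x. x \<in> X \<Longrightarrow> supp x {0..} \<Longrightarrow> cinner z (\<gamma> x) = 0"
  shows "\<exists>x\<in>X. Qle x = z"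
proof -
  have "\<exists>s\<in>S. Qle (M z) = Qle s"
  proof (rule exists_S_with_nonpositive_part)
    fix s assume s: "s \<in> S" "supp s {0..}"
    then obtain x where x: "x \<in> X" "s = M x"
      by (auto simp: S_def)
    then show "cinner (M z) (\<gamma> s) = 0"
      using cinner_M[OF z(2) X_Hh[OF x(1)]] ortho[OF x(1)] s(2) supp_M[OF X_Hh[OF x(1)]] by simp
  qed
  then obtain x where x: "x \<in> X" "Qle (M z) = Qle (M x)"
    by (auto simp: S_def)
  have "P t (Qle x) = P t z" for t
  proof (cases "t \<le> 0")
    case True
    have "P t (Qle (M z)) = P t (Qle (M x))"
      using x(2) by simp
    then have "weight t *\<^sub>R P t z = weight t *\<^sub>R P t x"
      using True by (simp add: P_spec_proj P_M z(2) X_Hh[OF x(1)])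
    then show ?thesis
      using True weight_neq_0[of t] by (simp add: P_spec_proj)
  next
    case False
    then show ?thesis
      using suppD[OF z(1), of t] by (simp add: P_spec_proj)
  qed
  then show ?thesis
    using components_eqI x(1) by blast
qed

text \<open>
  Symplectic reduction: \<open>W\<close> is the intersection of \<open>X\<close> with the coisotropic subspace of nonnegative
  support, whose annihilator is the positive part; \<open>L\<close> is the image of \<open>W\<close> in the quotient, which is
  the kernel.
\<close>
definition W :: "'h set" where "W = {x \<in> X. supp x {0..}}"
definition L :: "'h set" where "L = Qz ` W"
definition N :: "'h set" where "N = {x \<in> X. supp x {0<..}}"

lemma csubspace_W: "csubspace W"
proof -
  have "W = X \<inter> {x. supp x {0..}}"
    by (auto simp: W_def)
  then show ?thesis
    using csubspace_X csubspace_supp by (simp add: csubspace_inter)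
qed

lemma csubspace_N: "csubspace N"
proof -
  have "N = X \<inter> {x. supp x {0<..}}"
    by (auto simp: N_def)
  then show ?thesis
    using csubspace_X csubspace_supp by (simp add: csubspace_inter)
qed

lemma Qz_W: "x \<in> W \<Longrightarrow> x = Qz x + Qp x"
proof -
  assume "x \<in> W"
  then have "Qm x = 0"
    by (intro spec_proj_eq_0[of x "{0..}"]) (auto simp: W_def)
  then show ?thesis
    using eq_Qm_Qz_Qp[of x] by simp
qed

lemma csubspace_L: "csubspace L"
  using csubspace_W unfolding L_def csubspace_def
  by (auto simp: spec_proj_add[symmetric] spec_proj_scaleC[symmetric]) (metis image_eqI spec_proj_zero)

lemma L_supp: "l \<in> L \<Longrightarrow> supp l {0}"
  unfolding L_def using supp_spec_proj by blast

lemma L_Hh: "l \<in> L \<Longrightarrow> l \<in> Hh"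
  using ker_subset_Hh L_supp by blast

lemma cinner_ker_gamma: "supp l {0} \<Longrightarrow> cinner l (\<gamma> x) = cinner l (\<gamma> (Qz x))"
  by (rule cinner_eqI) (auto simp: P_gamma P_spec_proj supp_def)

lemma L_isotropic:
  assumes "l \<in> L" "l' \<in> L"
  shows "cinner l (\<gamma> l') = 0"
proof -
  obtain x y where x: "x \<in> W" "l = Qz x" and y: "y \<in> W" "l' = Qz y"
    using assms by (auto simp: L_def)
  have "cinner x (\<gamma> y) = cinner (Qz x) (\<gamma> (Qz y))"
  proof (rule cinner_eqI)
    fix t
    show "cinner (P t x) (P t (\<gamma> y)) = cinner (P t (Qz x)) (P t (\<gamma> (Qz y)))"
      using suppD[of x "{0..}" t] suppD[of y "{0..}" "- t"] x(1) y(1)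
      by (cases t "0::real" rule: linorder_cases) (simp_all add: P_gamma P_spec_proj W_def)
  qed
  then show ?thesis
    using X_isotropic[of x y] x y by (simp add: W_def)
qed

lemma L_maximal:
  assumes "supp l {0}" "\<And>l'. l' \<in> L \<Longrightarrow> cinner l (\<gamma> l') = 0"
  shows "l \<in> L"
proof -
  have "\<exists>x\<in>X. Qle x = l"
  proof (rule exists_X_with_nonpositive_part)
    show "supp l {..0}"
      by (rule supp_mono[OF assms(1)]) auto
    show "l \<in> Hh"
      by (rule ker_subset_Hh[OF assms(1)])
    fix x assume "x \<in> X" "supp x {0..}"
    then have "Qz x \<in> L"
      by (auto simp: L_def W_def)
    then show "cinner l (\<gamma> x) = 0"
      by (subst cinner_ker_gamma[OF assms(1)]) (rule assms(2))
  qed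
  then obtain x where x: "x \<in> X" "Qle x = l"
    by blast
  have "supp x {0..}"
    unfolding supp_def
  proof (intro allI impI)
    fix t :: real assume "t \<notin> {0..}"
    then show "P t x = 0"
      using suppD[OF assms(1), of t] x(2) P_spec_proj[of t "{..0}" x] by auto
  qed
  moreover have "Qz x = Qz l"
    unfolding x(2)[symmetric] by (rule components_eqI) (simp add: P_spec_proj)
  ultimately show ?thesis
    unfolding L_def W_def using x(1) spec_proj_id[OF assms(1)] by (auto intro!: image_eqI[of _ _ x])
qed

lemma closed_L: "closed L"
  by (rule finite_dimensional_closed(1)[OF finite_dimensional_subset_ker[OF csubspace_L]])
    (use L_supp in \<open>auto simp: ker_eq\<close>)

text \<open>
  By maximality, the orthogonal complement of \<open>L\<close> in the kernel is contained in \<open>\<gamma> L\<close>.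
\<close>
lemma lagrangian_L: "lagrangian D A \<gamma> L"
proof -
  have "L \<subseteq> ker_op D A"
    using L_supp by (auto simp: ker_eq)
  moreover have "sum_set L (\<gamma> ` L) \<subseteq> ker_op D A"
    unfolding sum_set_def using \<open>L \<subseteq> ker_op D A\<close> gamma_ker csubspace_ker csubspace_add by blast
  moreover have "ker_op D A \<subseteq> sum_set L (\<gamma> ` L)"
  proof
    fix x assume "x \<in> ker_op D A"
    then have x: "supp x {0}"
      by (simp add: ker_eq)
    define r where "r = x - orth_proj L x"
    have PL: "orth_proj L x \<in> L"
      by (rule orth_proj_in[OF csubspace_L closed_L])
    have "\<gamma> (- r) \<in> L"
    proof (rule L_maximal)
      have "supp (- r) {0}"
        unfolding r_def by (intro supp_minus supp_diff x L_supp PL)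
      then show "supp (\<gamma> (- r)) {0}"
        by (rule supp_gamma) auto
      show "cinner (\<gamma> (- r)) (\<gamma> l') = 0" if "l' \<in> L" for l'
        using orth_proj_ortho[OF csubspace_L closed_L that, of x]
        unfolding cinner_gamma_gamma r_def cinner_minus_left by simp
    qed
    moreover have "x = orth_proj L x + \<gamma> (\<gamma> (- r))"
      by (simp add: gamma_gamma r_def)
    ultimately show "x \<in> sum_set L (\<gamma> ` L)"
      unfolding sum_set_def using PL by blast
  qed
  ultimately show ?thesis
    unfolding lagrangian_def orthogonal_sets_def using csubspace_L L_isotropic by blast
qed

text \<open>
  \<open>A\<close> is bounded on \<open>NS = M N\<close>.
\<close>
lemma finite_dimensional_N: "finite_dimensional N"
proof -
  obtain C where C: "\<And>s. s \<in> S \<Longrightarrow> Qp s \<in> D" "\<And>s. s \<in> S \<Longrightarrow> norm (A (Qp s)) \<le> C * norm s"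
    using A_bounded_on_positive_part by blast
  have Qp_id: "Qp s = s" and NS_S: "s \<in> S" if "s \<in> NS" for s
    using that spec_proj_id[of s "{0<..}"] unfolding NS_def by blast+
  have "finite_dimensional NS"
  proof (rule finite_dimensional_if_A_bounded[OF csubspace_NS])
    show "NS \<subseteq> D"
    proof
      show "s \<in> D" if "s \<in> NS" for s
        using C(1)[OF NS_S[OF that]] unfolding Qp_id[OF that] .
    qed
    show "norm (A s) \<le> C * norm s" if "s \<in> NS" for s
      using C(2)[OF NS_S[OF that]] unfolding Qp_id[OF that] .
  qed
  moreover have NS_Hh: "s \<in> Hh" and N_Lam: "Lam s \<in> N" if s: "s \<in> NS" for s
  proof -
    obtain x where x: "x \<in> X" "s = M x" "supp (M x) {0<..}"
      using s unfolding NS_def S_def by blast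
    have sx: "supp x {0<..}"
      using x(3) supp_M[OF X_Hh[OF x(1)]] by simp
    then have "s = Li x"
      using M_gt[OF X_Hh[OF x(1)]] x(2) by simp
    then show "s \<in> Hh" "Lam s \<in> N"
      using sx x(1) by (simp_all add: Li_Hh Lam_Li N_def)
  qed
  then have "clinear_on NS Lam"
    unfolding clinear_on_def using Lam_add Lam_scaleC by blast
  ultimately have "finite_dimensional (Lam ` NS)"
    by (rule finite_dimensional_image)
  moreover have "Lam ` NS = N"
  proof
    show "Lam ` NS \<subseteq> N"
      using N_Lam by blast
    show "N \<subseteq> Lam ` NS"
    proof
      fix x assume "x \<in> N"
      then have x: "x \<in> X" "supp x {0<..}"
        by (auto simp: N_def)
      have "M x \<in> NS"
        using x supp_M[OF X_Hh[OF x(1)]] by (auto simp: NS_def S_def)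
      moreover have "x = Lam (M x)"
        by (simp add: M_gt[OF X_Hh[OF x(1)] x(2)] Lam_Li)
      ultimately show "x \<in> Lam ` NS"
        by blast
    qed
  qed
  ultimately show ?thesis
    by simp
qed

definition F :: "'h set" where "F = \<gamma> ` N"
definition V :: "'h set" where "V = {v. supp v {..<0} \<and> (\<forall>f\<in>F. cinner v f = 0)}"
text \<open>
  The description of \<open>V \<oplus> L\<close> by orthogonality, which makes it evident that it is closed;
  see \<open>sum_set_V_L\<close>.
\<close>
definition U :: "'h set" where
  "U = {u. supp u {..0} \<and> (\<forall>f\<in>F. cinner u f = 0) \<and> (\<forall>l\<in>L. cinner u (\<gamma> l) = 0)}"

lemma finite_dimensional_F: "finite_dimensional F"
  unfolding F_def by (rule finite_dimensional_image[OF finite_dimensional_N])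
    (simp add: clinear_on_def gamma_add gamma_scaleC)

lemma csubspace_F: "csubspace F" and closed_F: "closed F"
  using finite_dimensional_closed[OF finite_dimensional_F] by auto

lemma closed_N: "closed N"
  by (rule finite_dimensional_closed[OF finite_dimensional_N])

lemma F_supp: "f \<in> F \<Longrightarrow> supp f {..<0}"
  unfolding F_def N_def using supp_gamma[of _ "{0<..}" "{..<0}"] by auto

lemma F_Hh: "f \<in> F \<Longrightarrow> f \<in> Hh"
  unfolding F_def N_def using gamma_Hh X_Hh by blast

lemma csubspace_V: "csubspace V"
  by (auto simp: V_def csubspace_def supp_def P_zero P_add P_scaleC cinner_simps)

lemma csubspace_U: "csubspace U"
  by (auto simp: U_def csubspace_def supp_def P_zero P_add P_scaleC cinner_simps)

lemma closed_U: "closed U"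
proof -
  have "U = {u. supp u {..0}} \<inter> {u. \<forall>f\<in>F. cinner u f = 0} \<inter> {u. \<forall>l\<in>\<gamma> ` L. cinner u l = 0}"
    by (auto simp: U_def)
  then show ?thesis
    by (simp only: closed_Int closed_supp closed_orthogonal)
qed

lemma gamma_L_supp: "l \<in> L \<Longrightarrow> supp (\<gamma> l) {0}"
  by (rule supp_gamma[OF L_supp]) auto

lemma U_components:
  assumes "u \<in> U"
  shows "Qm u \<in> V" "Qz u \<in> L" "u = Qm u + Qz u"
proof -
  have u: "supp u {..0}" "\<And>f. f \<in> F \<Longrightarrow> cinner u f = 0" "\<And>l. l \<in> L \<Longrightarrow> cinner u (\<gamma> l) = 0"
    using assms by (auto simp: U_def)
  show "u = Qm u + Qz u"
    using Qle_eq[of u] spec_proj_id[OF u(1)] by simp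
  have "cinner (Qm u) f = 0" if "f \<in> F" for f
  proof -
    have "cinner (Qm u) f = cinner u f"
      by (rule cinner_spec_proj_left[OF F_supp[OF that]])
    then show ?thesis
      using u(2)[OF that] by simp
  qed
  then show "Qm u \<in> V"
    by (simp add: V_def supp_spec_proj)
  show "Qz u \<in> L"
  proof (rule L_maximal[OF supp_spec_proj])
    fix l assume l: "l \<in> L"
    have "cinner (Qz u) (\<gamma> l) = cinner u (\<gamma> l)"
      by (rule cinner_spec_proj_left[OF gamma_L_supp[OF l]])
    then show "cinner (Qz u) (\<gamma> l) = 0"
      using u(3)[OF l] by simp
  qed
qed

lemma V_subset_U: "v \<in> V \<Longrightarrow> v \<in> U"
  unfolding V_def U_def
  by (auto intro: supp_mono[of v "{..<0}"] cinner_supp_eq_0[OF _ gamma_L_supp])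

lemma L_subset_U: "l \<in> L \<Longrightarrow> l \<in> U"
  unfolding U_def using L_isotropic
  by (auto intro: supp_mono[OF L_supp] cinner_supp_eq_0[OF L_supp F_supp])

lemma sum_set_V_L: "sum_set V L = U"
proof
  show "sum_set V L \<subseteq> U"
    by (auto simp: sum_set_def intro: csubspace_add[OF csubspace_U V_subset_U L_subset_U])
  show "U \<subseteq> sum_set V L"
    unfolding sum_set_def using U_components by blast
qed

lemma sum_set_F_V: "sum_set F V = H_neg D A"
proof
  show "sum_set F V \<subseteq> H_neg D A"
    by (auto simp: sum_set_def H_neg_eq V_def intro: supp_add[OF F_supp])
  show "H_neg D A \<subseteq> sum_set F V"
  proof
    fix x assume "x \<in> H_neg D A"
    then have x: "supp x {..<0}"
      by (simp add: H_neg_eq)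
    have PF: "orth_proj F x \<in> F"
      by (rule orth_proj_in[OF csubspace_F closed_F])
    have "x - orth_proj F x \<in> V"
      unfolding V_def using orth_proj_ortho[OF csubspace_F closed_F] supp_diff[OF x F_supp[OF PF]] by simp
    moreover have "x = orth_proj F x + (x - orth_proj F x)"
      by simp
    ultimately show "x \<in> sum_set F V"
      unfolding sum_set_def using PF by blast
  qed
qed

lemma U_supp: "u \<in> U \<Longrightarrow> supp u {..0}"
  by (simp add: U_def)

lemma U_ortho_F: "u \<in> U \<Longrightarrow> f \<in> F \<Longrightarrow> cinner u f = 0"
  by (simp add: U_def)

lemma gamma_U_supp: "u \<in> U \<Longrightarrow> supp (\<gamma> u) {0..}"
  by (rule supp_gamma[OF U_supp]) auto

lemma U_isotropic:
  assumes "u \<in> U" "u' \<in> U"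
  shows "cinner u (\<gamma> u') = 0"
proof -
  have "cinner u (\<gamma> u') = cinner (Qz u) (\<gamma> (Qz u'))"
  proof (rule cinner_eqI)
    fix t
    show "cinner (P t u) (P t (\<gamma> u')) = cinner (P t (Qz u)) (P t (\<gamma> (Qz u')))"
      using suppD[OF U_supp[OF assms(1)], of t] suppD[OF U_supp[OF assms(2)], of "- t"]
      by (cases t "0::real" rule: linorder_cases) (simp_all add: P_gamma P_spec_proj)
  qed
  then show ?thesis
    using L_isotropic[OF U_components(2)[OF assms(1)] U_components(2)[OF assms(2)]] by simp
qed

lemma Qm_X_in_V:
  assumes "x \<in> X"
  shows "Qm x \<in> V"
proof -
  have "cinner (Qm x) f = 0" if f: "f \<in> F" for f
  proof -
    obtain n where n: "n \<in> N" "f = \<gamma> n"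
      using f by (auto simp: F_def)
    have "cinner (Qm x) f = cinner x f"
      by (rule cinner_spec_proj_left[OF F_supp[OF f]])
    also have "\<dots> = 0"
      unfolding n(2) using n(1) assms by (intro X_isotropic) (auto simp: N_def)
    finally show ?thesis .
  qed
  then show ?thesis
    by (simp add: V_def supp_spec_proj)
qed

section \<open>The operator of the graph\<close>

text \<open>
  The nonpositive part of the point to be found must be \<open>u - \<gamma> l'\<close> for some \<open>l' \<in> L\<close>. The solvability
  condition prescribes the pairing of \<open>l'\<close> with \<open>L\<close>: it must be \<open>\<phi>\<close>, which is well-defined since
  \<open>u\<close> is orthogonal to \<open>F = \<gamma> N\<close>. So \<open>l'\<close> exists. Removing the component in \<open>N\<close> brings the point to
  \<open>u + \<gamma> U\<close>.
\<close>
lemma exists_graph_point: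
  assumes u: "u \<in> U" "u \<in> Hh"
  shows "\<exists>w\<in>U. u + \<gamma> w \<in> X"
proof -
  define \<phi> where "\<phi> l = cinner (\<gamma> (Qp (SOME x. x \<in> W \<and> Qz x = l))) u" for l
  have \<phi>: "\<phi> (Qz x) = cinner (\<gamma> (Qp x)) u" if x: "x \<in> W" for x
  proof -
    define y where "y = (SOME y. y \<in> W \<and> Qz y = Qz x)"
    have y: "y \<in> W" "Qz y = Qz x"
      using someI[of "\<lambda>y. y \<in> W \<and> Qz y = Qz x" x] x by (simp_all add: y_def)
    have W: "y - x \<in> W"
      by (rule csubspace_diff[OF csubspace_W y(1) x])
    then have yx: "y - x = Qp y - Qp x"
      using Qz_W[OF W] y(2) by (simp add: spec_proj_diff)
    then have "supp (y - x) {0<..}"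
      by (simp add: supp_diff supp_spec_proj)
    then have "y - x \<in> N"
      using W by (simp add: N_def W_def)
    then have "cinner u (\<gamma> (y - x)) = 0"
      using U_ortho_F[OF u(1)] by (simp add: F_def)
    then have "cinner (\<gamma> (Qp y - Qp x)) u = 0"
      using yx cinner_eq_0_commute by metis
    then have "cinner (\<gamma> (Qp y)) u = cinner (\<gamma> (Qp x)) u"
      by (simp add: gamma_diff cinner_simps)
    then show ?thesis
      unfolding \<phi>_def y_def .
  qed
  have "\<exists>z\<in>L. \<forall>l\<in>L. \<phi> l = cinner l z"
  proof (rule riesz_finite_dimensional)
    show "finite_dimensional L"
      by (rule finite_dimensional_subset_ker[OF csubspace_L]) (use L_supp in \<open>auto simp: ker_eq\<close>)
    fix l assume "l \<in> L"
    then obtain x where x: "x \<in> W" "l = Qz x"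
      by (auto simp: L_def)
    show "\<phi> (c *\<^sub>C l) = c * \<phi> l" for c
      using \<phi>[OF csubspace_scale[OF csubspace_W x(1)], of c] \<phi>[OF x(1)]
      by (simp add: x(2) spec_proj_scaleC gamma_scaleC cinner_simps)
    fix l' assume "l' \<in> L"
    then obtain x' where x': "x' \<in> W" "l' = Qz x'"
      by (auto simp: L_def)
    show "\<phi> (l + l') = \<phi> l + \<phi> l'"
      using \<phi>[OF csubspace_add[OF csubspace_W x(1) x'(1)]] \<phi>[OF x(1)] \<phi>[OF x'(1)]
      by (simp add: x(2) x'(2) spec_proj_add gamma_add cinner_simps)
  qed
  then obtain l' where l': "l' \<in> L" "\<And>l. l \<in> L \<Longrightarrow> \<phi> l = cinner l l'"
    by blast
  have gl': "supp (\<gamma> l') {0}"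
    by (rule gamma_L_supp[OF l'(1)])
  have "\<exists>y\<in>X. Qle y = u - \<gamma> l'"
  proof (rule exists_X_with_nonpositive_part)
    show "supp (u - \<gamma> l') {..0}"
      by (intro supp_diff U_supp[OF u(1)] supp_mono[OF gl']) auto
    show "u - \<gamma> l' \<in> Hh"
      by (intro Hh_diff u(2) ker_subset_Hh[OF gl'])
    fix x assume "x \<in> X" "supp x {0..}"
    then have x: "x \<in> W"
      by (simp add: W_def)
    have "cinner (\<gamma> (Qp x)) u = cinner (Qz x) l'"
      using \<phi>[OF x] l'(2)[of "Qz x"] x by (simp add: L_def)
    then have "cinner u (\<gamma> (Qp x)) = cinner l' (Qz x)"
      by (metis cinner_commute)
    moreover have "cinner u (\<gamma> (Qz x)) = 0"
      using u(1) x by (simp add: U_def L_def)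
    moreover have "cinner u (\<gamma> x) = cinner u (\<gamma> (Qz x)) + cinner u (\<gamma> (Qp x))"
      using Qz_W[OF x] by (metis cinner_add_right gamma_add)
    moreover have "cinner (\<gamma> l') (\<gamma> x) = cinner l' (Qz x)"
    proof -
      have "cinner l' x = cinner l' (Qz x)"
        using cinner_spec_proj_left[OF L_supp[OF l'(1)], of x] by (metis cinner_commute)
      then show ?thesis
        by (simp add: cinner_gamma_gamma)
    qed
    ultimately show "cinner (u - \<gamma> l') (\<gamma> x) = 0"
      by (simp add: cinner_diff_left)
  qed
  then obtain y where y: "y \<in> X" "Qle y = u - \<gamma> l'"
    by blast
  define n where "n = orth_proj N y"
  have n: "n \<in> N"
    unfolding n_def by (rule orth_proj_in[OF csubspace_N closed_N])
  have nX: "n \<in> X" "supp n {0<..}"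
    using n by (simp_all add: N_def)
  define y' where "y' = y - n"
  have y'X: "y' \<in> X"
    unfolding y'_def by (rule csubspace_diff[OF csubspace_X y(1) nX(1)])
  have y'N: "cinner y' k = 0" if "k \<in> N" for k
    unfolding y'_def n_def by (rule orth_proj_ortho[OF csubspace_N closed_N that])
  have "Qle n = 0"
    by (rule spec_proj_eq_0[OF nX(2)]) auto
  then have "Qle y' = u - \<gamma> l'"
    using y(2) by (simp add: y'_def spec_proj_diff)
  then have y'_eq: "y' = u - \<gamma> l' + Qp y'"
    using eq_Qle_Qp by metis
  define w where "w = - (l' + \<gamma> (Qp y'))"
  have w_supp: "supp (\<gamma> (Qp y')) {..<0}"
    by (rule supp_gamma[OF supp_spec_proj]) auto
  have "w \<in> U"
    unfolding U_def
  proof (intro CollectI conjI ballI)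
    show "supp w {..0}"
      unfolding w_def by (intro supp_minus supp_add supp_mono[OF L_supp[OF l'(1)]] supp_mono[OF w_supp]) auto
    fix f assume f: "f \<in> F"
    then obtain k where k: "k \<in> N" "f = \<gamma> k"
      by (auto simp: F_def)
    have "cinner l' f = 0"
      by (rule cinner_supp_eq_0[OF L_supp[OF l'(1)] F_supp[OF f]]) auto
    moreover have "cinner (Qp y') k = cinner y' k"
      by (rule cinner_spec_proj_left) (use k in \<open>simp add: N_def\<close>)
    ultimately show "cinner w f = 0"
      using y'N[OF k(1)] by (simp add: w_def cinner_simps k(2) cinner_gamma_gamma)
  next
    fix l assume l: "l \<in> L"
    have "cinner (\<gamma> (Qp y')) (\<gamma> l) = 0"
      by (rule cinner_supp_eq_0[OF w_supp gamma_L_supp[OF l]]) auto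
    then show "cinner w (\<gamma> l) = 0"
      using L_isotropic[OF l'(1) l] by (simp add: w_def cinner_simps)
  qed
  moreover have "u + \<gamma> w = y'"
    by (subst y'_eq) (simp add: w_def gamma_simps)
  ultimately show ?thesis
    using y'X by metis
qed

text \<open>
  The difference \<open>d\<close> satisfies \<open>\<gamma> d \<in> W\<close>. So the kernel part of \<open>d\<close> is in \<open>\<gamma> L\<close>, but also in \<open>L\<close>,
  hence zero; then \<open>\<gamma> d\<close> is in \<open>N\<close> and \<open>d\<close> in \<open>F\<close>, which is orthogonal to \<open>U\<close>.
\<close>
lemma graph_point_unique:
  assumes "w \<in> U" "w' \<in> U" "u + \<gamma> w \<in> X" "u + \<gamma> w' \<in> X"
  shows "w = w'"
proof -
  define d where "d = w - w'"
  have dU: "d \<in> U"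
    unfolding d_def by (rule csubspace_diff[OF csubspace_U assms(1,2)])
  have "\<gamma> d = (u + \<gamma> w) - (u + \<gamma> w')"
    by (simp add: d_def gamma_diff)
  then have gd: "\<gamma> d \<in> X"
    using csubspace_diff[OF csubspace_X assms(3,4)] by simp
  then have gW: "\<gamma> d \<in> W"
    using gamma_U_supp[OF dU] by (simp add: W_def)
  have Qzg: "Qz (\<gamma> d) = \<gamma> (Qz d)"
    by (rule components_eqI) (simp add: P_spec_proj P_gamma)
  have "\<gamma> (Qz d) \<in> L"
    unfolding Qzg[symmetric] L_def using gW by blast
  then have "cinner d (\<gamma> (\<gamma> (Qz d))) = 0"
    using dU by (simp add: U_def)
  then have "cinner d (Qz d) = 0"
    by (simp add: gamma_gamma)
  moreover have "cinner (Qz d) (Qz d) = cinner d (Qz d)"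
    by (rule cinner_spec_proj_left[OF supp_spec_proj])
  ultimately have "Qz d = 0"
    by simp
  then have "supp d {..<0}"
    using U_components(3)[OF dU] supp_spec_proj[of "{..<0}" d] by simp
  then have "supp (\<gamma> d) {0<..}"
    by (rule supp_gamma) auto
  then have "\<gamma> d \<in> N"
    using gd by (simp add: N_def)
  then have "\<gamma> (\<gamma> d) \<in> F"
    by (simp add: F_def)
  then have "cinner d (\<gamma> (\<gamma> d)) = 0"
    by (rule U_ortho_F[OF dU])
  then have "d = 0"
    by (simp add: gamma_gamma)
  then show ?thesis
    by (simp add: d_def)
qed

definition g0 :: "'h \<Rightarrow> 'h" where "g0 u = (THE w. w \<in> U \<and> u + \<gamma> w \<in> X)"

lemma g0_eqI: "w \<in> U \<Longrightarrow> u + \<gamma> w \<in> X \<Longrightarrow> g0 u = w"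
  unfolding g0_def using graph_point_unique by blast

lemma
  assumes "u \<in> U" "u \<in> Hh"
  shows g0_U: "g0 u \<in> U" and g0_X: "u + \<gamma> (g0 u) \<in> X" and g0_Hh: "g0 u \<in> Hh"
proof -
  obtain w where w: "w \<in> U" "u + \<gamma> w \<in> X"
    using exists_graph_point[OF assms] by blast
  show "g0 u \<in> U" and X: "u + \<gamma> (g0 u) \<in> X"
    using w g0_eqI by metis+
  have "\<gamma> (g0 u) \<in> Hh"
    using Hh_diff[OF X_Hh[OF X] assms(2)] by simp
  then have "- \<gamma> (\<gamma> (g0 u)) \<in> Hh"
    by (rule Hh_minus[OF gamma_Hh])
  then show "g0 u \<in> Hh"
    by (simp add: gamma_gamma)
qed

lemma g0_add:
  assumes "u \<in> U" "u \<in> Hh" "v \<in> U" "v \<in> Hh"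
  shows "g0 (u + v) = g0 u + g0 v"
proof (rule g0_eqI)
  show "g0 u + g0 v \<in> U"
    by (intro csubspace_add[OF csubspace_U] g0_U assms)
  have "(u + \<gamma> (g0 u)) + (v + \<gamma> (g0 v)) \<in> X"
    by (intro csubspace_add[OF csubspace_X] g0_X assms)
  then show "u + v + \<gamma> (g0 u + g0 v) \<in> X"
    by (simp add: gamma_add algebra_simps)
qed

lemma g0_scaleC:
  assumes "u \<in> U" "u \<in> Hh"
  shows "g0 (c *\<^sub>C u) = c *\<^sub>C g0 u"
proof (rule g0_eqI)
  show "c *\<^sub>C g0 u \<in> U"
    by (intro csubspace_scale[OF csubspace_U] g0_U assms)
  have "c *\<^sub>C (u + \<gamma> (g0 u)) \<in> X"
    by (intro csubspace_scale[OF csubspace_X] g0_X assms)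
  then show "c *\<^sub>C u + \<gamma> (c *\<^sub>C g0 u) \<in> X"
    by (simp add: gamma_scaleC scaleC_add_right)
qed

lemma g0_symmetric:
  assumes u: "u \<in> U" "u \<in> Hh" and v: "v \<in> U" "v \<in> Hh"
  shows "cinner (g0 u) v = cinner u (g0 v)"
proof -
  have "cinner (u + \<gamma> (g0 u)) (\<gamma> (v + \<gamma> (g0 v))) = 0"
    by (rule X_isotropic[OF g0_X[OF u] g0_X[OF v]])
  then show ?thesis
    using U_isotropic[OF u(1) v(1)] U_isotropic[OF g0_U[OF u] g0_U[OF v]]
    by (simp add: gamma_simps cinner_gamma_left cinner_simps)
qed

lemma g0_diff:
  assumes "u \<in> U" "u \<in> Hh" "v \<in> U" "v \<in> Hh"
  shows "g0 (u - v) = g0 u - g0 v"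
proof -
  have "u - v \<in> U" "u - v \<in> Hh"
    using assms csubspace_U csubspace_diff Hh_diff by blast+
  then show ?thesis
    using g0_add[of "u - v" v] assms by (simp add: algebra_simps)
qed

abbreviation "PU \<equiv> orth_proj U"

lemmas PU_in = orth_proj_in[OF csubspace_U closed_U]
lemmas cinner_PU = cinner_orth_proj[OF csubspace_U closed_U]
lemmas PU_id = orth_proj_id[OF csubspace_U]
lemmas bounded_linear_PU = bounded_linear_orth_proj[OF csubspace_U closed_U]

text \<open>
  The projection to \<open>U\<close> differs from the one to the nonpositive part only by projections to
  finite dimensional subspaces of \<open>H\<^bsup>1/2\<^esup>\<close>.
\<close>
lemma PU_Hh:
  assumes "x \<in> Hh"
  shows "PU x \<in> Hh"
proof -
  define f where "f = orth_proj F (Qm x)"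
  define l where "l = orth_proj L (Qz x)"
  have f: "f \<in> F" and l: "l \<in> L"
    unfolding f_def l_def by (rule orth_proj_in csubspace_F closed_F csubspace_L closed_L)+
  define y where "y = Qm x - f + l"
  have "PU x = y"
  proof (rule orth_proj_eqI[OF csubspace_U])
    have "Qm x - f \<in> V"
      unfolding V_def f_def using orth_proj_ortho[OF csubspace_F closed_F]
        supp_diff[OF supp_spec_proj F_supp[OF f], unfolded f_def] by simp
    then show "y \<in> U"
      unfolding y_def by (intro csubspace_add[OF csubspace_U] V_subset_U L_subset_U l)
    fix u assume u: "u \<in> U"
    have "cinner (Qp x) u = 0"
      by (rule cinner_supp_eq_0[OF supp_spec_proj U_supp[OF u]]) auto
    moreover have "cinner f u = 0"
      using U_ortho_F[OF u f] cinner_eq_0_commute by blast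
    moreover have "cinner (Qz x - l) u = 0"
    proof -
      have "cinner (Qz x - l) (Qz u) = 0"
        unfolding l_def by (rule orth_proj_ortho[OF csubspace_L closed_L U_components(2)[OF u]])
      moreover have "cinner (Qz x - l) (Qm u) = 0"
        by (rule cinner_supp_eq_0[OF supp_diff[OF supp_spec_proj L_supp[OF l]] supp_spec_proj]) auto
      ultimately show ?thesis
        by (subst U_components(3)[OF u]) (simp add: cinner_add_right)
    qed
    moreover have "x - y = Qp x + f + (Qz x - l)"
      using eq_Qm_Qz_Qp[of x] by (simp add: y_def algebra_simps)
    ultimately show "cinner (x - y) u = 0"
      by (simp add: cinner_add_left)
  qed
  then show ?thesis
    using assms F_Hh[OF f] L_Hh[OF l] by (simp add: y_def Hh_add Hh_diff spec_proj_Hh)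
qed

text \<open>
  The argument of Hellinger and Toeplitz, with two norms. By symmetry, \<open>\<langle>Lam (g0 u), trunc n z\<rangle>\<close> is
  the inner product of \<open>u\<close> with a fixed vector, thus a bounded functional of \<open>Lam u\<close>; for fixed \<open>u\<close> these
  functionals are bounded uniformly in \<open>n\<close> and in \<open>z\<close> of norm at most \<open>1\<close>.
\<close>
lemma g0_Lam_bounded: "\<exists>C. \<forall>u\<in>U \<inter> Hh. norm (Lam (g0 u)) \<le> C * norm (Lam u)"
proof -
  \<comment> \<open>\<open>U \<inter> H\<^bsup>1/2\<^esup>\<close> with its own norm is the image of the Hilbert space \<open>SU\<close> under \<open>Li\<close>\<close>
  define SU where "SU = {a. Li a \<in> U}"
  have subSU: "csubspace SU"
    unfolding SU_def using csubspace_U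
    by (auto simp: csubspace_def Li_add Li_scaleC linear_simps(3)[OF bounded_linear_Li])
  have closedSU: "closed SU"
  proof -
    have "SU = Li -` U"
      by (auto simp: SU_def)
    then show ?thesis
      using continuous_closed_vimage[OF closed_U linear_continuous_at[OF bounded_linear_Li]] by (simp only:)
  qed
  \<comment> \<open>replacing \<open>z\<close> outside of the unit ball by \<open>0\<close> allows all pairs \<open>(n, z)\<close> as indices\<close>
  define yv where "yv n z = PU (Lam (trunc n (if norm z \<le> 1 then z else 0)))" for n :: nat and z :: 'h
  have LT: "Lam (trunc n z) \<in> Hh" for n z
  proof -
    have "trunc n (Lam (trunc n z)) = Lam (trunc n z)"
      by (rule components_eqI) (simp add: P_trunc P_Lam trunc_Hh)
    then show ?thesis
      by (metis trunc_Hh)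
  qed
  have yv: "yv n z \<in> U" "yv n z \<in> Hh" for n z
    unfolding yv_def by (rule PU_in PU_Hh LT)+
  define T where "T i a = cinner (Li (orth_proj SU a)) (g0 (yv (fst i) (snd i)))" for i :: "nat \<times> 'h" and a
  have lin: "bounded_linear (T i)" for i
    unfolding T_def
    by (intro bounded_linear_compose[OF bounded_linear_cinner_left]
        bounded_linear_compose[OF bounded_linear_Li] bounded_linear_orth_proj subSU closedSU)
  have T_eq: "cinner u (g0 (yv n z)) = cinner (Lam (g0 u)) (trunc n z)"
    if "u \<in> U" "u \<in> Hh" "norm z \<le> 1" for u n z
  proof -
    have "cinner u (g0 (yv n z)) = cinner (g0 u) (yv n z)"
      using g0_symmetric[OF that(1,2) yv] by simp
    also have "\<dots> = cinner (PU (g0 u)) (Lam (trunc n z))"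
      using that(3) by (simp add: yv_def cinner_PU)
    also have "PU (g0 u) = g0 u"
      by (rule PU_id[OF g0_U[OF that(1,2)]])
    also have "cinner (g0 u) (Lam (trunc n z)) = cinner (Lam (g0 u)) (trunc n z)"
      by (rule cinner_Lam[symmetric, OF g0_Hh[OF that(1,2)] trunc_Hh])
    finally show ?thesis .
  qed
  have "\<exists>K. \<forall>i. norm (T i a) \<le> K" for a
  proof -
    define u where "u = Li (orth_proj SU a)"
    have u: "u \<in> U" "u \<in> Hh"
      using orth_proj_in[OF subSU closedSU, of a] Li_Hh by (auto simp: u_def SU_def)
    have "norm (T (n, z) a) \<le> norm (Lam (g0 u))" for n z
    proof -
      define z' where "z' = (if norm z \<le> 1 then z else 0)"
      have z': "norm z' \<le> 1"
        by (simp add: z'_def)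
      have "T (n, z) a = cinner u (g0 (yv n z'))"
        by (simp add: T_def u_def yv_def z'_def)
      also have "\<dots> = cinner (Lam (g0 u)) (trunc n z')"
        by (rule T_eq[OF u z'])
      finally have "norm (T (n, z) a) \<le> norm (Lam (g0 u)) * norm (trunc n z')"
        using norm_cinner_le by simp
      also have "\<dots> \<le> norm (Lam (g0 u)) * 1"
        using norm_trunc_le[of n z'] z' by (intro mult_left_mono) auto
      finally show ?thesis by simp
    qed
    then show ?thesis
      by (metis surj_pair)
  qed
  then obtain C where C: "\<And>i a. norm (T i a) \<le> C * norm a"
    using banach_steinhaus[of T, OF lin] by blast
  have "norm (Lam (g0 u)) \<le> C * norm (Lam u)" if u: "u \<in> U" "u \<in> Hh" for u
  proof (cases "Lam (g0 u) = 0")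
    case True
    have "0 \<le> C * norm (Lam u)"
      using C[of undefined "Lam u"] norm_ge_zero order_trans by blast
    then show ?thesis
      using True by simp
  next
    case False
    define y where "y = Lam (g0 u)"
    define z where "z = (1 / norm y) *\<^sub>R y"
    have z: "norm z \<le> 1"
      using False by (simp add: z_def y_def)
    have SUu: "Lam u \<in> SU"
      using u by (simp add: SU_def Li_Lam)
    have "cmod (cinner y (trunc n z)) \<le> C * norm (Lam u)" for n
      using C[of "(n, z)" "Lam u"] T_eq[OF u z, of n] u
      by (simp add: T_def orth_proj_id[OF subSU SUu] Li_Lam y_def)
    moreover have "(\<lambda>n. cmod (cinner y (trunc n z))) \<longlonglongrightarrow> cmod (cinner y z)"
      by (intro tendsto_norm tendsto_cinner tendsto_const trunc_tendsto)
    ultimately have "cmod (cinner y z) \<le> C * norm (Lam u)"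
      using LIMSEQ_le_const2 by blast
    moreover have "cinner y z = complex_of_real (norm y)"
      using False by (simp add: z_def y_def cinner_simps cinner_self power2_eq_square)
    ultimately show ?thesis
      by (simp add: y_def)
  qed
  then show ?thesis
    by blast
qed

text \<open>
  With \<open>v k = g0\<^sup>k u\<close>, symmetry gives \<open>\<parallel>v (k+1)\<parallel>\<^sup>2 = \<langle>v k, v (k+2)\<rangle>\<close>, so the norms are
  logarithmically convex, and they are bounded by the norms of \<open>Lam (v k)\<close>, which grow at most
  like \<open>C\<^sup>k\<close>.
\<close>
lemma g0_bounded: "\<exists>C>0. \<forall>u\<in>U \<inter> Hh. norm (g0 u) \<le> C * norm u"
proof -
  obtain C0 where C0: "\<And>u. u \<in> U \<Longrightarrow> u \<in> Hh \<Longrightarrow> norm (Lam (g0 u)) \<le> C0 * norm (Lam u)"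
    using g0_Lam_bounded by blast
  define C where "C = max 1 C0"
  have C: "C > 0" "norm (Lam (g0 u)) \<le> C * norm (Lam u)" if "u \<in> U" "u \<in> Hh" for u
    using C0[OF that] mult_right_mono[of C0 C "norm (Lam u)"] by (auto simp: C_def)
  have "norm (g0 u) \<le> C * norm u" if u: "u \<in> U" "u \<in> Hh" for u
  proof -
    define v where "v k = (g0 ^^ k) u" for k
    have v: "v k \<in> U \<and> v k \<in> Hh" for k
      by (induction k) (use u g0_U g0_Hh in \<open>auto simp: v_def\<close>)
    have vS: "v (Suc k) = g0 (v k)" for k
      by (simp add: v_def)
    have "norm (v 1) \<le> C * norm (v 0)"
    proof (rule log_convex_growth)
      fix k
      have "cinner (v (Suc k)) (v (Suc k)) = cinner (v k) (v (Suc (Suc k)))"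
        using g0_symmetric[of "v k" "v (Suc k)"] v[of k] v[of "Suc k"] by (simp add: vS)
      then have "(norm (v (Suc k)))\<^sup>2 = cmod (cinner (v k) (v (Suc (Suc k))))"
        using arg_cong[OF cinner_self[of "v (Suc k)"], of cmod] by (simp add: norm_power)
      then show "(norm (v (Suc k)))\<^sup>2 \<le> norm (v k) * norm (v (Suc (Suc k)))"
        using norm_cinner_le by simp
      have "norm (Lam (v k)) \<le> norm (Lam u) * C ^ k"
      proof (induction k)
        case (Suc k)
        have "norm (Lam (v (Suc k))) \<le> C * norm (Lam (v k))"
          unfolding vS using C(2) v by blast
        also have "\<dots> \<le> C * (norm (Lam u) * C ^ k)"
          using Suc C(1)[OF u] by (intro mult_left_mono) auto
        finally show ?case
          by (simp add: algebra_simps)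
      qed (simp add: v_def)
      then show "norm (v k) \<le> norm (Lam u) * C ^ k"
        using norm_le_Lam v order_trans by blast
    qed (use C(1)[OF u] in auto)
    then show ?thesis
      by (simp add: v_def)
  qed
  moreover have "C > 0"
    by (simp add: C_def)
  ultimately show ?thesis
    by blast
qed

text \<open>
  Approximations in \<open>U \<inter> H\<^bsup>1/2\<^esup>\<close>, used to extend \<open>g0\<close> by continuity.
\<close>
definition J :: "nat \<Rightarrow> 'h \<Rightarrow> 'h" where "J n u = PU (trunc n u)"

lemma J_U: "J n u \<in> U" and J_Hh: "J n u \<in> Hh"
  unfolding J_def by (rule PU_in PU_Hh trunc_Hh)+

lemma J_tendsto: "u \<in> U \<Longrightarrow> (\<lambda>n. J n u) \<longlonglongrightarrow> u"
  using bounded_linear.tendsto[OF bounded_linear_PU trunc_tendsto, of u] by (simp add: J_def PU_id)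

lemma J_add: "J n (u + v) = J n u + J n v"
  by (simp add: J_def trunc_add orth_proj_add[OF csubspace_U closed_U])

lemma J_scaleC: "J n (c *\<^sub>C u) = c *\<^sub>C J n u"
  by (simp add: J_def trunc_scaleC orth_proj_scaleC[OF csubspace_U closed_U])

definition g :: "'h \<Rightarrow> 'h" where "g u = lim (\<lambda>n. g0 (J n u))"

lemma g_tendsto:
  assumes "u \<in> U"
  shows "(\<lambda>n. g0 (J n u)) \<longlonglongrightarrow> g u"
proof -
  obtain C where C: "C > 0" "\<And>u. u \<in> U \<Longrightarrow> u \<in> Hh \<Longrightarrow> norm (g0 u) \<le> C * norm u"
    using g0_bounded by blast
  have "dist (g0 (J m u)) (g0 (J n u)) \<le> dist (C *\<^sub>R J m u) (C *\<^sub>R J n u)" for m n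
  proof -
    have "J m u - J n u \<in> U" "J m u - J n u \<in> Hh"
      by (intro csubspace_diff[OF csubspace_U] Hh_diff J_U J_Hh)+
    then have "norm (g0 (J m u - J n u)) \<le> C * norm (J m u - J n u)"
      by (rule C(2))
    then show ?thesis
      using C(1) unfolding dist_norm scaleR_diff_right[symmetric] norm_scaleR g0_diff[OF J_U J_Hh J_U J_Hh] by simp
  qed
  moreover have "Cauchy (\<lambda>n. C *\<^sub>R J n u)"
    by (intro LIMSEQ_imp_Cauchy[OF tendsto_scaleR[OF tendsto_const J_tendsto[OF assms]]])
  ultimately have "Cauchy (\<lambda>n. g0 (J n u))"
    unfolding Cauchy_def by (meson le_less_trans)
  then show ?thesis
    unfolding g_def using Cauchy_convergent_iff convergent_LIMSEQ_iff by blast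
qed

lemma g_U: "u \<in> U \<Longrightarrow> g u \<in> U"
  by (rule closed_sequentially[OF closed_U g0_U[OF J_U J_Hh] g_tendsto])

lemma g_eq_g0:
  assumes "u \<in> U" "u \<in> Hh"
  shows "g u = g0 u"
proof -
  obtain C where C: "C > 0" "\<And>u. u \<in> U \<Longrightarrow> u \<in> Hh \<Longrightarrow> norm (g0 u) \<le> C * norm u"
    using g0_bounded by blast
  have "norm (g0 (J n u) - g0 u) \<le> C * norm (J n u - u)" for n
  proof -
    have "J n u - u \<in> U" "J n u - u \<in> Hh"
      by (intro csubspace_diff[OF csubspace_U] Hh_diff J_U J_Hh assms)+
    then have "norm (g0 (J n u - u)) \<le> C * norm (J n u - u)"
      by (rule C(2))
    then show ?thesis
      by (simp add: g0_diff J_U J_Hh assms)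
  qed
  moreover have "(\<lambda>n. C * norm (J n u - u)) \<longlonglongrightarrow> C * norm (u - u)"
    by (intro tendsto_intros J_tendsto assms)
  then have "(\<lambda>n. C * norm (J n u - u)) \<longlonglongrightarrow> 0"
    by simp
  ultimately have "(\<lambda>n. g0 (J n u) - g0 u) \<longlonglongrightarrow> 0"
    by (intro Lim_null_comparison[of "\<lambda>n. g0 (J n u) - g0 u" "\<lambda>n. C * norm (J n u - u)"]) auto
  then have "(\<lambda>n. g0 (J n u)) \<longlonglongrightarrow> g0 u"
    by (simp add: LIM_zero_iff)
  then show ?thesis
    using g_tendsto[OF assms(1)] LIMSEQ_unique by blast
qed

lemma g_add:
  assumes "u \<in> U" "v \<in> U"
  shows "g (u + v) = g u + g v"
proof (rule LIMSEQ_unique)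
  show "(\<lambda>n. g0 (J n (u + v))) \<longlonglongrightarrow> g (u + v)"
    by (intro g_tendsto csubspace_add[OF csubspace_U] assms)
  show "(\<lambda>n. g0 (J n (u + v))) \<longlonglongrightarrow> g u + g v"
    unfolding J_add g0_add[OF J_U J_Hh J_U J_Hh] by (intro tendsto_add g_tendsto assms)
qed

lemma g_scaleC:
  assumes "u \<in> U"
  shows "g (c *\<^sub>C u) = c *\<^sub>C g u"
proof (rule LIMSEQ_unique)
  show "(\<lambda>n. g0 (J n (c *\<^sub>C u))) \<longlonglongrightarrow> g (c *\<^sub>C u)"
    by (intro g_tendsto csubspace_scale[OF csubspace_U] assms)
  show "(\<lambda>n. g0 (J n (c *\<^sub>C u))) \<longlonglongrightarrow> c *\<^sub>C g u"
    unfolding J_scaleC g0_scaleC[OF J_U J_Hh] by (intro tendsto_scaleC g_tendsto assms)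
qed

lemma g_symmetric:
  assumes "u \<in> U" "v \<in> U"
  shows "cinner (g u) v = cinner u (g v)"
proof (rule LIMSEQ_unique)
  show "(\<lambda>n. cinner (g0 (J n u)) (J n v)) \<longlonglongrightarrow> cinner (g u) v"
    by (intro tendsto_cinner g_tendsto J_tendsto assms)
  show "(\<lambda>n. cinner (g0 (J n u)) (J n v)) \<longlonglongrightarrow> cinner u (g v)"
    unfolding g0_symmetric[OF J_U J_Hh J_U J_Hh] by (intro tendsto_cinner g_tendsto J_tendsto assms)
qed

lemma g_bounded: "\<exists>C. \<forall>u\<in>U. norm (g u) \<le> C * norm u"
proof -
  obtain C where C: "C > 0" "\<And>u. u \<in> U \<Longrightarrow> u \<in> Hh \<Longrightarrow> norm (g0 u) \<le> C * norm u"
    using g0_bounded by blast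
  have "norm (g u) \<le> C * norm u" if u: "u \<in> U" for u
  proof (rule LIMSEQ_le)
    show "(\<lambda>n. norm (g0 (J n u))) \<longlonglongrightarrow> norm (g u)"
      by (intro tendsto_norm g_tendsto u)
    show "(\<lambda>n. C * norm (J n u)) \<longlonglongrightarrow> C * norm u"
      by (intro tendsto_intros J_tendsto u)
    show "\<exists>N. \<forall>n\<ge>N. norm (g0 (J n u)) \<le> C * norm (J n u)"
      using C(2)[OF J_U J_Hh] by blast
  qed
  then show ?thesis
    by blast
qed

lemma bc_data_of_half_lag: "bc_data D A \<gamma> L F V g"
  unfolding bc_data_def sum_set_V_L
proof (intro conjI)
  show "lagrangian D A \<gamma> L" "csubspace F" "csubspace V" "sum_set F V = H_neg D A" "finite_dimensional F"
    by (rule lagrangian_L csubspace_F csubspace_V sum_set_F_V finite_dimensional_F)+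
  show "orthogonal_sets F V"
    unfolding orthogonal_sets_def V_def using cinner_eq_0_commute by blast
  show "F \<subseteq> sob_spec D A (1 / 2) {..<0}"
  proof
    fix f assume "f \<in> F"
    then show "f \<in> sob_spec D A (1 / 2) {..<0}"
      unfolding sob_spec_def using spec_proj_id[OF F_supp] F_Hh by (metis image_eqI)
  qed
  have gH: "g ` (U \<inter> Hh) \<subseteq> U \<inter> Hh"
    using g_eq_g0 g0_U g0_Hh by auto
  show adj: "is_adjoint_on U g g"
    unfolding is_adjoint_on_def using g_U g_symmetric by blast
  have "bounded_endo U g"
    unfolding bounded_endo_def clinear_on_def using g_U g_add g_scaleC g_bounded by blast
  then show "half_smooth D A U g"
    unfolding half_smooth_def using csubspace_U closed_U gH adj by blast
qed

text \<open>
  An element of \<open>X\<close> orthogonal to \<open>N\<close> is \<open>u + \<gamma> w\<close> with \<open>u\<close> and \<open>w\<close> in \<open>U\<close>: its negative part is in \<open>V\<close> by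
  isotropy, its positive part is in \<open>\<gamma> V\<close>, and its kernel part splits along \<open>L\<close> and \<open>\<gamma> L\<close>. By
  uniqueness, \<open>w = g0 u\<close>.
\<close>
lemma X_eq_bc: "X = sum_set (\<gamma> ` F) (bc_graph D A \<gamma> L V g)"
proof
  have FN: "\<gamma> ` F = N"
  proof
    show "\<gamma> ` F \<subseteq> N"
      using csubspace_N csubspace_neg by (auto simp: F_def gamma_gamma)
    show "N \<subseteq> \<gamma> ` F"
    proof
      fix n assume n: "n \<in> N"
      then have "- n \<in> N"
        using csubspace_N csubspace_neg by blast
      then have "\<gamma> (\<gamma> (- n)) \<in> \<gamma> ` F"
        by (simp add: F_def)
      then show "n \<in> \<gamma> ` F"
        by (simp add: gamma_gamma)
    qed
  qed
  have graph: "bc_graph D A \<gamma> L V g = {w + \<gamma> (g0 w) | w. w \<in> U \<and> w \<in> Hh}"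
    unfolding bc_graph_def sum_set_V_L by (intro Collect_cong ex_cong1) (auto simp: g_eq_g0)
  show "sum_set (\<gamma> ` F) (bc_graph D A \<gamma> L V g) \<subseteq> X"
    unfolding FN graph sum_set_def
    by (auto simp: N_def intro!: csubspace_add[OF csubspace_X _ g0_X])
  show "X \<subseteq> sum_set (\<gamma> ` F) (bc_graph D A \<gamma> L V g)"
  proof
    fix x assume x: "x \<in> X"
    define n where "n = orth_proj N x"
    have n: "n \<in> N"
      unfolding n_def by (rule orth_proj_in[OF csubspace_N closed_N])
    have nX: "n \<in> X" "supp n {0<..}"
      using n by (simp_all add: N_def)
    define y where "y = x - n"
    have yX: "y \<in> X"
      unfolding y_def by (rule csubspace_diff[OF csubspace_X x nX(1)])
    have yN: "cinner y k = 0" if "k \<in> N" for k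
      unfolding y_def n_def by (rule orth_proj_ortho[OF csubspace_N closed_N that])
    obtain l l' where l: "l \<in> L" "l' \<in> L" "Qz y = l + \<gamma> l'"
      using lagrangian_data(4)[OF lagrangian_L supp_spec_proj] by blast
    define u where "u = Qm y + l"
    have uU: "u \<in> U"
      unfolding u_def by (intro csubspace_add[OF csubspace_U] V_subset_U[OF Qm_X_in_V[OF yX]] L_subset_U l)
    have uH: "u \<in> Hh"
      unfolding u_def by (intro Hh_add spec_proj_Hh X_Hh yX L_Hh l)
    have s: "supp (\<gamma> (Qp y)) {..<0}"
      by (rule supp_gamma[OF supp_spec_proj]) auto
    have "\<gamma> (Qp y) \<in> V"
      unfolding V_def
    proof (intro CollectI conjI ballI s)
      fix f assume "f \<in> F"
      then obtain k where k: "k \<in> N" "f = \<gamma> k"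
        by (auto simp: F_def)
      have "cinner (Qp y) k = cinner y k"
        by (rule cinner_spec_proj_left) (use k in \<open>simp add: N_def\<close>)
      then show "cinner (\<gamma> (Qp y)) f = 0"
        using yN[OF k(1)] by (simp add: k(2) cinner_gamma_gamma)
    qed
    then have w: "l' - \<gamma> (Qp y) \<in> U"
      by (intro csubspace_diff[OF csubspace_U] V_subset_U L_subset_U l)
    have y_eq: "y = u + \<gamma> (l' - \<gamma> (Qp y))"
    proof -
      have "u + \<gamma> (l' - \<gamma> (Qp y)) = Qm y + Qz y + Qp y"
        by (simp add: u_def l(3) gamma_simps add.assoc)
      then show ?thesis
        using eq_Qm_Qz_Qp[of y] by (simp only:)
    qed
    have "g0 u = l' - \<gamma> (Qp y)"
      by (rule g0_eqI[OF w]) (use y_eq yX in simp)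
    then have "y \<in> bc_graph D A \<gamma> L V g"
      unfolding graph using y_eq uU uH by (auto intro!: exI[of _ u])
    moreover have "x = n + y"
      by (simp add: y_def)
    ultimately show "x \<in> sum_set (\<gamma> ` F) (bc_graph D A \<gamma> L V g)"
      unfolding FN sum_set_def using n by blast
  qed
qed

end

section \<open>The completion and the boundary space\<close>

text \<open>
  The isometry \<open>\<Theta>\<close> is a coordinate system in which \<open>j\<close> becomes \<open>e\<close> and \<open>T\<close> becomes the continuous
  map \<open>h\<close>, so the extension by continuity is \<open>h\<close>. The extensions of \<open>\<iota>\<close>, of the spectral projections,
  of \<open>\<gamma>\<close> and of the Bessel potential are all of this form.
\<close>
lemma cont_ext_eq:
  fixes j :: "'u \<Rightarrow> 'x::metric_space" and T :: "'u \<Rightarrow> 'y::metric_space" and e :: "'u \<Rightarrow> 'z::metric_space"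
  assumes isom: "\<And>a b. dist (\<Theta> a) (\<Theta> b) = dist a b"
    and dense: "closure (e ` S) = UNIV"
    and j: "\<And>u. u \<in> S \<Longrightarrow> j u = \<Theta> (e u)" and T: "\<And>u. u \<in> S \<Longrightarrow> T u = h (e u)"
    and h: "isCont h p"
  shows "cont_ext S j T (\<Theta> p) = h p"
proof -
  define F where "F = inf (filtercomap j (nhds (\<Theta> p))) (principal S)"
  have near: "eventually (\<lambda>u. u \<in> S \<and> dist (e u) p < d) F" if "d > 0" for d
  proof -
    have "eventually (\<lambda>y. dist y (\<Theta> p) < d) (nhds (\<Theta> p))"
      using that eventually_nhds_metric by blast
    then have "eventually (\<lambda>u. dist (j u) (\<Theta> p) < d) (filtercomap j (nhds (\<Theta> p)))"
      by (rule eventually_filtercomapI)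
    then show ?thesis
      unfolding F_def eventually_inf_principal by eventually_elim (auto simp: j isom)
  qed
  have "\<not> trivial_limit F"
  proof
    assume "trivial_limit F"
    then have "eventually (\<lambda>u. u \<in> S \<longrightarrow> False) (filtercomap j (nhds (\<Theta> p)))"
      unfolding trivial_limit_def F_def eventually_inf_principal .
    then obtain Q where Q: "eventually Q (nhds (\<Theta> p))" "\<And>u. Q (j u) \<Longrightarrow> u \<notin> S"
      unfolding eventually_filtercomap by blast
    then obtain d where d: "d > 0" "\<And>y. dist y (\<Theta> p) < d \<Longrightarrow> Q y"
      unfolding eventually_nhds_metric by blast
    obtain u where u: "u \<in> S" "dist (e u) p < d"
      using dense d(1) closure_approachable[of p "e ` S"] by auto
    have "dist (j u) (\<Theta> p) < d"
      using u by (simp add: j isom)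
    then show False
      using Q(2) d(2) u(1) by blast
  qed
  moreover have "(T \<longlongrightarrow> h p) F"
    unfolding tendsto_iff
  proof (intro allI impI)
    fix \<epsilon> :: real assume "\<epsilon> > 0"
    then obtain d where d: "d > 0" "\<And>z. dist z p < d \<Longrightarrow> dist (h z) (h p) < \<epsilon>"
      using h unfolding continuous_at_eps_delta by blast
    show "eventually (\<lambda>u. dist (T u) (h p) < \<epsilon>) F"
      using near[OF d(1)] by eventually_elim (simp add: T d(2))
  qed
  ultimately show ?thesis
    unfolding cont_ext_def F_def[symmetric] by (rule tendsto_Lim)
qed

lemma (in discrete_operator) mem_sob_inf_if_bounded_supp:
  assumes "supp x {- c..c}"
  shows "x \<in> sob_inf D A"
proof -
  have "x \<in> sob D A r" if "r \<ge> 0" for r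
    unfolding sob_def
  proof (rule fun_calc_dom_mono[where f = "\<lambda>_. 1" and C = "\<bar>c\<bar> powr r"])
    show "x \<in> fun_calc_dom D A (\<lambda>_. 1)"
      by (rule fun_calc_dom_bounded[where C = 1]) simp
    show "\<bar>\<bar>t\<bar> powr r\<bar> * norm (P t x) \<le> \<bar>c\<bar> powr r * (\<bar>1\<bar> * norm (P t x))" for t
    proof (cases "t \<in> {- c..c}")
      case True
      then have "\<bar>t\<bar> powr r \<le> \<bar>c\<bar> powr r"
        using that by (intro powr_mono2) auto
      then show ?thesis
        by (simp add: mult_right_mono)
    next
      case False
      then show ?thesis
        using suppD[OF assms] by simp
    qed
  qed
  then show ?thesis
    by (auto simp: sob_inf_def)
qed

lemma (in discrete_operator) csubspace_sob_inf: "csubspace (sob_inf D A)"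
  unfolding sob_inf_def sob_def by (rule csubspace_Inter) (auto simp: csubspace_fun_calc_dom)

lemma (in discrete_operator) spec_proj_sob_inf: "u \<in> sob_inf D A \<Longrightarrow> spec_proj D A J u \<in> sob_inf D A"
proof -
  have "spec_proj D A J u \<in> fun_calc_dom D A f" if "u \<in> fun_calc_dom D A f" for f
    by (rule fun_calc_dom_mono[OF that, where C = 1]) (simp add: P_spec_proj)
  then show "u \<in> sob_inf D A \<Longrightarrow> spec_proj D A J u \<in> sob_inf D A"
    unfolding sob_inf_def sob_def by blast
qed

lemma (in dirac) gamma_sob_inf: "u \<in> sob_inf D A \<Longrightarrow> \<gamma> u \<in> sob_inf D A"
  unfolding sob_inf_def sob_def by (auto intro!: gamma_fun_calc_dom)

locale dirac_completion = dirac D A \<gamma>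
  for D :: "'h::complex_hilbert set" and A and \<gamma> :: "'h \<Rightarrow> 'h" +
  fixes \<iota> :: "'h \<Rightarrow> 'k::complex_hilbert"
  assumes completion: "is_sob_completion D A (-1/2) \<iota>"
begin

abbreviation "Hinf \<equiv> sob_inf D A"

lemma iota_add: "x \<in> Hinf \<Longrightarrow> y \<in> Hinf \<Longrightarrow> \<iota> (x + y) = \<iota> x + \<iota> y"
  and iota_scaleC: "x \<in> Hinf \<Longrightarrow> \<iota> (c *\<^sub>C x) = c *\<^sub>C \<iota> x"
  and norm_iota: "x \<in> Hinf \<Longrightarrow> norm (\<iota> x) = norm (Li x)"
  and dense_iota: "closure (\<iota> ` Hinf) = UNIV"
  using completion unfolding is_sob_completion_def clinear_on_def sob_norm_def Li_def by blast+

lemma iota_diff: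
  assumes "x \<in> Hinf" "y \<in> Hinf"
  shows "\<iota> (x - y) = \<iota> x - \<iota> y"
proof -
  have "x - y \<in> Hinf"
    using assms csubspace_sob_inf csubspace_diff by blast
  then have "\<iota> x = \<iota> (x - y) + \<iota> y"
    using iota_add[of "x - y" y] assms by simp
  then show ?thesis
    by simp
qed

lemma trunc_sob_inf: "trunc n x \<in> Hinf"
  unfolding trunc_def by (rule mem_sob_inf_if_bounded_supp[OF supp_spec_proj])

lemma Lam_trunc_sob_inf: "Lam (trunc n x) \<in> Hinf"
proof (rule mem_sob_inf_if_bounded_supp)
  show "supp (Lam (trunc n x)) {- real n..real n}"
    using supp_Lam[OF trunc_Hh, of n x] supp_spec_proj[of "{- real n..real n}" x] by (simp add: trunc_def)
qed

lemma Li_Lam_trunc: "Li (Lam (trunc n x)) = trunc n x"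
  by (rule Li_Lam[OF trunc_Hh])

text \<open>
  The isometry of \<open>H\<close> onto \<open>H\<^bsup>-1/2\<^esup>\<close> that extends \<open>\<iota> \<circ> Lam\<close>; it is the inverse of \<open>bessel_ext\<close>.
\<close>
definition \<Theta> :: "'h \<Rightarrow> 'k" where "\<Theta> p = lim (\<lambda>n. \<iota> (Lam (trunc n p)))"

lemma Theta_tendsto: "(\<lambda>n. \<iota> (Lam (trunc n p))) \<longlonglongrightarrow> \<Theta> p"
proof -
  have "dist (\<iota> (Lam (trunc m p))) (\<iota> (Lam (trunc n p))) = dist (trunc m p) (trunc n p)" for m n
  proof -
    have "Lam (trunc m p) - Lam (trunc n p) \<in> Hinf"
      using Lam_trunc_sob_inf csubspace_sob_inf csubspace_diff by blast
    then show ?thesis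
      unfolding dist_norm iota_diff[OF Lam_trunc_sob_inf Lam_trunc_sob_inf, symmetric]
      by (simp add: norm_iota Li_diff Li_Lam_trunc)
  qed
  moreover have "Cauchy (\<lambda>n. trunc n p)"
    by (rule LIMSEQ_imp_Cauchy[OF trunc_tendsto])
  ultimately have "Cauchy (\<lambda>n. \<iota> (Lam (trunc n p)))"
    unfolding Cauchy_def by simp
  then show ?thesis
    unfolding \<Theta>_def using Cauchy_convergent_iff convergent_LIMSEQ_iff by blast
qed

lemma Theta_add: "\<Theta> (p + q) = \<Theta> p + \<Theta> q"
proof (rule LIMSEQ_unique[OF Theta_tendsto])
  have "\<iota> (Lam (trunc n (p + q))) = \<iota> (Lam (trunc n p)) + \<iota> (Lam (trunc n q))" for n
    by (simp add: trunc_add Lam_add trunc_Hh iota_add Lam_trunc_sob_inf)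
  then show "(\<lambda>n. \<iota> (Lam (trunc n (p + q)))) \<longlonglongrightarrow> \<Theta> p + \<Theta> q"
    using tendsto_add[OF Theta_tendsto[of p] Theta_tendsto[of q]] by simp
qed

lemma Theta_scaleC: "\<Theta> (c *\<^sub>C p) = c *\<^sub>C \<Theta> p"
proof (rule LIMSEQ_unique[OF Theta_tendsto])
  have "\<iota> (Lam (trunc n (c *\<^sub>C p))) = c *\<^sub>C \<iota> (Lam (trunc n p))" for n
    by (simp add: trunc_scaleC Lam_scaleC trunc_Hh iota_scaleC Lam_trunc_sob_inf)
  then show "(\<lambda>n. \<iota> (Lam (trunc n (c *\<^sub>C p)))) \<longlonglongrightarrow> c *\<^sub>C \<Theta> p"
    using tendsto_scaleC[OF Theta_tendsto[of p], of c] by simp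
qed

lemma norm_Theta: "norm (\<Theta> p) = norm p"
proof (rule LIMSEQ_unique)
  show "(\<lambda>n. norm (\<iota> (Lam (trunc n p)))) \<longlonglongrightarrow> norm (\<Theta> p)"
    by (rule tendsto_norm[OF Theta_tendsto])
  show "(\<lambda>n. norm (\<iota> (Lam (trunc n p)))) \<longlonglongrightarrow> norm p"
    using tendsto_norm[OF trunc_tendsto[of p]] by (simp add: norm_iota Lam_trunc_sob_inf Li_Lam_trunc)
qed

lemma bounded_linear_Theta: "bounded_linear \<Theta>"
  by (rule bounded_linear_intro[where K = 1]) (simp_all add: Theta_add Theta_scaleC scaleR_eq_scaleC norm_Theta)

lemmas Theta_diff = linear_simps(2)[OF bounded_linear_Theta]

lemma Theta_isometry: "dist (\<Theta> p) (\<Theta> q) = dist p q"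
  by (simp add: dist_norm Theta_diff[symmetric] norm_Theta)

lemma Theta_inject: "\<Theta> p = \<Theta> q \<longleftrightarrow> p = q"
  by (metis Theta_isometry dist_eq_0_iff)

lemma Theta_Li: "u \<in> Hinf \<Longrightarrow> \<Theta> (Li u) = \<iota> u"
proof (rule LIMSEQ_unique[OF Theta_tendsto])
  assume u: "u \<in> Hinf"
  have "Lam (trunc n (Li u)) = trunc n u" for n
    by (rule components_eqI) (simp add: P_Lam trunc_Hh P_trunc P_Li lam_neq_0)
  moreover have "(\<lambda>n. \<iota> (trunc n u) - \<iota> u) \<longlonglongrightarrow> 0"
  proof (rule Lim_null_comparison)
    have "norm (\<iota> (trunc n u) - \<iota> u) \<le> norm (trunc n u - u)" for n
    proof -
      have "trunc n u - u \<in> Hinf"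
        using trunc_sob_inf u csubspace_sob_inf csubspace_diff by blast
      then show ?thesis
        unfolding iota_diff[OF trunc_sob_inf u, symmetric] by (simp add: norm_iota norm_Li_le)
    qed
    then show "\<forall>\<^sub>F n in sequentially. norm (\<iota> (trunc n u) - \<iota> u) \<le> norm (trunc n u - u)"
      by simp
    have "(\<lambda>n. norm (trunc n u - u)) \<longlonglongrightarrow> norm (u - u)"
      by (intro tendsto_intros trunc_tendsto)
    then show "(\<lambda>n. norm (trunc n u - u)) \<longlonglongrightarrow> 0"
      by simp
  qed
  ultimately show "(\<lambda>n. \<iota> (Lam (trunc n (Li u)))) \<longlonglongrightarrow> \<iota> u"
    by (simp add: LIM_zero_iff)
qed

text \<open>
  The range is complete, hence closed, and contains the dense image of \<open>\<iota>\<close>.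
\<close>
lemma range_Theta: "range \<Theta> = UNIV"
proof -
  have "closed (range \<Theta>)"
  proof (rule closed_sequential_limits[THEN iffD2], intro allI impI)
    fix y l assume y: "(\<forall>n. y n \<in> range \<Theta>) \<and> y \<longlonglongrightarrow> l"
    then have "\<forall>n. \<exists>p. y n = \<Theta> p"
      by blast
    then obtain p where p: "\<And>n. y n = \<Theta> (p n)"
      by metis
    have "Cauchy y"
      using y LIMSEQ_imp_Cauchy by blast
    then have "Cauchy p"
      unfolding Cauchy_def p Theta_isometry .
    then obtain q where "p \<longlonglongrightarrow> q"
      using Cauchy_convergent_iff convergent_def by blast
    then have "y \<longlonglongrightarrow> \<Theta> q"
      using bounded_linear.tendsto[OF bounded_linear_Theta] unfolding p[abs_def] by blast
    then show "l \<in> range \<Theta>"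
      using y LIMSEQ_unique by blast
  qed
  moreover have "\<iota> ` Hinf \<subseteq> range \<Theta>"
    using Theta_Li by (metis image_subsetI rangeI)
  ultimately have "closure (\<iota> ` Hinf) \<subseteq> range \<Theta>"
    by (rule closure_minimal[rotated])
  then show ?thesis
    using dense_iota by blast
qed

lemma dense_sob_inf: "closure ((\<lambda>u. u) ` Hinf) = UNIV"
proof -
  have "x \<in> closure ((\<lambda>u. u) ` Hinf)" for x
    unfolding closure_sequential using trunc_sob_inf trunc_tendsto[of x] by (intro exI[of _ "\<lambda>n. trunc n x"]) auto
  then show ?thesis
    by auto
qed

lemma dense_Li_sob_inf: "closure (Li ` Hinf) = UNIV"
proof -
  have mem: "trunc n x \<in> Li ` Hinf" for n x
    using imageI[OF Lam_trunc_sob_inf[of n x], of Li] by (simp only: Li_Lam_trunc)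
  have "x \<in> closure (Li ` Hinf)" for x
    unfolding closure_sequential by (intro exI[of _ "\<lambda>n. trunc n x"] conjI allI mem trunc_tendsto)
  then show ?thesis
    by auto
qed

lemma isCont_bounded_linear: "bounded_linear f \<Longrightarrow> isCont f x"
  by (rule linear_continuous_at)

lemma emb_eq: "emb D A \<iota> x = \<Theta> (Li x)"
  unfolding emb_def
  by (rule cont_ext_eq[where \<Theta> = "\<lambda>u. u" and e = "\<lambda>u. u" and h = "\<lambda>x. \<Theta> (Li x)"])
    (simp_all add: dense_sob_inf[simplified] Theta_Li isCont_bounded_linear
      bounded_linear_compose[OF bounded_linear_Theta bounded_linear_Li])

lemma spec_proj_ext_Theta: "spec_proj_ext D A \<iota> J (\<Theta> p) = \<Theta> (spec_proj D A J p)"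
  unfolding spec_proj_ext_def
proof (rule cont_ext_eq[where \<Theta> = \<Theta> and e = Li and h = "\<lambda>p. \<Theta> (spec_proj D A J p)"])
  show "isCont (\<lambda>p. \<Theta> (spec_proj D A J p)) p"
    by (intro isCont_bounded_linear bounded_linear_compose[OF bounded_linear_Theta bounded_linear_spec_proj])
  show "\<iota> (spec_proj D A J u) = \<Theta> (spec_proj D A J (Li u))" if "u \<in> Hinf" for u
  proof -
    have "spec_proj D A J (Li u) = Li (spec_proj D A J u)"
      by (rule components_eqI) (simp add: P_spec_proj P_Li)
    then show ?thesis
      using Theta_Li[OF spec_proj_sob_inf[OF that]] by simp
  qed
qed (simp_all add: Theta_isometry dense_Li_sob_inf Theta_Li)

lemma gamma_ext_Theta: "gamma_ext D A \<gamma> \<iota> (\<Theta> p) = \<Theta> (\<gamma> p)"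
  unfolding gamma_ext_def
proof (rule cont_ext_eq[where \<Theta> = \<Theta> and e = Li and h = "\<lambda>p. \<Theta> (\<gamma> p)"])
  show "isCont (\<lambda>p. \<Theta> (\<gamma> p)) p"
    by (intro isCont_bounded_linear bounded_linear_compose[OF bounded_linear_Theta bounded_linear_gamma])
  show "\<iota> (\<gamma> u) = \<Theta> (\<gamma> (Li u))" if "u \<in> Hinf" for u
    using Theta_Li[OF gamma_sob_inf[OF that]] by (simp add: Li_gamma)
qed (simp_all add: Theta_isometry dense_Li_sob_inf Theta_Li)

lemma bessel_ext_Theta: "bessel_ext D A \<iota> (\<Theta> p) = p"
  unfolding bessel_ext_def Li_def[symmetric]
  by (rule cont_ext_eq[where \<Theta> = \<Theta> and e = Li and h = "\<lambda>p. p"])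
    (simp_all add: Theta_isometry dense_Li_sob_inf Theta_Li)

lemma from_half_emb: "x \<in> Hh \<Longrightarrow> from_half D A \<iota> (emb D A \<iota> x) = x"
  unfolding from_half_def
proof (rule inv_into_f_f)
  show "inj_on (emb D A \<iota>) Hh"
    by (rule inj_onI) (metis emb_eq Theta_inject Lam_Li)
qed

text \<open>
  The inverse of the flattening. In the coordinates of \<open>\<Theta>\<close>, elements of \<open>H\<^bsup>1/2\<^esup>\<close> are those of the form
  \<open>Li (Li a)\<close>.
\<close>
definition \<Psi> :: "'h \<Rightarrow> 'k" where "\<Psi> a = \<Theta> (Li (Li (Qle a)) + Qp a)"

lemma Psi_diff: "\<Psi> (a - b) = \<Psi> a - \<Psi> b"
  unfolding \<Psi>_def Theta_diff[symmetric] by (simp add: spec_proj_diff Li_diff algebra_simps)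

lemma Psi_inject: "\<Psi> a = \<Psi> b \<longleftrightarrow> a = b"
proof
  assume "\<Psi> a = \<Psi> b"
  then have eq: "Li (Li (Qle a)) + Qp a = Li (Li (Qle b)) + Qp b"
    by (simp add: \<Psi>_def Theta_inject)
  show "a = b"
  proof (rule components_eqI)
    fix t
    have "P t (Li (Li (Qle a)) + Qp a) = P t (Li (Li (Qle b)) + Qp b)"
      using eq by simp
    then show "P t a = P t b"
      using lam_neq_0[of t] by (simp add: P_add P_Li P_spec_proj split: if_splits)
  qed
qed simp

lemma Qle_parts: "spec_proj D A {..0} (Li (Li (Qle a)) + Qp a) = Li (Li (Qle a))"
  and Qp_parts: "spec_proj D A {0<..} (Li (Li (Qle a)) + Qp a) = Qp a"
  and Qm_parts: "spec_proj D A {..<0} (Li (Li (Qle a)) + Qp a) = Li (Li (Qm a))"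
  and Qge_parts: "spec_proj D A {0..} (Li (Li (Qle a)) + Qp a) = spec_proj D A {0..} a"
proof -
  have "P t (spec_proj D A {0..} (Li (Li (Qle a)) + Qp a)) = P t (spec_proj D A {0..} a)" for t
    by (cases t "0::real" rule: linorder_cases) (simp_all add: P_spec_proj P_add P_Li lam_0)
  then show "spec_proj D A {0..} (Li (Li (Qle a)) + Qp a) = spec_proj D A {0..} a"
    by (rule components_eqI)
qed (rule components_eqI, simp add: P_spec_proj P_add P_Li)+

lemma Psi_emb: "\<Theta> (Li (Li (Qle a))) = emb D A \<iota> (Li (Qle a))"
  by (simp add: emb_eq)

lemma emb_eq_Psi_M: "x \<in> Hh \<Longrightarrow> emb D A \<iota> x = \<Psi> (M x)"
proof -
  assume x: "x \<in> Hh"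
  have "Li x = Li (Li (Qle (M x))) + Qp (M x)"
    by (rule components_eqI) (simp add: P_Li P_add P_spec_proj P_M[OF x] weight_def lam_neq_0)
  then show ?thesis
    by (simp add: emb_eq \<Psi>_def)
qed

lemma check_H_eq: "check_H D A \<iota> = range \<Psi>"
proof
  show "check_H D A \<iota> \<subseteq> range \<Psi>"
  proof
    fix y assume "y \<in> check_H D A \<iota>"
    then obtain x k where "x \<in> Hh" "y = emb D A \<iota> (Qle x) + spec_proj_ext D A \<iota> {0<..} k"
      unfolding check_H_def sum_set_def sob_spec_def by blast
    moreover obtain q where "k = \<Theta> q"
      using range_Theta by (metis UNIV_I imageE)
    ultimately have x: "x \<in> Hh" "y = \<Theta> (Li (Qle x) + Qp q)"
      by (simp_all add: emb_eq spec_proj_ext_Theta Theta_add)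
    define a where "a = Lam (Qle x) + Qp q"
    have QH: "Qle x \<in> Hh"
      by (rule spec_proj_Hh[OF x(1)])
    have "Li (Li (Qle a)) + Qp a = Li (Qle x) + Qp q"
      by (rule components_eqI) (simp add: a_def P_Li P_add P_spec_proj P_Lam[OF QH] lam_neq_0)
    then have "y = \<Psi> a"
      by (simp only: \<Psi>_def x(2))
    then show "y \<in> range \<Psi>"
      by blast
  qed
  show "range \<Psi> \<subseteq> check_H D A \<iota>"
  proof
    fix y assume "y \<in> range \<Psi>"
    then obtain a where a: "y = \<Psi> a"
      by blast
    have "Li (Qle a) = Qle (Li a)"
      by (rule components_eqI) (simp add: P_Li P_spec_proj)
    then have "Li (Qle a) \<in> sob_spec D A (1/2) {..0}"
      unfolding sob_spec_def using imageI[OF Li_Hh[of a], of Qle] by simp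
    then have "emb D A \<iota> (Li (Qle a)) \<in> emb D A \<iota> ` sob_spec D A (1/2) {..0}"
      by (rule imageI)
    moreover have "y = emb D A \<iota> (Li (Qle a)) + spec_proj_ext D A \<iota> {0<..} (\<Theta> a)"
      by (simp add: a \<Psi>_def Theta_add emb_eq spec_proj_ext_Theta)
    ultimately show "y \<in> check_H D A \<iota>"
      unfolding check_H_def sum_set_def by blast
  qed
qed

lemma check_norm_Psi: "check_norm D A \<iota> (\<Psi> a) = norm a"
proof -
  have "cinner (Qle a) (Qp a) = 0"
    by (rule cinner_supp_eq_0[OF supp_spec_proj supp_spec_proj]) auto
  then have n: "(norm a)\<^sup>2 = (norm (Qle a))\<^sup>2 + (norm (Qp a))\<^sup>2"
    using norm_add_orthogonal eq_Qle_Qp by metis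
  show ?thesis
    unfolding check_norm_def \<Psi>_def spec_proj_ext_Theta Qle_parts Qp_parts Psi_emb
      from_half_emb[OF Li_Hh] sob_norm_def Lam_Li norm_Theta
    unfolding n[symmetric] by simp
qed

text \<open>
  In both pairings the weights cancel, and the two terms are the pairings of \<open>\<gamma> b\<close> with the
  nonpositive and the positive part of \<open>a\<close>.
\<close>
lemma omega_Psi: "omega D A \<gamma> \<iota> (\<Psi> a) (\<Psi> b) = cinner a (\<gamma> b)"
proof -
  have 1: "cinner (Qle a) (\<gamma> (spec_proj D A {0..} b)) = cinner (Qle a) (\<gamma> b)"
    by (rule cinner_eqI) (simp add: P_spec_proj P_gamma)
  have 2: "cinner (Qp a) (\<gamma> (Qm b)) = cinner (Qp a) (\<gamma> b)"
    by (rule cinner_eqI) (simp add: P_spec_proj P_gamma)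
  have "\<gamma> (Li (Li (Qm b))) = Li (Li (\<gamma> (Qm b)))"
    by (simp add: Li_gamma)
  then have 3: "\<Theta> (\<gamma> (Li (Li (Qm b)))) = emb D A \<iota> (Li (\<gamma> (Qm b)))"
    by (simp add: emb_eq)
  have "omega D A \<gamma> \<iota> (\<Psi> a) (\<Psi> b) = cinner (Qle a) (\<gamma> (spec_proj D A {0..} b)) + cinner (Qp a) (\<gamma> (Qm b))"
    unfolding omega_def pairing_pos_def pairing_neg_def \<Psi>_def spec_proj_ext_Theta Qle_parts Qp_parts Qm_parts
      Qge_parts gamma_ext_Theta bessel_ext_Theta Psi_emb 3 from_half_emb[OF Li_Hh] Lam_Li ..
  also have "\<dots> = cinner a (\<gamma> b)"
    unfolding 1 2 cinner_add_left[symmetric] eq_Qle_Qp[symmetric] ..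
  finally show ?thesis .
qed

lemma regular_selfadjoint_of_half_lag:
  assumes "half_lag X"
  shows "regular_selfadjoint_bc D A \<gamma> \<iota> (emb D A \<iota> ` X)"
proof -
  interpret half_lagrangian D A \<gamma> X
    by unfold_locales (rule assms)
  let ?B = "emb D A \<iota> ` X"
  have B_eq: "?B = \<Psi> ` S"
    unfolding S_def image_image using X_Hh emb_eq_Psi_M by (intro image_cong) auto
  have "complex_vector.subspace ?B"
    using csubspace_X unfolding csubspace_def
    by (auto simp: emb_eq Theta_add[symmetric] Theta_scaleC[symmetric] Li_add[symmetric] Li_scaleC[symmetric])
      (metis image_eqI linear_simps(3)[OF bounded_linear_Li] linear_simps(3)[OF bounded_linear_Theta])
  moreover have "?B \<subseteq> check_H D A \<iota>"
    unfolding B_eq check_H_eq by blast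
  moreover have "x \<in> ?B" if x: "x \<in> check_H D A \<iota>" and u: "\<forall>n. u n \<in> ?B"
    "(\<lambda>n. check_norm D A \<iota> (u n - x)) \<longlonglongrightarrow> 0" for u :: "nat \<Rightarrow> 'k" and x
  proof -
    obtain a where a: "x = \<Psi> a"
      using x by (auto simp: check_H_eq)
    have "\<forall>n. \<exists>s. s \<in> S \<and> u n = \<Psi> s"
      using u(1) unfolding B_eq by blast
    then obtain s where s: "\<And>n. s n \<in> S" "\<And>n. u n = \<Psi> (s n)"
      by metis
    have "(\<lambda>n. norm (s n - a)) \<longlonglongrightarrow> 0"
      using u(2) by (simp add: s(2) a Psi_diff[symmetric] check_norm_Psi)
    then have "s \<longlonglongrightarrow> a"
      by (simp add: tendsto_norm_zero_iff LIM_zero_iff)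
    then have "a \<in> S"
      using closed_sequentially[OF closed_S] s(1) by blast
    then show ?thesis
      unfolding B_eq a by blast
  qed
  ultimately have "boundary_condition D A \<iota> ?B"
    unfolding boundary_condition_def by blast
  moreover have "regular_condition D A \<iota> ?B"
    unfolding regular_condition_def H_half_def using X_Hh by blast
  moreover have "adjoint_condition D A \<gamma> \<iota> ?B = \<Psi> ` S"
    unfolding adjoint_condition_def check_H_eq using X_Hh
    by (auto simp: emb_eq_Psi_M omega_Psi S_iff)
  then have "selfadjoint_condition D A \<gamma> \<iota> ?B"
    unfolding selfadjoint_condition_def B_eq by simp
  ultimately show ?thesis
    unfolding regular_selfadjoint_bc_def by blast
qed

text \<open>
  Through \<open>\<Psi>\<close>, the equation \<open>B = B\<^sup>a\<close> is literally the defining equation of \<open>half_lag\<close>.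
\<close>
lemma half_lag_of_regular_selfadjoint:
  assumes "regular_selfadjoint_bc D A \<gamma> \<iota> B"
  shows "\<exists>X. half_lag X \<and> B = emb D A \<iota> ` X"
proof -
  have sub: "complex_vector.subspace B" and B: "B \<subseteq> H_half D A \<iota>" "B = adjoint_condition D A \<gamma> \<iota> B"
    using assms unfolding regular_selfadjoint_bc_def boundary_condition_def regular_condition_def
      selfadjoint_condition_def by blast+
  define X where "X = {x \<in> Hh. emb D A \<iota> x \<in> B}"
  have BX: "B = emb D A \<iota> ` X"
    using B(1) unfolding X_def H_half_def by blast
  have X_Hh: "x \<in> Hh" if "x \<in> X" for x
    using that by (simp add: X_def)
  have emb_add: "emb D A \<iota> (x + y) = emb D A \<iota> x + emb D A \<iota> y"
    and emb_scaleC: "emb D A \<iota> (c *\<^sub>C x) = c *\<^sub>C emb D A \<iota> x" for x y c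
    by (simp_all add: emb_eq Li_add Li_scaleC Theta_add Theta_scaleC)
  have emb_0: "emb D A \<iota> 0 = 0"
    using emb_add[of 0 0] by simp
  have "csubspace X"
    unfolding csubspace_def X_def
    using sub by (auto simp: emb_add emb_scaleC emb_0 Hh_zero Hh_add Hh_scaleC
        csubspace_0 csubspace_add csubspace_scale)
  moreover have "M ` X = {b. \<forall>x\<in>X. cinner (M x) (\<gamma> b) = 0}"
  proof -
    have B_Psi: "B = \<Psi> ` M ` X"
      unfolding BX image_image using X_Hh emb_eq_Psi_M by (intro image_cong) auto
    have "b \<in> M ` X \<longleftrightarrow> \<Psi> b \<in> B" for b
      unfolding B_Psi by (auto simp: Psi_inject)
    also have "\<Psi> b \<in> B \<longleftrightarrow> (\<forall>y\<in>B. omega D A \<gamma> \<iota> y (\<Psi> b) = 0)" for b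
      by (subst (1) B(2)) (simp add: adjoint_condition_def check_H_eq)
    also have "(\<forall>y\<in>B. omega D A \<gamma> \<iota> y (\<Psi> b) = 0) \<longleftrightarrow> (\<forall>x\<in>X. cinner (M x) (\<gamma> b) = 0)" for b
      unfolding B_Psi by (simp add: omega_Psi)
    finally show ?thesis
      by blast
  qed
  ultimately have "half_lag X"
    unfolding half_lag_def using X_Hh by blast
  then show ?thesis
    using BX by blast
qed

end

section \<open>Classification of the boundary conditions\<close>

context dirac
begin

text \<open>
  Take \<open>F = 0\<close>, \<open>V = H\<^sub><\<close> and \<open>g = 0\<close>. The sum \<open>V \<oplus> L\<close> is closed, since it consists of the vectors of
  nonpositive support orthogonal to \<open>\<gamma> L\<close>.
\<close>
lemma exists_bc_data_if_lagrangian: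
  assumes "lagrangian D A \<gamma> L"
  shows "\<exists>F V g. bc_data D A \<gamma> L F V g"
proof -
  note lag = lagrangian_data[OF assms]
  define V where "V = {x. supp x {..<0}}"
  have V: "csubspace V" "closed V"
    unfolding V_def by (rule csubspace_supp closed_supp)+
  have U_eq: "sum_set V L = {u. supp u {..0}} \<inter> {u. \<forall>y\<in>\<gamma> ` L. cinner u y = 0}"
  proof
    have "supp v {..0}" "cinner v (\<gamma> l) = 0" if "v \<in> V" "l \<in> L" for v l
    proof -
      show "supp v {..0}"
        by (rule supp_mono[of v "{..<0}"]) (use that in \<open>auto simp: V_def\<close>)
      have "supp (\<gamma> l) {0}"
        by (rule supp_gamma[OF lag(2)[OF that(2)]]) auto
      then show "cinner v (\<gamma> l) = 0"
        by (intro cinner_supp_eq_0[of v "{..<0}" "\<gamma> l" "{0}"]) (use that in \<open>auto simp: V_def\<close>)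
    qed
    moreover have "supp l {..0}" if "l \<in> L" for l
      by (rule supp_mono[OF lag(2)[OF that]]) auto
    ultimately show "sum_set V L \<subseteq> {u. supp u {..0}} \<inter> {u. \<forall>y\<in>\<gamma> ` L. cinner u y = 0}"
      using lag(3) by (auto simp: sum_set_def cinner_simps intro: supp_add)
    show "{u. supp u {..0}} \<inter> {u. \<forall>y\<in>\<gamma> ` L. cinner u y = 0} \<subseteq> sum_set V L"
    proof
      fix u assume "u \<in> {u. supp u {..0}} \<inter> {u. \<forall>y\<in>\<gamma> ` L. cinner u y = 0}"
      then have u: "supp u {..0}" "\<And>l. l \<in> L \<Longrightarrow> cinner u (\<gamma> l) = 0"
        by auto
      obtain l l' where l: "l \<in> L" "l' \<in> L" "Qz u = l + \<gamma> l'"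
        using lag(4)[OF supp_spec_proj] by blast
      have sl': "supp (\<gamma> l') {0}"
        by (rule supp_gamma[OF lag(2)[OF l(2)]]) auto
      have "cinner (Qz u) (\<gamma> l') = 0"
        using cinner_spec_proj_left[OF sl', of u] u(2)[OF l(2)] by simp
      moreover have "cinner l (\<gamma> l') = 0"
        by (rule lag(3)[OF l(1,2)])
      ultimately have "\<gamma> l' = 0"
        by (simp add: l(3) cinner_add_left del: gamma_eq_0)
      then have "u = Qm u + l"
        using Qle_eq[of u] spec_proj_id[OF u(1)] l(3) by simp
      moreover have "Qm u \<in> V"
        by (simp add: V_def supp_spec_proj)
      ultimately show "u \<in> sum_set V L"
        unfolding sum_set_def using l(1) by blast
    qed
  qed
  have closedU: "closed (sum_set V L)"
    unfolding U_eq by (intro closed_Int closed_supp closed_orthogonal)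
  have subU: "csubspace (sum_set V L)"
    unfolding sum_set_def by (rule csubspace_sums[OF V(1) lag(1)])
  have 0: "0 \<in> sum_set V L" "0 \<in> Hh"
    using subU Hh_zero csubspace_0 by blast+
  have be: "bounded_endo (sum_set V L) (\<lambda>_. 0)"
    unfolding bounded_endo_def clinear_on_def using 0(1) by (auto intro!: exI[of _ 0])
  have adj: "is_adjoint_on (sum_set V L) (\<lambda>_. 0) (\<lambda>_. 0)"
    unfolding is_adjoint_on_def using 0(1) by auto
  have "half_smooth D A (sum_set V L) (\<lambda>_. 0)"
    unfolding half_smooth_def using subU closedU be adj 0 by blast
  moreover have "sum_set {0} V = H_neg D A"
    by (auto simp: sum_set_def H_neg_eq V_def)
  moreover have "0 \<in> sob_spec D A (1/2) {..<0}"
    unfolding sob_spec_def using Hh_zero spec_proj_zero by (metis image_eqI)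
  moreover have "finite_dimensional {0 :: 'h}"
    unfolding finite_dimensional_def using complex_vector.span_empty by (metis finite.emptyI)
  ultimately have "bc_data D A \<gamma> L {0} V (\<lambda>_. 0)"
    unfolding bc_data_def orthogonal_sets_def using assms V(1) adj by (simp add: csubspace_single_0)
  then show ?thesis
    by blast
qed

end

lemma dirac_of_dirac_system:
  assumes "dirac_system D A \<gamma>"
  shows "dirac D A \<gamma>"
proof
  show "selfadjoint_operator D A" "compact (closure {x \<in> D. graph_norm A x \<le> 1})"
    "bounded_endo UNIV \<gamma>" "\<gamma> ` D \<subseteq> D" "is_adjoint_on UNIV \<gamma> (\<lambda>x. - \<gamma> x)"
    using assms unfolding dirac_system_def by blast+
  show "\<gamma> (\<gamma> x) = - x" for x
    using assms unfolding dirac_system_def by (metis minus_minus)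
  show "A (\<gamma> x) + \<gamma> (A x) = 0" if "x \<in> D" for x
    using assms that unfolding dirac_system_def by blast
qed

theorem theorem1p83:
  fixes D :: "'h::{complex_hilbert, second_countable_topology} set"
    and A \<gamma> :: "'h \<Rightarrow> 'h"
    and \<iota> :: "'h \<Rightarrow> 'k::complex_hilbert"
  assumes "dirac_system D A \<gamma>"
    and "is_sob_completion D A (-1/2) \<iota>"
  shows "((\<exists>B. regular_selfadjoint_bc D A \<gamma> \<iota> B) \<longleftrightarrow> hermitian_symplectic D A \<gamma>) \<and>
    (hermitian_symplectic D A \<gamma> \<longrightarrow>
      (\<forall>L F V g. bc_data D A \<gamma> L F V g \<longrightarrow>
         \<gamma> ` F \<inter> bc_graph D A \<gamma> L V g = {0} \<and>
         regular_selfadjoint_bc D A \<gamma> \<iota> (bc_of_data D A \<gamma> \<iota> L F V g)) \<and>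
      (\<forall>B. regular_selfadjoint_bc D A \<gamma> \<iota> B \<longrightarrow>
         (\<exists>L F V g. bc_data D A \<gamma> L F V g \<and> B = bc_of_data D A \<gamma> \<iota> L F V g)))"
proof -
  interpret dirac D A \<gamma>
    by (rule dirac_of_dirac_system[OF assms(1)])
  interpret dirac_completion D A \<gamma> \<iota>
    by unfold_locales (rule assms(2))
  have of_data: "\<gamma> ` F \<inter> bc_graph D A \<gamma> L V g = {0} \<and>
      regular_selfadjoint_bc D A \<gamma> \<iota> (bc_of_data D A \<gamma> \<iota> L F V g)" if "bc_data D A \<gamma> L F V g" for L F V g
    unfolding bc_of_data_def
    using half_lag_of_data[OF that] regular_selfadjoint_of_half_lag by blast
  have to_data: "\<exists>L F V g. bc_data D A \<gamma> L F V g \<and> B = bc_of_data D A \<gamma> \<iota> L F V g"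
    if B: "regular_selfadjoint_bc D A \<gamma> \<iota> B" for B
  proof -
    obtain X where X: "half_lag X" "B = emb D A \<iota> ` X"
      using half_lag_of_regular_selfadjoint[OF B] by blast
    interpret X: half_lagrangian D A \<gamma> X
      by unfold_locales (rule X(1))
    have "B = bc_of_data D A \<gamma> \<iota> X.L X.F X.V X.g"
      unfolding bc_of_data_def X.X_eq_bc[symmetric] by (rule X(2))
    then show ?thesis
      using X.bc_data_of_half_lag by blast
  qed
  have "hermitian_symplectic D A \<gamma>" if "regular_selfadjoint_bc D A \<gamma> \<iota> B" for B
    using to_data[OF that] hermitian_symplectic_if_lagrangian unfolding bc_data_def by blast
  moreover have "\<exists>B. regular_selfadjoint_bc D A \<gamma> \<iota> B" if "hermitian_symplectic D A \<gamma>"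
    using exists_lagrangian[OF that] exists_bc_data_if_lagrangian of_data by blast
  ultimately show ?thesis
    using of_data to_data by blast
qed

end
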